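(* Let $\mathbb{K}$ be a field, let $G$ be a graph on the vertex set $[n]=\{1,\ldots,n\}$, let $S=\mathbb{K}[x_1,\ldots,x_n,y_1,\ldots,y_n]$, and let $J_G\subseteq S$ be the binomial edge ideal of $G$. Let $\varphi$ be a compatible map from the set of all graphs to the set of non-negative integers. Then $$\operatorname{reg} S/J_G\leq \varphi(G).$$
   Context: All graphs are finite and simple (undirected, no loops, no multiple edges), with an arbitrary finite vertex set; the graph with no vertices is allowed. $\mathbb{N}_0$ denotes the set of non-negative integers, and $\mathcal{G}$ denotes the set of all graphs. The binomial edge ideal of a graph $G$ on $[n]$ is the ideal $J_G$ of $S=\mathbb{K}[x_1,\ldots,x_n,y_1,\ldots,y_n]$ generated by all binomials $f_{ij}=x_iy_j-x_jy_i$ with $i<j$ and $\{i,j\}\in E(G)$. The Castelnuovo-Mumford regularity is $\operatorname{reg} S/J_G=\max\{j-i : \beta_{i,j}(S/J_G)\neq 0\}$, where $\beta_{i,j}(S/J_G)$ are the graded Betti numbers of $S/J_G$ over the standard graded polynomial ring $S$. Notation for graphs. $K_t$ is the complete graph on $t$ vertices, and $\dot{\cup}$ denotes disjoint union of graphs. $\widehat{G}$ is the induced subgraph of $G$ obtained by deleting all isolated vertices of $G$. For $v\in V(G)$, $G-v$ is the induced subgraph of $G$ on $V(G)\setminus\{v\}$, $N_G(v)$ is the set of neighbours of $v$ in $G$, and $G_v$ is the graph with vertex set $V(G)$ and edge set $E(G)\cup\{\{u,w\} : \{u,w\}\subseteq N_G(v),\ u\neq w\}$. Compatible map. A map $\varphi:\mathcal{G}\to\mathbb{N}_0$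 is called compatible if it satisfies the following three conditions: (a) $\varphi(\widehat{G})\leq\varphi(G)$ for every $G\in\mathcal{G}$; (b) if $G=\dot{\cup}_{i=1}^{t}K_{n_i}$ with $n_i\geq 2$ for every $1\leq i\leq t$, then $\varphi(G)\geq t$; (c) if $G$ is not a disjoint union of complete graphs (where components that are single vertices $K_1$ are allowed in such a union), then there exists $v\in V(G)$ such that both (1) $\varphi(G-v)\leq\varphi(G)$ and (2) $\varphi(G_v)<\varphi(G)$. *)

theory Defs
  imports "HOL-Library.Poly_Mapping" "HOL-Library.Disjoint_Sets" "HOL-Algebra.Ideal"
    "Jordan_Normal_Form.Matrix"
begin

section \<open>Graphs\<close>

record 'v graph =
  verts :: "'v set"
  edges :: "'v set set"

definition is_graph :: "'v graph \<Rightarrow> bool" where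
  "is_graph G \<longleftrightarrow> finite (verts G) \<and> (\<forall>e\<in>edges G. e \<subseteq> verts G \<and> card e = 2)"

definition neighbours :: "'v graph \<Rightarrow> 'v \<Rightarrow> 'v set" where
  "neighbours G v = {w. {v, w} \<in> edges G}"

definition all_pairs :: "'v set \<Rightarrow> 'v set set" where
  "all_pairs C = {{u, w} |u w. u \<in> C \<and> w \<in> C \<and> u \<noteq> w}"

definition induced :: "'v graph \<Rightarrow> 'v set \<Rightarrow> 'v graph" where
  "induced G W = \<lparr>verts = W, edges = {e \<in> edges G. e \<subseteq> W}\<rparr>"

definition delete_isolated :: "'v graph \<Rightarrow> 'v graph" where
  "delete_isolated G = induced G {v \<in> verts G. neighbours G v \<noteq> {}}"

definition delete_vertex :: "'v graph \<Rightarrow> 'v \<Rightarrow> 'v graph" where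
  "delete_vertex G v = induced G (verts G - {v})"

text \<open>The graph \<open>G\<^sub>v\<close>.\<close>

definition complete_at :: "'v graph \<Rightarrow> 'v \<Rightarrow> 'v graph" where
  "complete_at G v = \<lparr>verts = verts G, edges = edges G \<union> all_pairs (neighbours G v)\<rparr>"

text \<open>\<open>G\<close> is (isomorphic to) the disjoint union of \<open>K\<^bsub>m 1\<^esub>, \<dots>, K\<^bsub>m t\<^esub>\<close>; the set \<open>C i\<close> is the
  vertex set of the \<open>i\<close>-th summand.\<close>

definition is_disjoint_union_complete :: "'v graph \<Rightarrow> nat \<Rightarrow> (nat \<Rightarrow> nat) \<Rightarrow> bool" where
  "is_disjoint_union_complete G t m \<longleftrightarrow>
     (\<exists>C. (\<forall>i\<in>{1..t}. finite (C i) \<and> card (C i) = m i) \<and>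
          disjoint_family_on C {1..t} \<and>
          verts G = (\<Union>i\<in>{1..t}. C i) \<and>
          edges G = (\<Union>i\<in>{1..t}. all_pairs (C i)))"

definition compatible :: "('v graph \<Rightarrow> nat) \<Rightarrow> bool" where
  "compatible \<phi> \<longleftrightarrow>
     (\<forall>G. is_graph G \<longrightarrow> \<phi> (delete_isolated G) \<le> \<phi> G) \<and>
     (\<forall>G t m. is_graph G \<longrightarrow> (\<forall>i\<in>{1..t}. m i \<ge> 2) \<longrightarrow> is_disjoint_union_complete G t m \<longrightarrow>
        \<phi> G \<ge> t) \<and>
     (\<forall>G. is_graph G \<longrightarrow>
        \<not> (\<exists>t m. (\<forall>i\<in>{1..t}. m i \<ge> 1) \<and> is_disjoint_union_complete G t m) \<longrightarrow>
        (\<exists>v\<in>verts G. \<phi> (delete_vertex G v) \<le> \<phi> G \<and> \<phi> (complete_at G v) < \<phi> G))"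


section \<open>The polynomial ring \<open>K[x\<^sub>i, y\<^sub>i : i \<in> V]\<close>\<close>

datatype indet = IX nat | IY nat

text \<open>Polynomials in all the indeterminates \<open>x\<^sub>i, y\<^sub>i\<close> (\<open>i\<close> a natural number); the ring \<open>S\<close> over a
  vertex set \<open>V\<close> consists of those involving only indeterminates with index in \<open>V\<close>.\<close>

type_synonym 'k mpol = "(indet \<Rightarrow>\<^sub>0 nat) \<Rightarrow>\<^sub>0 'k"

definition indets :: "nat set \<Rightarrow> indet set" where
  "indets V = IX ` V \<union> IY ` V"

definition var :: "indet \<Rightarrow> 'k::field mpol" where
  "var z = Poly_Mapping.single (Poly_Mapping.single z 1) 1"

definition S_ring :: "nat set \<Rightarrow> 'k::field mpol ring" where
  "S_ring V =
     \<lparr>carrier = {p. \<forall>m\<in>Poly_Mapping.keys p. Poly_Mapping.keys m \<subseteq> indets V},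
      monoid.mult = (*), one = 1, zero = 0, add = (+)\<rparr>"

definition mon_degree :: "(indet \<Rightarrow>\<^sub>0 nat) \<Rightarrow> nat" where
  "mon_degree m = (\<Sum>z\<in>Poly_Mapping.keys m. Poly_Mapping.lookup m z)"

text \<open>The zero polynomial is homogeneous of every degree and is the only homogeneous polynomial of
  negative degree.\<close>

definition homogeneous :: "int \<Rightarrow> 'k::field mpol \<Rightarrow> bool" where
  "homogeneous d p \<longleftrightarrow> (\<forall>m\<in>Poly_Mapping.keys p. int (mon_degree m) = d)"

definition irrelevant_ideal :: "nat set \<Rightarrow> 'k::field mpol set" where
  "irrelevant_ideal V = genideal (S_ring V) (var ` indets V)"

definition binomial_edge_ideal :: "nat graph \<Rightarrow> 'k::field mpol set" where
  "binomial_edge_ideal G = genideal (S_ring (verts G))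
     {var (IX i) * var (IY j) - var (IX j) * var (IY i) |i j. i < j \<and> {i, j} \<in> edges G}"


section \<open>Minimal graded free resolutions, Betti numbers and regularity\<close>

definition free_module :: "nat set \<Rightarrow> nat \<Rightarrow> 'k::field mpol vec set" where
  "free_module V b = {v \<in> carrier_vec b. \<forall>k<b. v $ k \<in> carrier (S_ring V)}"

text \<open>A graded \<open>S\<close>-linear map \<open>\<Oplus>\<^sub>c S(-ds!c) \<rightarrow> \<Oplus>\<^sub>r S(-es!r)\<close> of degree 0, as a matrix.\<close>

definition graded_matrix ::
    "nat set \<Rightarrow> int list \<Rightarrow> int list \<Rightarrow> 'k::field mpol mat \<Rightarrow> bool" where
  "graded_matrix V es ds A \<longleftrightarrow>
     A \<in> carrier_mat (length es) (length ds) \<and>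
     (\<forall>r<length es. \<forall>c<length ds.
        A $$ (r, c) \<in> carrier (S_ring V) \<and> homogeneous (ds ! c - es ! r) (A $$ (r, c)))"

text \<open>A minimal graded free resolution
  \<open>\<dots> \<rightarrow> F\<^sub>2 \<rightarrow> F\<^sub>1 \<rightarrow> F\<^sub>0 \<rightarrow> S/I \<rightarrow> 0\<close> of \<open>S/I\<close>, for a homogeneous ideal \<open>I\<close> of \<open>S\<close>.
  Here \<open>F\<^sub>i = \<Oplus>\<^sub>k S(-(d i)!k)\<close>, the matrix \<open>D i\<close> is the map from \<open>F\<close> in position \<open>i + 1\<close> to \<open>F\<^sub>i\<close>, and
  the augmentation sends the \<open>k\<close>-th basis vector of \<open>F\<^sub>0\<close> to the residue class of the homogeneous
  polynomial \<open>a $ k\<close>.  A resolution of finite length has \<open>d i = []\<close> for all large \<open>i\<close>.\<close>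

definition minimal_graded_free_resolution ::
    "nat set \<Rightarrow> 'k::field mpol set \<Rightarrow>
     (nat \<Rightarrow> int list) \<Rightarrow> 'k mpol vec \<Rightarrow> (nat \<Rightarrow> 'k mpol mat) \<Rightarrow> bool" where
  "minimal_graded_free_resolution V I d a D \<longleftrightarrow>
     a \<in> free_module V (length (d 0)) \<and>
     (\<forall>k<length (d 0). homogeneous (d 0 ! k) (a $ k)) \<and>
     (\<forall>i. graded_matrix V (d i) (d (Suc i)) (D i)) \<and>
     (\<forall>p\<in>carrier (S_ring V). \<exists>v\<in>free_module V (length (d 0)). p - a \<bullet> v \<in> I) \<and>
     {v \<in> free_module V (length (d 0)). a \<bullet> v \<in> I} =
       (\<lambda>w. D 0 *\<^sub>v w) ` free_module V (length (d 1)) \<and>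
     (\<forall>i. {v \<in> free_module V (length (d (Suc i))). D i *\<^sub>v v = 0\<^sub>v (length (d i))} =
       (\<lambda>w. D (Suc i) *\<^sub>v w) ` free_module V (length (d (Suc (Suc i))))) \<and>
     (\<forall>i. \<forall>r<length (d i). \<forall>c<length (d (Suc i)). D i $$ (r, c) \<in> irrelevant_ideal V)"

text \<open>The graded Betti number \<open>\<beta>\<^bsub>i,j\<^esub>(S/I)\<close> is the number of summands \<open>S(-j)\<close> of \<open>F\<^sub>i\<close>.  For
  finite \<open>V\<close> and homogeneous \<open>I\<close> a minimal graded free resolution exists and is unique up to
  isomorphism, so the value does not depend on the one chosen.\<close>

definition betti :: "nat set \<Rightarrow> 'k::field mpol set \<Rightarrow> nat \<Rightarrow> int \<Rightarrow> nat" where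
  "betti V I i j =
     count_list ((SOME d. \<exists>a D. minimal_graded_free_resolution V I d a D) i) j"

text \<open>The regularity of \<open>S/I\<close>.  For finite \<open>V\<close> and homogeneous \<open>I \<noteq> S\<close> the set below is finite and
  nonempty.\<close>

definition reg :: "nat set \<Rightarrow> 'k::field mpol set \<Rightarrow> int" where
  "reg V I = Max {j - int i |i j. betti V I i j \<noteq> 0}"

end

theory Submission imports Defs begin

text \<open>
  The regularity of \<open>S/I\<close> is controlled here through Koszul homology instead of resolutions. For a
  homogeneous ideal \<open>I\<close>, let \<open>K(S/I)\<close> be the Koszul complex of \<open>S/I\<close> on all the variables. If the
  homology of \<open>K(S/I)\<close> in homological degree \<open>p\<close> vanishes in all internal degrees above \<open>p + r\<close>,
  then \<open>\<beta>\<^bsub>i,j\<^esub>(S/I) = 0\<close> for \<open>j - i > r\<close>. The predicate \<open>regular X I r\<close> is this vanishing. It passes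
  through short exact sequences by plain diagram chases, which makes a proof by induction possible.

  Let \<open>v\<close> be a vertex as in the third condition of compatibility. Since \<open>x\<^sub>v f\<^bsub>ij\<^esub>\<close> and \<open>y\<^sub>v f\<^bsub>ij\<^esub>\<close> lie in
  \<open>J\<^sub>G\<close> for neighbours \<open>i, j\<close> of \<open>v\<close>, one gets \<open>J\<^sub>G = J\<^bsub>G\<^sub>v\<^esub> \<inter> ((x\<^sub>v, y\<^sub>v) + J\<^bsub>G-v\<^esub>)\<close>, and the sum of the two
  ideals on the right is \<open>(x\<^sub>v, y\<^sub>v) + J\<^bsub>G\<^sub>v\<^esub>\<close>. The exact sequence
  \<open>0 \<rightarrow> S/J\<^sub>G \<rightarrow> S/J\<^bsub>G\<^sub>v\<^esub> \<oplus> S/((x\<^sub>v, y\<^sub>v) + J\<^bsub>G-v\<^esub>) \<rightarrow> S/((x\<^sub>v, y\<^sub>v) + J\<^bsub>G\<^sub>v\<^esub>) \<rightarrow> 0\<close> bounds the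
  regularity of \<open>S/J\<^sub>G\<close> by the largest of \<open>\<phi>(G\<^sub>v)\<close>, \<open>\<phi>(G - v)\<close> and \<open>\<phi>(G\<^sub>v) + 1\<close>, hence by \<open>\<phi>(G)\<close>
  (\<open>regular_vertex_step\<close>). Adding the variables of \<open>v\<close> to an ideal does not increase the regularity
  when setting those variables to zero maps the ideal to itself (\<open>regular_kill\<close>). The induction runs
  on the number of vertices and then on the number of missing edges: \<open>G\<^sub>v\<close> has more edges than \<open>G\<close>
  because \<open>\<phi>(G\<^sub>v) \<noteq> \<phi>(G)\<close>. Vertices outside the graph are harmless, so a single ring \<open>S\<close> serves for all
  graphs that occur.

  The induction ends at disjoint unions of complete graphs. There a vertex \<open>v\<close> of a clique \<open>C\<close> is
  split off: \<open>x\<^sub>v\<close> is a nonzerodivisor, the quotient by \<open>x\<^sub>v\<close> and \<open>y\<^sub>v\<close> belongs to a smaller clique, and the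
  annihilator of \<open>y\<^sub>v\<close> modulo \<open>J + (x\<^sub>v)\<close> is \<open>(x\<^sub>i : i \<in> C)\<close> plus the ideal of the other cliques
  (\<open>regular_clique\<close>).

  The Betti numbers are read off by dimension shifting along an arbitrary minimal resolution
  (\<open>vec_regular_syzygies\<close>, \<open>vec_regular_bound\<close>). That a minimal resolution with finitely generated
  terms exists also follows from the vanishing of Koszul homology: it forces each syzygy module to be
  generated in bounded degree, where everything is a finite-dimensional vector space
  (\<open>finite_generators\<close>).
\<close>

section \<open>Polynomials\<close>

abbreviation "lookup \<equiv> Poly_Mapping.lookup"
abbreviation "keys \<equiv> Poly_Mapping.keys"
abbreviation "single \<equiv> Poly_Mapping.single"

type_synonym mon = "indet \<Rightarrow>\<^sub>0 nat"

definition polys :: "indet set \<Rightarrow> 'k::field mpol set" where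
  "polys X = {p. \<forall>m\<in>keys p. keys m \<subseteq> X}"

lemma keys_add_nat:
  fixes m n :: "'a \<Rightarrow>\<^sub>0 nat"
  shows "keys (m + n) = keys m \<union> keys n"
  by (auto simp: in_keys_iff lookup_add)

lemma polys_0 [simp]: "0 \<in> polys X"
  and polys_1 [simp]: "1 \<in> polys X"
  and polys_const [simp]: "single 0 c \<in> polys X"
  by (auto simp: polys_def)

lemma polys_add: "p \<in> polys X \<Longrightarrow> q \<in> polys X \<Longrightarrow> p + q \<in> polys X"
  using keys_add[of p q] by (force simp: polys_def)

lemma keys_uminus [simp]: "keys (- p) = keys (p :: 'k::field mpol)"
  by (auto simp: in_keys_iff)

lemma polys_uminus: "p \<in> polys X \<Longrightarrow> - p \<in> polys X"
  by (simp add: polys_def)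

lemma polys_diff: "p \<in> polys X \<Longrightarrow> q \<in> polys X \<Longrightarrow> p - q \<in> polys X"
  using polys_add[of p X "- q"] polys_uminus[of q X] by simp

lemma keys_multE:
  fixes p q :: "'k::field mpol"
  assumes "m \<in> keys (p * q)"
  obtains a b where "m = a + b" "a \<in> keys p" "b \<in> keys q"
  using assms keys_mult[of p q] by blast

lemma polys_mult: "p \<in> polys X \<Longrightarrow> q \<in> polys X \<Longrightarrow> p * q \<in> polys X"
  unfolding polys_def by (auto elim!: keys_multE simp: keys_add_nat dest!: bspec)

lemma polys_sum: "(\<And>i. i \<in> A \<Longrightarrow> f i \<in> polys X) \<Longrightarrow> sum f A \<in> polys X"
  by (induction A rule: infinite_finite_induct) (auto intro: polys_add)

lemma polys_power: "p \<in> polys X \<Longrightarrow> p ^ n \<in> polys X"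
  by (induction n) (auto intro: polys_mult)

lemma polys_var: "a \<in> X \<Longrightarrow> var a \<in> polys X"
  by (simp add: polys_def var_def)

lemmas polys_closed = polys_add polys_uminus polys_diff polys_mult polys_sum polys_power polys_var

lemma polys_mono: "X \<subseteq> Y \<Longrightarrow> polys X \<subseteq> polys Y"
  by (auto simp: polys_def)

text \<open>The part of a polynomial supported on the monomials with property \<open>Q\<close>. Setting
  variables to zero and taking homogeneous components are both of this form.\<close>

definition restr :: "(mon \<Rightarrow> bool) \<Rightarrow> 'k::field mpol \<Rightarrow> 'k mpol" where
  "restr Q p = Abs_poly_mapping (\<lambda>m. lookup p m when Q m)"

lemma lookup_restr: "lookup (restr Q p) m = (if Q m then lookup p m else 0)"
proof -
  have "finite {m. (lookup p m when Q m) \<noteq> 0}"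
    by (rule finite_subset[OF _ finite_lookup[of p]]) auto
  then show ?thesis by (simp add: restr_def when_def)
qed

lemma keys_restr: "keys (restr Q p) = {m \<in> keys p. Q m}"
  by (auto simp: in_keys_iff lookup_restr split: if_splits)

lemma restr_0 [simp]: "restr Q 0 = 0"
  and restr_add: "restr Q (p + q) = restr Q p + restr Q q"
  and restr_diff: "restr Q (p - q) = restr Q p - restr Q q"
  and restr_uminus: "restr Q (- p) = - restr Q p"
  by (auto intro!: poly_mapping_eqI simp: lookup_restr lookup_add lookup_minus)

lemma restr_sum: "restr Q (sum f A) = (\<Sum>i\<in>A. restr Q (f i))"
  by (induction A rule: infinite_finite_induct) (auto simp: restr_add)

lemma restr_polys: "p \<in> polys X \<Longrightarrow> restr Q p \<in> polys X"
  by (auto simp: polys_def keys_restr)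

lemma restr_eqI:
  assumes "f = g + h" "\<And>m. m \<in> keys g \<Longrightarrow> Q m" "\<And>m. m \<in> keys h \<Longrightarrow> \<not> Q m"
  shows "restr Q f = g"
proof (rule poly_mapping_eqI)
  fix m
  show "lookup (restr Q f) m = lookup g m"
    using assms(2,3)[of m] by (cases "Q m") (auto simp: assms(1) lookup_restr lookup_add in_keys_iff)
qed

lemma restr_same: "(\<And>m. m \<in> keys p \<Longrightarrow> Q m) \<Longrightarrow> restr Q p = p"
  by (rule restr_eqI[where h=0]) auto

lemma mpol_induct [case_names zero monomial]:
  fixes p :: "'k::field mpol"
  assumes "P 0"
    and "\<And>m c p. P p \<Longrightarrow> P (single m c + p)"
  shows "P p"
proof (induction p rule: update_induct)
  case const then show ?case by (rule assms(1))
next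
  case (update f m c)
  have "Poly_Mapping.update m c f = single m c + f"
    using update(1) by (intro poly_mapping_eqI) (auto simp: lookup_update lookup_add lookup_single when_def in_keys_iff)
  then show ?case using assms(2)[OF update(3)] by simp
qed

lemma single_sub_add:
  "lookup m a \<noteq> 0 \<Longrightarrow> single a (1::nat) + (m - single a 1) = m"
  by (rule poly_mapping_eqI) (auto simp: lookup_add lookup_minus lookup_single when_def)

lemma lookup_var_mult:
  "lookup (var a * p) m
    = (if lookup m a = 0 then 0 else lookup p (m - single a 1))"
proof (induction p rule: mpol_induct)
  case zero then show ?case by simp
next
  case (monomial n c p)
  have "lookup (var a * single n c) m
    = (if lookup m a = 0 then 0 else lookup (single n c) (m - single a 1))"
  proof (cases "lookup m a = 0")
    case True
    then have "single a 1 + n \<noteq> m" by (metis add_is_0 lookup_add lookup_single_eq one_neq_zero)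
    then show ?thesis using True by (simp add: var_def mult_single lookup_single)
  next
    case False
    then have "(single a 1 + n = m) = (n = m - single a 1)"
      using single_sub_add[OF False] by (metis add_left_cancel)
    then show ?thesis using False by (simp add: var_def mult_single lookup_single)
  qed
  then show ?case using monomial by (simp add: distrib_left lookup_add)
qed

lemma keys_var_mult: "keys (var a * p) = (\<lambda>m. single a 1 + m) ` keys p"
proof -
  have "m \<in> keys (var a * p) \<longleftrightarrow> m \<in> (\<lambda>m. single a 1 + m) ` keys p" for m :: mon
  proof
    assume "m \<in> keys (var a * p)"
    then have 1: "lookup m a \<noteq> 0" "m - single a 1 \<in> keys p"
      by (auto simp: in_keys_iff lookup_var_mult split: if_splits)
    show "m \<in> (\<lambda>m. single a 1 + m) ` keys p"
      using single_sub_add[OF 1(1)] 1(2) by (metis imageI)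
  next
    assume "m \<in> (\<lambda>m. single a 1 + m) ` keys p"
    then show "m \<in> keys (var a * p)" by (auto simp: in_keys_iff lookup_var_mult lookup_add)
  qed
  then show ?thesis by blast
qed

text \<open>The substitution of \<open>0\<close> for the variables in \<open>Z\<close>.\<close>

definition kill :: "indet set \<Rightarrow> 'k::field mpol \<Rightarrow> 'k mpol" where
  "kill Z = restr (\<lambda>m. keys m \<inter> Z = {})"

lemma kill_add: "kill Z (p + q) = kill Z p + kill Z q"
  and kill_diff: "kill Z (p - q) = kill Z p - kill Z q"
  and kill_0 [simp]: "kill Z 0 = 0"
  and kill_sum: "kill Z (sum f A) = (\<Sum>i\<in>A. kill Z (f i))"
  and kill_polys: "p \<in> polys X \<Longrightarrow> kill Z p \<in> polys X"
  by (simp_all add: kill_def restr_add restr_diff restr_sum restr_polys)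

text \<open>Monomials free of \<open>Z\<close> are closed under multiplication, and a product with a monomial
  that meets \<open>Z\<close> meets \<open>Z\<close>; so the \<open>Z\<close>-free part of \<open>p * q\<close> comes from the \<open>Z\<close>-free parts alone.\<close>

lemma kill_mult: "kill Z (p * q) = kill Z p * kill Z q"
proof -
  define f where "f = kill Z p" define f' where "f' = p - f"
  define g where "g = kill Z q" define g' where "g' = q - g"
  have f: "m \<in> keys f \<Longrightarrow> keys m \<inter> Z = {}" for m :: mon
    by (simp add: f_def kill_def keys_restr)
  have g: "m \<in> keys g \<Longrightarrow> keys m \<inter> Z = {}" for m :: mon
    by (simp add: g_def kill_def keys_restr)
  have f': "m \<in> keys f' \<Longrightarrow> keys m \<inter> Z \<noteq> {}" for m :: mon
    by (auto simp: f'_def f_def kill_def in_keys_iff lookup_minus lookup_restr split: if_splits)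
  have g': "m \<in> keys g' \<Longrightarrow> keys m \<inter> Z \<noteq> {}" for m :: mon
    by (auto simp: g'_def g_def kill_def in_keys_iff lookup_minus lookup_restr split: if_splits)
  have "p * q = f * g + (f * g' + f' * q)" unfolding f'_def g'_def by (simp add: left_diff_distrib right_diff_distrib)
  moreover have "keys m \<inter> Z = {}" if "m \<in> keys (f * g)" for m :: mon
    using that
  proof (rule keys_multE)
    fix a b assume "m = a + b" "a \<in> keys f" "b \<in> keys g"
    then show ?thesis using f[of a] g[of b] by (auto simp: keys_add_nat)
  qed
  moreover have "keys m \<inter> Z \<noteq> {}" if "m \<in> keys (f * g' + f' * q)" for m :: mon
  proof -
    have "m \<in> keys (f * g') \<or> m \<in> keys (f' * q)" using that keys_add[of "f * g'" "f' * q"] by auto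
    then show ?thesis
    proof
      assume "m \<in> keys (f * g')"
      then show ?thesis
      proof (rule keys_multE)
        fix a b assume "m = a + b" "a \<in> keys f" "b \<in> keys g'"
        then show ?thesis using g'[of b] by (auto simp: keys_add_nat)
      qed
    next
      assume "m \<in> keys (f' * q)"
      then show ?thesis
      proof (rule keys_multE)
        fix a b assume "m = a + b" "a \<in> keys f'" "b \<in> keys q"
        then show ?thesis using f'[of a] by (auto simp: keys_add_nat)
      qed
    qed
  qed
  ultimately have "restr (\<lambda>m. keys m \<inter> Z = {}) (p * q) = f * g"
    by (intro restr_eqI[where g="f * g" and h="f * g' + f' * q"]) blast+
  then show ?thesis by (simp add: kill_def f_def g_def)
qed

lemma kill_var: "kill Z (var a) = (if a \<in> Z then 0 else var a)"
  by (auto simp: kill_def var_def lookup_restr lookup_single when_def intro!: poly_mapping_eqI)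

lemma mon_degree_superset:
  "finite A \<Longrightarrow> keys m \<subseteq> A \<Longrightarrow> mon_degree m = (\<Sum>z\<in>A. lookup m z)"
  unfolding mon_degree_def by (rule sum.mono_neutral_left) (auto simp: in_keys_iff)

lemma mon_degree_add: "mon_degree (m + n) = mon_degree m + mon_degree n"
  using mon_degree_superset[of "keys m \<union> keys n" m]
    mon_degree_superset[of "keys m \<union> keys n" n]
    mon_degree_superset[of "keys m \<union> keys n" "m + n"]
  by (simp add: keys_add_nat lookup_add sum.distrib)

lemma mon_degree_single [simp]: "mon_degree (single a k) = k"
  by (simp add: mon_degree_def)

lemma mon_degree_0 [simp]: "mon_degree 0 = 0"
  by (simp add: mon_degree_def)

lemma mon_degree_eq_0: "mon_degree m = 0 \<longleftrightarrow> m = 0"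
proof
  assume "mon_degree m = 0"
  then have "lookup m z = 0" for z
    by (cases "z \<in> keys m") (auto simp: mon_degree_def in_keys_iff)
  then show "m = 0" by (intro poly_mapping_eqI) simp
qed simp

lemma homogeneous_0 [simp]: "homogeneous d 0"
  and homogeneous_const [simp]: "homogeneous 0 (single 0 c)"
  and homogeneous_1 [simp]: "homogeneous 0 1"
  and homogeneous_var: "homogeneous 1 (var a)"
  by (auto simp: homogeneous_def var_def)

lemma homogeneous_add: "homogeneous d p \<Longrightarrow> homogeneous d q \<Longrightarrow> homogeneous d (p + q)"
  using keys_add[of p q] by (force simp: homogeneous_def)

lemma homogeneous_uminus: "homogeneous d p \<Longrightarrow> homogeneous d (- p)"
  by (simp add: homogeneous_def)

lemma homogeneous_diff: "homogeneous d p \<Longrightarrow> homogeneous d q \<Longrightarrow> homogeneous d (p - q)"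
  using homogeneous_add[of d p "- q"] homogeneous_uminus[of d q] by simp

lemma homogeneous_mult: "homogeneous d p \<Longrightarrow> homogeneous e q \<Longrightarrow> homogeneous (d + e) (p * q)"
  unfolding homogeneous_def by (auto elim!: keys_multE simp: mon_degree_add)

lemma homogeneous_sum: "(\<And>i. i \<in> A \<Longrightarrow> homogeneous d (f i)) \<Longrightarrow> homogeneous d (sum f A)"
  by (induction A rule: infinite_finite_induct) (auto intro: homogeneous_add)

lemma homogeneous_negative: "homogeneous d p \<Longrightarrow> d < 0 \<Longrightarrow> p = 0"
  by (intro poly_mapping_eqI) (force simp: homogeneous_def in_keys_iff)

definition hcomp :: "int \<Rightarrow> 'k::field mpol \<Rightarrow> 'k mpol" where
  "hcomp e = restr (\<lambda>m. int (mon_degree m) = e)"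

lemma hcomp_add: "hcomp e (p + q) = hcomp e p + hcomp e q"
  and hcomp_diff: "hcomp e (p - q) = hcomp e p - hcomp e q"
  and hcomp_uminus: "hcomp e (- p) = - hcomp e p"
  and hcomp_0 [simp]: "hcomp e 0 = 0"
  and hcomp_sum: "hcomp e (sum f A) = (\<Sum>i\<in>A. hcomp e (f i))"
  and hcomp_polys: "p \<in> polys X \<Longrightarrow> hcomp e p \<in> polys X"
  by (simp_all add: hcomp_def restr_add restr_diff restr_sum restr_polys restr_uminus)

lemma homogeneous_hcomp: "homogeneous e (hcomp e p)"
  by (simp add: homogeneous_def hcomp_def keys_restr)

lemma hcomp_same: "homogeneous e p \<Longrightarrow> hcomp e p = p"
  unfolding hcomp_def by (rule restr_same) (simp add: homogeneous_def)

lemma hcomp_mult: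
  assumes "homogeneous d p"
  shows "hcomp e (p * q) = p * hcomp (e - d) q"
proof -
  have "p * q = p * hcomp (e - d) q + p * (q - hcomp (e - d) q)" by (simp add: algebra_simps)
  moreover have "int (mon_degree m) = e" if "m \<in> keys (p * hcomp (e - d) q)" for m :: mon
    using homogeneous_mult[OF assms homogeneous_hcomp[of "e - d" q]] that by (simp add: homogeneous_def)
  moreover have "int (mon_degree m) \<noteq> e" if m: "m \<in> keys (p * (q - hcomp (e - d) q))" for m :: mon
  proof -
    obtain a b where ab: "m = a + b" "a \<in> keys p" "b \<in> keys (q - hcomp (e - d) q)"
      using m by (rule keys_multE)
    have "int (mon_degree a) = d" using ab(2) assms by (simp add: homogeneous_def)
    moreover have "int (mon_degree b) \<noteq> e - d"
      using ab(3) by (auto simp: hcomp_def in_keys_iff lookup_minus lookup_restr split: if_splits)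
    ultimately show ?thesis by (simp add: ab(1) mon_degree_add)
  qed
  ultimately show ?thesis unfolding hcomp_def[of e]
    by (intro restr_eqI[where g="p * hcomp (e - d) q" and h="p * (q - hcomp (e - d) q)"]) (blast | simp add: hcomp_def)+
qed

lemma hcomp_var_mult: "hcomp e (var a * q) = var a * hcomp (e - 1) q"
  by (rule hcomp_mult) (rule homogeneous_var)

lemma sum_hcomp:
  fixes p :: "'k::field mpol"
  assumes "\<And>m. m \<in> keys p \<Longrightarrow> int (mon_degree m) \<in> A" "finite A"
  shows "p = (\<Sum>e\<in>A. hcomp e p)"
proof (rule poly_mapping_eqI)
  fix m
  show "lookup p m = lookup (\<Sum>e\<in>A. hcomp e p) m"
    using assms by (cases "m \<in> keys p")
      (auto simp: lookup_sum hcomp_def lookup_restr in_keys_iff)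
qed

text \<open>The quotient by \<open>z\<close> of those terms that are divisible by \<open>z\<close>.\<close>

definition quot_var :: "indet \<Rightarrow> 'k::field mpol \<Rightarrow> 'k mpol" where
  "quot_var z p = Abs_poly_mapping (\<lambda>m. lookup p (single z 1 + m))"

lemma lookup_quot_var: "lookup (quot_var z p) m = lookup p (single z 1 + m)"
proof -
  have "finite ((\<lambda>m. single z 1 + m) -` {n. lookup p n \<noteq> 0})"
    by (rule finite_vimageI) (auto simp: inj_on_def)
  then have "finite {m. lookup p (single z 1 + m) \<noteq> 0}"
    by (simp add: vimage_def)
  then show ?thesis by (simp add: quot_var_def)
qed

lemma quot_var_polys: "p \<in> polys X \<Longrightarrow> quot_var z p \<in> polys X"
proof -
  assume p: "p \<in> polys X"
  have "keys m \<subseteq> X" if "m \<in> keys (quot_var z p)" for m :: mon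
  proof -
    have "single z 1 + m \<in> keys p"
      using that by (simp add: in_keys_iff lookup_quot_var)
    then have "keys (single z 1 + m) \<subseteq> X"
      using p unfolding polys_def by blast
    then show ?thesis by (simp add: keys_add_nat)
  qed
  then show ?thesis by (simp add: polys_def)
qed

lemma quot_var_0 [simp]: "quot_var z 0 = 0"
  and quot_var_add: "quot_var z (p + q) = quot_var z p + quot_var z q"
  and quot_var_uminus: "quot_var z (- p) = - quot_var z p"
  by (auto intro!: poly_mapping_eqI simp: lookup_quot_var lookup_add)

lemma quot_var_sum: "quot_var z (sum f A) = (\<Sum>i\<in>A. quot_var z (f i))"
  by (induction A rule: infinite_finite_induct) (auto simp: quot_var_add)

lemma quot_var_mult_same: "quot_var z (var z * p) = p"
  by (auto intro!: poly_mapping_eqI simp: lookup_quot_var lookup_var_mult lookup_add)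

lemma quot_var_mult_other: "a \<noteq> z \<Longrightarrow> quot_var z (var a * p) = var a * quot_var z p"
proof (rule poly_mapping_eqI)
  fix m :: mon assume "a \<noteq> z"
  moreover have "single z 1 + m - single a 1
      = single z 1 + (m - single a 1)"
    using \<open>a \<noteq> z\<close> by (intro poly_mapping_eqI) (auto simp: lookup_add lookup_minus lookup_single when_def)
  ultimately show "lookup (quot_var z (var a * p)) m = lookup (var a * quot_var z p) m"
    by (simp add: lookup_quot_var lookup_var_mult lookup_add lookup_single)
qed

lemma mult_quot_var: "var z * quot_var z p = p - kill {z} p"
  by (rule poly_mapping_eqI)
    (auto simp: lookup_quot_var lookup_var_mult lookup_minus kill_def lookup_restr in_keys_iff single_sub_add[simplified])

section \<open>The Koszul complex\<close>

text \<open>This injection orders the indeterminates, to fix the signs of exterior products. Since initial segments are finite, the signs below make sense even for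
  infinite index sets.\<close>

fun code :: "indet \<Rightarrow> nat" where
  "code (IX i) = 2 * i"
| "code (IY i) = Suc (2 * i)"

lemma code_inject: "code a = code b \<longleftrightarrow> a = b"
  by (cases a; cases b; simp; presburger)

definition koszul_sign :: "indet \<Rightarrow> indet set \<Rightarrow> 'k::field mpol" where
  "koszul_sign a B = (- 1) ^ card {b \<in> B. code b < code a}"

lemma finite_code_less: "finite {b. code b < n}"
proof (rule finite_imageD)
  show "finite (code ` {b. code b < n})" by (rule finite_subset[of _ "{..<n}"]) auto
  show "inj_on code {b. code b < n}" by (simp add: inj_on_def code_inject)
qed

lemma koszul_sign_square: "koszul_sign a B * koszul_sign a B = 1"
  unfolding koszul_sign_def by (rule minus_one_mult_self)

lemma koszul_sign_insert_same [simp]: "koszul_sign a (insert a B) = koszul_sign a B"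
  and koszul_sign_remove_same [simp]: "koszul_sign a (B - {a}) = koszul_sign a B"
  by (auto simp: koszul_sign_def intro: arg_cong[where f="\<lambda>S. (- 1) ^ card S"])

lemma koszul_sign_insert:
  assumes "b \<notin> B"
  shows "koszul_sign a (insert b B) = (if code b < code a then - koszul_sign a B else koszul_sign a B)"
proof (cases "code b < code a")
  case True
  then have "{x \<in> insert b B. code x < code a} = insert b {x \<in> B. code x < code a}" by auto
  moreover have "finite {x \<in> B. code x < code a}" by (rule finite_subset[OF _ finite_code_less]) auto
  ultimately show ?thesis using True assms by (simp add: koszul_sign_def)
next
  case False
  then have "{x \<in> insert b B. code x < code a} = {x \<in> B. code x < code a}" by auto
  then show ?thesis using False by (simp add: koszul_sign_def)
qed

text \<open>A Koszul chain \<open>c\<close> stands for the sum of the \<open>c B e\<^sub>B\<close>, where \<open>e\<^sub>B\<close> is the exterior product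
  of the \<open>e\<^sub>a\<close> with \<open>a \<in> B\<close>. Then \<open>contract a\<close> is contraction by the dual of \<open>e\<^sub>a\<close>, \<open>create a\<close> is
  exterior multiplication by \<open>e\<^sub>a\<close>, and the Koszul differential is \<open>\<Sum>\<^sub>a x\<^sub>a contract a\<close>. These
  operators satisfy the anticommutation relations of a Clifford algebra, from which every sign in
  the later arguments is obtained. Chains may have index sets that are not contained in \<open>X\<close>; this
  only adds further copies of the complex.\<close>

definition contract :: "indet \<Rightarrow> (indet set \<Rightarrow> 'k::field mpol) \<Rightarrow> indet set \<Rightarrow> 'k mpol" where
  "contract a c B = (if a \<in> B then 0 else koszul_sign a B * c (insert a B))"

definition create :: "indet \<Rightarrow> (indet set \<Rightarrow> 'k::field mpol) \<Rightarrow> indet set \<Rightarrow> 'k mpol" where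
  "create a c B = (if a \<in> B then koszul_sign a B * c (B - {a}) else 0)"

definition koszul :: "indet set \<Rightarrow> (indet set \<Rightarrow> 'k::field mpol) \<Rightarrow> indet set \<Rightarrow> 'k mpol" where
  "koszul X c B = (\<Sum>a\<in>X. var a * contract a c B)"

lemma contract_contract: "contract a (contract b c) B = - contract b (contract a c) B"
proof (cases "a = b \<or> a \<in> B \<or> b \<in> B")
  case True
  then show ?thesis by (auto simp: contract_def)
next
  case False
  moreover from this have "code a < code b \<or> code b < code a" using code_inject[of a b] by auto
  ultimately show ?thesis
    by (auto simp: contract_def koszul_sign_insert insert_commute mult.left_commute)
qed

lemma create_contract: "a \<noteq> b \<Longrightarrow> create b (contract a c) B = - contract a (create b c) B"
proof (cases "b \<in> B \<and> a \<notin> B")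
  case False
  then show "a \<noteq> b \<Longrightarrow> ?thesis" by (auto simp: contract_def create_def)
next
  case True
  assume ab: "a \<noteq> b"
  then have c: "code a < code b \<and> \<not> code b < code a \<or> code b < code a \<and> \<not> code a < code b"
    using code_inject[of a b] by auto
  obtain D where D: "B = insert b D" "b \<notin> D" using True by (metis mk_disjoint_insert)
  have a: "a \<notin> D" using True unfolding D(1) by blast
  have e: "insert a (insert b D) - {b} = insert a D" "insert b D - {b} = D" "a \<notin> insert b D" using ab D(2) a by blast+
  show ?thesis unfolding D(1) using c
    by (auto simp: contract_def create_def e D(2) a koszul_sign_insert mult.left_commute)
qed

lemma contract_create_same: "contract a (create a c) B = (if a \<in> B then 0 else c B)"
  by (auto simp: contract_def create_def koszul_sign_square simp flip: mult.assoc)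

lemma create_contract_same: "create a (contract a c) B = (if a \<in> B then c B else 0)"
  by (auto simp: contract_def create_def koszul_sign_square insert_absorb simp flip: mult.assoc)

lemma contract_add: "contract a (\<lambda>B. c B + c' B) B = contract a c B + contract a c' B"
  and contract_diff: "contract a (\<lambda>B. c B - c' B) B = contract a c B - contract a c' B"
  and contract_mult: "contract a (\<lambda>B. p * c B) B = p * contract a c B"
  and contract_0: "contract a (\<lambda>B. 0) B = 0"
  by (simp_all add: contract_def algebra_simps)

lemma create_add: "create a (\<lambda>B. c B + c' B) B = create a c B + create a c' B"
  and create_diff: "create a (\<lambda>B. c B - c' B) B = create a c B - create a c' B"
  and create_mult: "create a (\<lambda>B. p * c B) B = p * create a c B"
  and create_0: "create a (\<lambda>B. 0) B = 0"
  by (simp_all add: create_def algebra_simps)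

lemma contract_sum: "contract a (\<lambda>B. \<Sum>i\<in>A. f i B) B = (\<Sum>i\<in>A. contract a (f i) B)"
  and create_sum: "create a (\<lambda>B. \<Sum>i\<in>A. f i B) B = (\<Sum>i\<in>A. create a (f i) B)"
  by (auto simp: contract_def create_def sum_distrib_left)

lemma koszul_add: "koszul X (\<lambda>B. c B + c' B) B = koszul X c B + koszul X c' B"
  and koszul_diff: "koszul X (\<lambda>B. c B - c' B) B = koszul X c B - koszul X c' B"
  and koszul_mult: "koszul X (\<lambda>B. p * c B) B = p * koszul X c B"
  and koszul_0 [simp]: "koszul X (\<lambda>B. 0) B = 0"
  by (simp_all add: koszul_def contract_add contract_diff contract_mult contract_0
      sum.distrib sum_subtractf sum_distrib_left distrib_left right_diff_distrib mult.left_commute)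

lemma koszul_sum: "koszul X (\<lambda>B. \<Sum>i\<in>A. f i B) B = (\<Sum>i\<in>A. koszul X (f i) B)"
  by (simp add: koszul_def contract_sum sum_distrib_left sum.swap[of _ X A])

lemma koszul_remove:
  "finite X \<Longrightarrow> z \<in> X \<Longrightarrow> koszul X c B = var z * contract z c B + koszul (X - {z}) c B"
  unfolding koszul_def by (rule sum.remove)

lemma contract_koszul: "contract z (koszul X c) B = - koszul X (contract z c) B"
proof -
  have "contract z (\<lambda>B. \<Sum>a\<in>X. var a * contract a c B) B = (\<Sum>a\<in>X. var a * contract z (contract a c) B)"
    by (simp add: contract_sum contract_mult)
  also have "\<dots> = - (\<Sum>a\<in>X. var a * contract a (contract z c) B)"
    by (simp add: contract_contract[of z] sum_negf)
  finally show ?thesis by (simp add: koszul_def[abs_def])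
qed

lemma create_koszul: "z \<notin> X \<Longrightarrow> create z (koszul X c) B = - koszul X (create z c) B"
proof -
  assume z: "z \<notin> X"
  have "create z (\<lambda>B. \<Sum>a\<in>X. var a * contract a c B) B = (\<Sum>a\<in>X. var a * create z (contract a c) B)"
    by (simp add: create_sum create_mult)
  also have "\<dots> = (\<Sum>a\<in>X. - (var a * contract a (create z c) B))"
    using z by (intro sum.cong refl) (metis create_contract mult_minus_right)
  finally show ?thesis by (simp add: koszul_def[abs_def] sum_negf)
qed

lemma koszul_koszul: "finite X \<Longrightarrow> koszul X (koszul X c) B = 0"
proof (induction X arbitrary: B rule: finite_induct)
  case empty then show ?case by (simp add: koszul_def)
next
  case (insert z X)
  have e: "koszul (insert z X) c = (\<lambda>B. var z * contract z c B + koszul X c B)" for c :: "indet set \<Rightarrow> 'a mpol"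
    using insert.hyps by (auto simp: koszul_def fun_eq_iff)
  have "contract z (contract z c) B = 0" for B by (simp add: contract_def)
  then show ?case
    by (simp add: e contract_add contract_mult koszul_add koszul_mult contract_koszul insert.IH algebra_simps)
qed

text \<open>Multiplication by a variable is null-homotopic on the Koszul complex, by exterior
  multiplication with the corresponding basis vector.\<close>

lemma koszul_create:
  assumes "finite X" "z \<in> X"
  shows "koszul X (create z c) B + create z (koszul X c) B = var z * c B"
proof -
  have e: "koszul X c = (\<lambda>B. var z * contract z c B + koszul (X - {z}) c B)" for c :: "indet set \<Rightarrow> 'a mpol"
    using koszul_remove[OF assms] by (auto simp: fun_eq_iff)
  have "contract z (create z c) B + create z (contract z c) B = c B"
    by (simp add: contract_create_same create_contract_same)
  then have "var z * contract z (create z c) B + var z * create z (contract z c) B = var z * c B"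
    by (simp flip: distrib_left)
  then show ?thesis
    by (simp add: e create_add create_mult create_koszul)
qed

lemma map_contract:
  assumes "\<And>p. L (- p) = - L p" "L 0 = 0"
  shows "L (contract a c B) = contract a (\<lambda>B. L (c B)) B"
proof -
  have "koszul_sign a B = (1 :: 'a mpol) \<or> koszul_sign a B = (- 1 :: 'a mpol)"
    unfolding koszul_sign_def by (metis neg_one_even_power neg_one_odd_power)
  then show ?thesis using assms by (auto simp: contract_def koszul_sign_def minus_one_power_iff)
qed

lemma hcomp_koszul: "hcomp e (koszul X c B) = koszul X (\<lambda>B. hcomp (e - 1) (c B)) B"
  by (simp add: koszul_def hcomp_sum hcomp_var_mult map_contract[of "hcomp (e - 1)"] hcomp_uminus)

text \<open>Ideals of the polynomial ring in the variables \<open>X\<close>, as subsets of the type of all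
  polynomials; \<open>ideal_S_ring\<close> identifies them with the ideals of \<open>S_ring\<close>.\<close>

definition is_ideal :: "indet set \<Rightarrow> 'k::field mpol set \<Rightarrow> bool" where
  "is_ideal X I \<longleftrightarrow> I \<subseteq> polys X \<and> 0 \<in> I \<and> (\<forall>p\<in>I. \<forall>q\<in>I. p + q \<in> I) \<and> (\<forall>p\<in>polys X. \<forall>q\<in>I. p * q \<in> I)"

lemma is_ideal_polys: "is_ideal X (polys X)"
  by (auto simp: is_ideal_def polys_add polys_mult)

lemma ideal_sub: "is_ideal X I \<Longrightarrow> p \<in> I \<Longrightarrow> p \<in> polys X"
  and ideal_0: "is_ideal X I \<Longrightarrow> 0 \<in> I"
  and ideal_add: "is_ideal X I \<Longrightarrow> p \<in> I \<Longrightarrow> q \<in> I \<Longrightarrow> p + q \<in> I"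
  and ideal_mult: "is_ideal X I \<Longrightarrow> r \<in> polys X \<Longrightarrow> p \<in> I \<Longrightarrow> r * p \<in> I"
  by (auto simp: is_ideal_def)

lemma ideal_uminus: "is_ideal X I \<Longrightarrow> p \<in> I \<Longrightarrow> - p \<in> I"
  using ideal_mult[of X I "- 1" p] by (simp add: polys_uminus)

lemma ideal_diff: "is_ideal X I \<Longrightarrow> p \<in> I \<Longrightarrow> q \<in> I \<Longrightarrow> p - q \<in> I"
  using ideal_add[of X I p "- q"] ideal_uminus by auto

lemma ideal_sum: "is_ideal X I \<Longrightarrow> (\<And>i. i \<in> A \<Longrightarrow> f i \<in> I) \<Longrightarrow> sum f A \<in> I"
  by (induction A rule: infinite_finite_induct) (auto intro: ideal_add ideal_0)

lemma koszul_sign_polys [simp]: "koszul_sign a B \<in> polys X"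
  by (simp add: koszul_sign_def polys_power polys_uminus)

lemma contract_mem: "is_ideal X I \<Longrightarrow> (\<And>B. c B \<in> I) \<Longrightarrow> contract a c B \<in> I"
  and create_mem: "is_ideal X I \<Longrightarrow> (\<And>B. c B \<in> I) \<Longrightarrow> create a c B \<in> I"
  by (auto simp: contract_def create_def intro: ideal_0 ideal_mult)

lemma koszul_mem: "is_ideal X I \<Longrightarrow> (\<And>B. c B \<in> I) \<Longrightarrow> koszul X c B \<in> I"
  unfolding koszul_def by (intro ideal_sum ideal_mult contract_mem polys_var) auto

lemmas contract_polys = contract_mem[OF is_ideal_polys]
  and create_polys = create_mem[OF is_ideal_polys]
  and koszul_polys = koszul_mem[OF is_ideal_polys]

lemma quot_koszul:
  assumes "z \<notin> Y"
  shows "quot_var z (koszul Y c B) = koszul Y (\<lambda>B. quot_var z (c B)) B"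
proof -
  have "quot_var z (koszul Y c B) = (\<Sum>a\<in>Y. quot_var z (var a * contract a c B))"
    by (simp add: koszul_def quot_var_sum)
  also have "\<dots> = (\<Sum>a\<in>Y. var a * contract a (\<lambda>B. quot_var z (c B)) B)"
  proof (rule sum.cong[OF refl])
    fix a assume "a \<in> Y"
    then have "a \<noteq> z" using assms by auto
    then show "quot_var z (var a * contract a c B) = var a * contract a (\<lambda>B. quot_var z (c B)) B"
      by (simp add: quot_var_mult_other map_contract[of "quot_var z"] quot_var_uminus)
  qed
  finally show ?thesis by (simp add: koszul_def)
qed

text \<open>With \<open>h\<close> the composite of \<open>quot_var z\<close> and \<open>create z\<close>, the operator \<open>dh + hd\<close> is the
  identity minus the projection to the terms that involve \<open>z\<close> neither in the coefficient nor in
  the exterior part. So a cycle may be replaced by its image under this projection.\<close>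

lemma koszul_eliminate_variable:
  assumes X: "finite X" "z \<in> X" and cycle: "\<And>B. koszul X c B = 0"
  shows "c B - koszul X (create z (\<lambda>B. quot_var z (c B))) B = (if z \<in> B then 0 else kill {z} (c B))"
proof -
  define q where "q = (\<lambda>B. quot_var z (c B))"
  have d': "koszul (X - {z}) c B = - (var z * contract z c B)" for B
    using cycle[of B] koszul_remove[OF X, of c B] by (simp add: eq_neg_iff_add_eq_0 add.commute)
  have q': "koszul (X - {z}) q B = - contract z c B" for B
    using quot_koszul[of z "X - {z}" c B] by (simp add: d' q_def quot_var_uminus quot_var_mult_same)
  have "koszul X (create z q) B = var z * contract z (create z q) B + koszul (X - {z}) (create z q) B"
    by (rule koszul_remove[OF X])
  also have "koszul (X - {z}) (create z q) B = - create z (koszul (X - {z}) q) B"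
    using create_koszul[of z "X - {z}" q B] by simp
  also have "create z (koszul (X - {z}) q) B = - create z (contract z c) B"
    using q' by (simp add: create_def)
  finally show ?thesis
    by (auto simp: contract_create_same create_contract_same q_def mult_quot_var)
qed

text \<open>Removing the variables one at a time leaves the constant terms, which vanish by assumption.
  The homology of the Koszul complex of \<open>S\<close> consists of classes of constants, and the assumption
  on the constant terms excludes just these. Unlike the homotopy given by the Euler derivation, this
  argument works in every characteristic.\<close>

theorem koszul_acyclic:
  fixes c :: "indet set \<Rightarrow> 'k::field mpol"
  assumes X: "finite X" and c: "\<And>B. c B \<in> polys X" "\<And>B. lookup (c B) 0 = 0"
    and cycle: "\<And>B. koszul X c B = 0"
  shows "\<exists>b. (\<forall>B. b B \<in> polys X) \<and> (\<forall>B. koszul X b B = c B)"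
proof -
  have "\<exists>b. (\<forall>B. b B \<in> polys X) \<and>
      (\<forall>B. c B - koszul X b B \<in> polys (X - Y) \<and> lookup (c B - koszul X b B) 0 = 0)"
    if "finite Y" "Y \<subseteq> X" for Y
    using that
  proof (induction Y rule: finite_induct)
    case empty
    then show ?case using c by (intro exI[of _ "\<lambda>_. 0"]) auto
  next
    case (insert z Y)
    then obtain b where b: "\<And>B. b B \<in> polys X" "\<And>B. c B - koszul X b B \<in> polys (X - Y)"
      "\<And>B. lookup (c B - koszul X b B) 0 = 0" by auto
    define c' where "c' = (\<lambda>B. c B - koszul X b B)"
    define h where "h = create z (\<lambda>B. quot_var z (c' B))"
    have c': "c' B \<in> polys X" for B
      using b(2)[of B] polys_mono[of "X - Y" X] by (auto simp: c'_def)
    have "koszul X c' B = 0" for B by (simp add: c'_def koszul_diff cycle koszul_koszul[OF X])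
    then have eq: "c' B - koszul X h B = (if z \<in> B then 0 else kill {z} (c' B))" for B
      unfolding h_def using insert.prems by (intro koszul_eliminate_variable[OF X]) auto
    have "kill {z} (c' B) \<in> polys (X - insert z Y)" for B
    proof -
      have "kill {z} (c' B) \<in> polys (X - Y)" using b(2) by (intro kill_polys) (simp add: c'_def)
      then show ?thesis by (auto simp: polys_def kill_def keys_restr)
    qed
    moreover have "lookup (kill {z} (c' B)) 0 = 0" for B
      using b(3) by (simp add: c'_def kill_def lookup_restr)
    moreover have "c B - koszul X (\<lambda>B. b B + h B) B = c' B - koszul X h B" for B
      by (simp add: koszul_add c'_def)
    moreover have "h B \<in> polys X" for B unfolding h_def by (intro create_polys quot_var_polys c')
    ultimately show ?case using b(1) eq
      by (intro exI[of _ "\<lambda>B. b B + h B"]) (auto intro: polys_add)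
  qed
  from this[OF X] obtain b where b: "\<And>B. b B \<in> polys X" "\<And>B. c B - koszul X b B \<in> polys {}"
      "\<And>B. lookup (c B - koszul X b B) 0 = 0" by auto
  have "c B - koszul X b B = 0" for B
  proof (rule poly_mapping_eqI)
    fix m :: mon
    show "lookup (c B - koszul X b B) m = lookup 0 m"
    proof (cases "m = 0")
      case False
      then have "keys m \<noteq> {}" by (metis keys_eq_empty)
      then have "m \<notin> keys (c B - koszul X b B)" using b(2)[of B] by (auto simp: polys_def)
      then show ?thesis by (simp add: in_keys_iff)
    qed (use b(3) in simp)
  qed
  then show ?thesis using b(1) by auto
qed

lemma koszul_acyclic_graded:
  fixes c :: "indet set \<Rightarrow> 'k::field mpol"
  assumes X: "finite X" and c: "\<And>B. c B \<in> polys X" "\<And>B. lookup (c B) 0 = 0"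
    and cycle: "\<And>B. koszul X c B = 0" and hom: "\<And>B. homogeneous e (c B)"
  shows "\<exists>b. \<forall>B. b B \<in> polys X \<and> homogeneous (e - 1) (b B) \<and> koszul X b B = c B"
proof -
  obtain b where b: "\<And>B. b B \<in> polys X" "\<And>B. koszul X b B = c B"
    using koszul_acyclic[OF X c cycle] by blast
  have "koszul X (\<lambda>B. hcomp (e - 1) (b B)) B = c B" for B
    unfolding hcomp_koszul[symmetric] b(2) by (rule hcomp_same[OF hom])
  then show ?thesis
    using b(1) by (intro exI[of _ "\<lambda>B. hcomp (e - 1) (b B)"]) (simp add: hcomp_polys homogeneous_hcomp)
qed

section \<open>Ideals given by generators\<close>

inductive_set gen :: "indet set \<Rightarrow> 'k::field mpol set \<Rightarrow> 'k mpol set" for X A where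
  gen_zero: "0 \<in> gen X A"
| gen_step: "p \<in> polys X \<Longrightarrow> a \<in> A \<Longrightarrow> q \<in> gen X A \<Longrightarrow> p * a + q \<in> gen X A"

lemma gen_add: "p \<in> gen X A \<Longrightarrow> q \<in> gen X A \<Longrightarrow> p + q \<in> gen X A"
  by (induction rule: gen.induct) (auto intro: gen_step simp: add.assoc)

lemma gen_mult: "q \<in> gen X A \<Longrightarrow> p \<in> polys X \<Longrightarrow> p * q \<in> gen X A"
  by (induction rule: gen.induct)
    (auto intro: gen_zero gen_step polys_mult simp: distrib_left simp flip: mult.assoc)

lemma gen_base: "a \<in> A \<Longrightarrow> a \<in> gen X A"
  using gen_step[of 1 X a A 0] by (simp add: gen_zero)

lemma gen_least: "p \<in> gen X A \<Longrightarrow> is_ideal X I \<Longrightarrow> A \<subseteq> I \<Longrightarrow> p \<in> I"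
  by (induction rule: gen.induct) (auto intro: ideal_0 ideal_add ideal_mult)

lemma gen_ideal: "A \<subseteq> polys X \<Longrightarrow> is_ideal X (gen X A)"
  unfolding is_ideal_def
  by (auto intro: gen_zero gen_add gen_mult gen_least[OF _ is_ideal_polys])

lemma gen_mono: "A \<subseteq> B \<Longrightarrow> gen X A \<subseteq> gen X B"
proof
  fix p assume "p \<in> gen X A" "A \<subseteq> B"
  then show "p \<in> gen X B" by (induction rule: gen.induct) (auto intro: gen_zero gen_step)
qed

lemma gen_Un: "w \<in> gen X (A \<union> B) \<longleftrightarrow> (\<exists>u\<in>gen X A. \<exists>v\<in>gen X B. w = u + v)"
proof
  assume "w \<in> gen X (A \<union> B)"
  then show "\<exists>u\<in>gen X A. \<exists>v\<in>gen X B. w = u + v"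
  proof (induction rule: gen.induct)
    case gen_zero
    then show ?case using gen.gen_zero by force
  next
    case (gen_step p a q)
    then obtain u v where uv: "u \<in> gen X A" "v \<in> gen X B" "q = u + v" by auto
    show ?case
    proof (cases "a \<in> A")
      case True
      then have "p * a + u \<in> gen X A" using gen_step uv by (auto intro: gen.gen_step)
      then show ?thesis using uv by (intro bexI[of _ "p * a + u"] bexI[of _ v]) (auto simp: add.assoc)
    next
      case False
      then have "p * a + v \<in> gen X B" using gen_step uv by (auto intro: gen.gen_step)
      then show ?thesis using uv by (intro bexI[of _ u] bexI[of _ "p * a + v"]) (auto simp: add.left_commute)
    qed
  qed
next
  assume "\<exists>u\<in>gen X A. \<exists>v\<in>gen X B. w = u + v"
  then show "w \<in> gen X (A \<union> B)"
    using gen_mono[of A "A \<union> B" X] gen_mono[of B "A \<union> B" X] by (auto intro: gen_add)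
qed

lemma gen_singleton: "w \<in> gen X {a} \<longleftrightarrow> (\<exists>p\<in>polys X. w = a * p)"
proof
  assume "w \<in> gen X {a}"
  then show "\<exists>p\<in>polys X. w = a * p"
  proof (induction rule: gen.induct)
    case gen_zero then show ?case by (intro bexI[of _ 0]) auto
  next
    case (gen_step p a' q)
    then obtain p' where "p' \<in> polys X" "q = a * p'" by auto
    then show ?case using gen_step by (intro bexI[of _ "p + p'"]) (auto simp: polys_add algebra_simps)
  qed
next
  assume "\<exists>p\<in>polys X. w = a * p"
  then show "w \<in> gen X {a}" by (auto intro: gen_mult gen_base simp: mult.commute[of a])
qed

lemma gen_insert: "w \<in> gen X (insert a A) \<longleftrightarrow> (\<exists>u\<in>gen X A. \<exists>p\<in>polys X. w = u + a * p)"
proof -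
  have "(\<exists>v\<in>gen X {a}. w = u + v) \<longleftrightarrow> (\<exists>p\<in>polys X. w = u + a * p)" for u
    by (auto simp: gen_singleton)
  then show ?thesis using gen_Un[of w X A "{a}"] by simp
qed

text \<open>Substitution is a ring homomorphism, so stability of an ideal under it can be
  checked on generators.\<close>

lemma kill_gen_mem:
  assumes "p \<in> gen X A" "is_ideal X I"
    and "\<And>a. a \<in> A \<Longrightarrow> kill Z a \<in> I"
  shows "kill Z p \<in> I"
  using assms(1)
proof (induction rule: gen.induct)
  case gen_zero
  then show ?case by (simp add: ideal_0[OF assms(2)])
next
  case (gen_step p a q)
  then show ?case unfolding kill_add kill_mult
    by (intro ideal_add[OF assms(2)] ideal_mult[OF assms(2)] kill_polys assms(3) gen_step)
qed

lemma sum_monomials: "p = (\<Sum>m\<in>keys p. single m (lookup p m))"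
  for p :: "'k::field mpol"
  by (rule poly_mapping_eqI)
    (auto simp: lookup_sum lookup_single when_def in_keys_iff sum.delta cong: if_cong)

lemma monomial_polys: "p \<in> polys X \<Longrightarrow> m \<in> keys p \<Longrightarrow> single m c \<in> polys X"
  by (auto simp: polys_def)

lemma diff_kill_mem:
  assumes p: "p \<in> polys X" and Z: "Z \<subseteq> X"
  shows "p - kill Z p \<in> gen X (var ` Z)"
proof -
  let ?c = "lookup p"
  have I: "is_ideal X (gen X (var ` Z))" using Z by (intro gen_ideal) (auto intro: polys_var)
  have "p - kill Z p = (\<Sum>m\<in>keys p. single m (?c m) - kill Z (single m (?c m)))"
    by (subst (1 2) sum_monomials[of p]) (simp add: kill_sum sum_subtractf)
  also have "\<dots> \<in> gen X (var ` Z)"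
  proof (rule ideal_sum[OF I])
    fix m assume m: "m \<in> keys p"
    let ?s = "single m (?c m)"
    show "?s - kill Z ?s \<in> gen X (var ` Z)"
    proof (cases "keys m \<inter> Z = {}")
      case True
      then have "kill Z ?s = ?s" unfolding kill_def by (intro restr_same) (auto split: if_splits)
      then show ?thesis by (simp add: gen_zero)
    next
      case False
      then obtain z where z: "z \<in> keys m" "z \<in> Z" by auto
      have "kill Z ?s = 0"
        using False by (intro poly_mapping_eqI) (auto simp: kill_def lookup_restr lookup_single when_def)
      moreover have "?s = var z * quot_var z ?s"
        using z by (simp add: mult_quot_var)
          (auto simp: kill_def lookup_restr lookup_single when_def intro!: poly_mapping_eqI)
      moreover have "quot_var z ?s * var z \<in> gen X (var ` Z)"
        using z m p by (intro gen_mult gen_base quot_var_polys monomial_polys) auto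
      ultimately show ?thesis by (simp add: mult.commute)
    qed
  qed
  finally show ?thesis .
qed

definition hom_ideal :: "indet set \<Rightarrow> 'k::field mpol set \<Rightarrow> bool" where
  "hom_ideal X I \<longleftrightarrow> is_ideal X I \<and> (\<forall>e. \<forall>p\<in>I. hcomp e p \<in> I)"

lemma hom_ideal_ideal: "hom_ideal X I \<Longrightarrow> is_ideal X I"
  and hom_ideal_hcomp: "hom_ideal X I \<Longrightarrow> p \<in> I \<Longrightarrow> hcomp e p \<in> I"
  by (auto simp: hom_ideal_def)

lemma gen_hom_ideal:
  assumes "A \<subseteq> polys X" "\<And>a. a \<in> A \<Longrightarrow> \<exists>d. homogeneous d a"
  shows "hom_ideal X (gen X A)"
proof -
  have "hcomp e p \<in> gen X A" if "p \<in> gen X A" for e p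
    using that
  proof (induction rule: gen.induct)
    case (gen_step p a q)
    then obtain d where d: "homogeneous d a" using assms by auto
    have "hcomp e (p * a) = hcomp e (a * p)" by (simp only: mult.commute)
    also have "\<dots> = hcomp (e - d) p * a" unfolding hcomp_mult[OF d] by (rule mult.commute)
    finally have "hcomp e (p * a + q) = hcomp (e - d) p * a + hcomp e q" by (simp only: hcomp_add)
    then show ?case using gen_step by (auto intro: gen.gen_step hcomp_polys)
  qed (auto intro: gen.gen_zero)
  then show ?thesis using gen_ideal[OF assms(1)] by (auto simp: hom_ideal_def)
qed

section \<open>Koszul regularity\<close>

text \<open>A chain all of whose coefficients have degree \<open>e\<close> has, in homological degree \<open>p\<close>, internal
  degree \<open>p + e\<close>. Hence \<open>regular X I r\<close> says that the Koszul homology of \<open>S/I\<close> in homological degree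
  \<open>p\<close> vanishes in all degrees above \<open>p + r\<close>, for all \<open>p\<close> at once. Chains with values in \<open>S/I\<close> are
  represented by chains with values in \<open>S\<close>.\<close>

definition regular :: "indet set \<Rightarrow> 'k::field mpol set \<Rightarrow> int \<Rightarrow> bool" where
  "regular X I r \<longleftrightarrow>
     (\<forall>e>r. \<forall>c. (\<forall>B. c B \<in> polys X \<and> homogeneous e (c B)) \<longrightarrow> (\<forall>B. koszul X c B \<in> I) \<longrightarrow>
        (\<exists>b. (\<forall>B. b B \<in> polys X) \<and> (\<forall>B. c B - koszul X b B \<in> I)))"

lemma regularI:
  assumes "\<And>e c. e > r \<Longrightarrow> (\<And>B. c B \<in> polys X) \<Longrightarrow> (\<And>B. homogeneous e (c B)) \<Longrightarrow> (\<And>B. koszul X c B \<in> I) \<Longrightarrow>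
    \<exists>b. (\<forall>B. b B \<in> polys X) \<and> (\<forall>B. c B - koszul X b B \<in> I)"
  shows "regular X I r"
  using assms unfolding regular_def by blast

lemma regularE:
  assumes "regular X I r" "e > r" "\<And>B. c B \<in> polys X" "\<And>B. homogeneous e (c B)" "\<And>B. koszul X c B \<in> I"
  obtains b where "\<And>B. b B \<in> polys X" "\<And>B. c B - koszul X b B \<in> I"
  using assms unfolding regular_def by blast

text \<open>The component of degree \<open>e - 1\<close> of any bounding chain still bounds.\<close>

lemma regular_homE:
  assumes "regular X I r" "hom_ideal X I" "e > r"
    and c: "\<And>B. c B \<in> polys X" "\<And>B. homogeneous e (c B)" "\<And>B. koszul X c B \<in> I"
  obtains b where "\<And>B. b B \<in> polys X" "\<And>B. homogeneous (e - 1) (b B)" "\<And>B. c B - koszul X b B \<in> I"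
proof -
  obtain b where b: "\<And>B. b B \<in> polys X" "\<And>B. c B - koszul X b B \<in> I"
    using regularE[OF assms(1,3) c] by blast
  have "c B - koszul X (\<lambda>B. hcomp (e - 1) (b B)) B = hcomp e (c B - koszul X b B)" for B
    by (simp add: hcomp_diff hcomp_koszul hcomp_same[OF c(2)])
  then have "c B - koszul X (\<lambda>B. hcomp (e - 1) (b B)) B \<in> I" for B
    using hom_ideal_hcomp[OF assms(2) b(2)] by simp
  then show ?thesis
    using that[of "\<lambda>B. hcomp (e - 1) (b B)"] b(1) by (simp add: hcomp_polys homogeneous_hcomp)
qed

lemma regular_mono: "regular X I r \<Longrightarrow> r \<le> s \<Longrightarrow> regular X I s"
  unfolding regular_def by (meson le_less_trans)

lemma koszul_koszul_diff:
  "finite X \<Longrightarrow> koszul X (\<lambda>B. c B - koszul X b B) B = koszul X c B"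
  by (simp add: koszul_diff koszul_koszul)

text \<open>The sequence \<open>0 \<rightarrow> S/(J\<^sub>1 \<inter> J\<^sub>2) \<rightarrow> S/J\<^sub>1 \<oplus> S/J\<^sub>2 \<rightarrow> S/(J\<^sub>1 + J\<^sub>2) \<rightarrow> 0\<close>. Bounding chains \<open>b\<^sub>1\<close>,
  \<open>b\<^sub>2\<close> of the same cycle modulo \<open>J\<^sub>1\<close> and \<open>J\<^sub>2\<close> differ by a cycle modulo \<open>J\<^sub>1 + J\<^sub>2\<close>; as this is a
  boundary, they can be corrected to agree.\<close>

theorem regular_Int:
  assumes X: "finite X"
    and J1: "hom_ideal X J1" and J2: "hom_ideal X J2"
    and J3: "\<And>w. w \<in> J3 \<longleftrightarrow> (\<exists>u\<in>J1. \<exists>v\<in>J2. w = u + v)"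
    and r: "regular X J1 r" "regular X J2 r" "regular X J3 (r - 1)"
  shows "regular X (J1 \<inter> J2) r"
proof (rule regularI)
  fix e and c :: "indet set \<Rightarrow> 'a mpol"
  assume e: "e > r" and c: "\<And>B. c B \<in> polys X" "\<And>B. homogeneous e (c B)" and d: "\<And>B. koszul X c B \<in> J1 \<inter> J2"
  have d1: "\<And>B. koszul X c B \<in> J1" and d2: "\<And>B. koszul X c B \<in> J2" using d by auto
  note I1 = hom_ideal_ideal[OF J1] and I2 = hom_ideal_ideal[OF J2]
  obtain b1 where b1: "\<And>B. b1 B \<in> polys X" "\<And>B. homogeneous (e - 1) (b1 B)" "\<And>B. c B - koszul X b1 B \<in> J1"
    using regular_homE[OF r(1) J1 e c d1] by blast
  obtain b2 where b2: "\<And>B. b2 B \<in> polys X" "\<And>B. homogeneous (e - 1) (b2 B)" "\<And>B. c B - koszul X b2 B \<in> J2"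
    using regular_homE[OF r(2) J2 e c d2] by blast
  have 1: "koszul X (\<lambda>B. b1 B - b2 B) B \<in> J3" for B
  proof -
    have "koszul X (\<lambda>B. b1 B - b2 B) B = - (c B - koszul X b1 B) + (c B - koszul X b2 B)"
      by (simp add: koszul_diff)
    then show ?thesis using ideal_uminus[OF I1 b1(3)] b2(3) unfolding J3 by blast
  qed
  have 2: "e - 1 > r - 1" "b1 B - b2 B \<in> polys X" "homogeneous (e - 1) (b1 B - b2 B)" for B
    using e b1 b2 by (auto intro: polys_diff homogeneous_diff)
  obtain f where f: "\<And>B. f B \<in> polys X" "\<And>B. b1 B - b2 B - koszul X f B \<in> J3"
    using regularE[OF r(3) 2 1] by blast
  then obtain u v where uv: "\<And>B. u B \<in> J1" "\<And>B. v B \<in> J2" "\<And>B. b1 B - b2 B - koszul X f B = u B + v B"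
    unfolding J3 by metis
  \<comment> \<open>the common correction of \<open>b1\<close> and \<open>b2\<close>: it equals \<open>b2 + v\<close> as well\<close>
  define b where "b = (\<lambda>B. b1 B - u B - koszul X f B)"
  have b': "b = (\<lambda>B. b2 B + v B)" using uv(3) by (auto simp: b_def fun_eq_iff algebra_simps)
  have "c B - koszul X b B \<in> J1" for B
  proof -
    have "c B - koszul X b B = (c B - koszul X b1 B) + koszul X u B"
      by (simp add: b_def koszul_diff koszul_koszul[OF X])
    then show ?thesis by (simp only:) (intro ideal_add[OF I1] koszul_mem[OF I1] b1(3) uv(1))
  qed
  moreover have "c B - koszul X b B \<in> J2" for B
  proof -
    have "c B - koszul X b B = (c B - koszul X b2 B) - koszul X v B"
      by (simp add: b' koszul_add)
    then show ?thesis by (simp only:) (intro ideal_diff[OF I2] koszul_mem[OF I2] b2(3) uv(2))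
  qed
  moreover have "b B \<in> polys X" for B
    unfolding b' using b2(1) ideal_sub[OF I2 uv(2)] by (auto intro: polys_add)
  ultimately show "\<exists>b. (\<forall>B. b B \<in> polys X) \<and> (\<forall>B. c B - koszul X b B \<in> J1 \<inter> J2)" by blast
qed

text \<open>The sequence \<open>0 \<rightarrow> S/(I : z)(-1) \<rightarrow> S/I \<rightarrow> S/(I + (z)) \<rightarrow> 0\<close>. A cycle modulo \<open>I\<close> is, up to a boundary,
  \<open>z\<close> times a chain \<open>q\<close>; then \<open>q\<close> is a cycle modulo \<open>I : z\<close> with coefficients of one degree less.\<close>

theorem regular_colon:
  assumes X: "finite X" and z: "z \<in> X"
    and I: "hom_ideal X I" and Iz: "hom_ideal X Iz"
    and Iz_iff: "\<And>w. w \<in> Iz \<longleftrightarrow> (\<exists>u\<in>I. \<exists>p\<in>polys X. w = u + var z * p)"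
    and colon: "\<And>f. f \<in> polys X \<Longrightarrow> var z * f \<in> I \<longleftrightarrow> f \<in> I'" and I': "I' \<subseteq> polys X"
    and r: "regular X Iz r" "regular X I' (r - 1)"
  shows "regular X I r"
proof (rule regularI)
  fix e and c :: "indet set \<Rightarrow> 'a mpol"
  assume e: "e > r" and c: "\<And>B. c B \<in> polys X" "\<And>B. homogeneous e (c B)" and d: "\<And>B. koszul X c B \<in> I"
  note II = hom_ideal_ideal[OF I]
  have dz: "koszul X c B \<in> Iz" for B unfolding Iz_iff using d[of B] by (intro bexI[of _ "koszul X c B"] bexI[of _ 0]) auto
  obtain b where b: "\<And>B. b B \<in> polys X" "\<And>B. homogeneous (e - 1) (b B)" "\<And>B. c B - koszul X b B \<in> Iz"
    using regular_homE[OF r(1) Iz e c dz] by blast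
  from b(3) obtain u p where up: "\<And>B. u B \<in> I" "\<And>B. p B \<in> polys X" "\<And>B. c B - koszul X b B = u B + var z * p B"
    unfolding Iz_iff by metis
  define q where "q = (\<lambda>B. hcomp (e - 1) (p B))"
  have q: "q B \<in> polys X" "homogeneous (e - 1) (q B)" for B
    using up(2) by (auto simp: q_def hcomp_polys homogeneous_hcomp)
  have hb: "hcomp e (koszul X b B) = koszul X b B" for B
    by (simp add: hcomp_koszul hcomp_same[OF b(2)])
  have eq: "c B - koszul X b B = hcomp e (u B) + var z * q B" for B
    using arg_cong[OF up(3)[of B], of "hcomp e"]
    by (simp add: hcomp_diff hcomp_add hcomp_var_mult hb hcomp_same[OF c(2)] q_def)
  have dq: "koszul X q B \<in> I'" for B
  proof -
    have "koszul X (\<lambda>B. c B - koszul X b B) B = koszul X (\<lambda>B. hcomp e (u B) + var z * q B) B"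
      by (simp only: eq)
    then have "var z * koszul X q B = koszul X c B - koszul X (\<lambda>B. hcomp e (u B)) B"
      by (simp add: koszul_koszul_diff[OF X] koszul_add koszul_mult)
    then have "var z * koszul X q B \<in> I"
      by (simp only:) (intro ideal_diff[OF II] d koszul_mem[OF II] hom_ideal_hcomp[OF I] up(1))
    then show ?thesis using colon koszul_polys q(1) by blast
  qed
  have "e - 1 > r - 1" using e by simp
  then obtain f where f: "\<And>B. f B \<in> polys X" "\<And>B. q B - koszul X f B \<in> I'"
    using regularE[OF r(2) _ q dq] by blast
  have "c B - koszul X (\<lambda>B. b B + var z * f B) B \<in> I" for B
  proof -
    have "var z * (q B - koszul X f B) \<in> I" using colon[of "q B - koszul X f B"] f(2) I' by blast
    moreover have "c B - koszul X (\<lambda>B. b B + var z * f B) B = hcomp e (u B) + var z * (q B - koszul X f B)"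
      using eq[of B] by (simp add: koszul_add koszul_mult algebra_simps)
    ultimately show ?thesis by (simp only:) (intro ideal_add[OF II] hom_ideal_hcomp[OF I] up(1))
  qed
  moreover have "b B + var z * f B \<in> polys X" for B using b(1) f(1) z by (intro polys_closed)
  ultimately show "\<exists>b. (\<forall>B. b B \<in> polys X) \<and> (\<forall>B. c B - koszul X b B \<in> I)"
    by (intro exI[of _ "\<lambda>B. b B + var z * f B"]) blast
qed

text \<open>For \<open>I : z = I\<close> the preceding sequence would be circular. But multiplication by \<open>z\<close>
  induces zero on Koszul homology, so the homology of \<open>S/I\<close> embeds into that of \<open>S/(I + (z))\<close>.\<close>

theorem regular_nonzerodivisor:
  assumes X: "finite X" and z: "z \<in> X" and I: "is_ideal X I"
    and Iz_iff: "\<And>w. w \<in> Iz \<longleftrightarrow> (\<exists>u\<in>I. \<exists>p\<in>polys X. w = u + var z * p)"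
    and nzd: "\<And>f. f \<in> polys X \<Longrightarrow> var z * f \<in> I \<Longrightarrow> f \<in> I"
    and r: "regular X Iz r"
  shows "regular X I r"
proof (rule regularI)
  fix e and c :: "indet set \<Rightarrow> 'a mpol"
  assume e: "e > r" and c: "\<And>B. c B \<in> polys X" "\<And>B. homogeneous e (c B)" and d: "\<And>B. koszul X c B \<in> I"
  have dz: "koszul X c B \<in> Iz" for B unfolding Iz_iff using d[of B] by (intro bexI[of _ "koszul X c B"] bexI[of _ 0]) auto
  obtain b where b: "\<And>B. b B \<in> polys X" "\<And>B. c B - koszul X b B \<in> Iz"
    using regularE[OF r e c dz] by blast
  from b(2) obtain u p where up: "\<And>B. u B \<in> I" "\<And>B. p B \<in> polys X" "\<And>B. c B - koszul X b B = u B + var z * p B"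
    unfolding Iz_iff by metis
  have "koszul X p B \<in> I" for B
  proof -
    have "koszul X (\<lambda>B. c B - koszul X b B) B = koszul X (\<lambda>B. u B + var z * p B) B"
      by (simp only: up(3))
    then have "var z * koszul X p B = koszul X c B - koszul X u B"
      by (simp add: koszul_koszul_diff[OF X] koszul_add koszul_mult)
    then have "var z * koszul X p B \<in> I"
      by (simp only:) (intro ideal_diff[OF I] d koszul_mem[OF I] up(1))
    then show ?thesis using nzd koszul_polys up(2) by blast
  qed
  then have "u B + create z (koszul X p) B \<in> I" for B by (intro ideal_add[OF I up(1)] create_mem[OF I])
  moreover have "c B - koszul X (\<lambda>B. b B + create z p B) B = u B + create z (koszul X p) B" for B
    using up(3)[of B] koszul_create[OF X z, of p B] by (simp add: koszul_add algebra_simps)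
  moreover have "b B + create z p B \<in> polys X" for B using b(1) up(2) by (intro polys_add create_polys)
  ultimately show "\<exists>b. (\<forall>B. b B \<in> polys X) \<and> (\<forall>B. c B - koszul X b B \<in> I)"
    by (intro exI[of _ "\<lambda>B. b B + create z p B"]) auto
qed

lemma kill_koszul:
  assumes "\<And>z B. z \<in> Z \<Longrightarrow> contract z c B = 0"
  shows "kill Z (koszul X c B) = koszul X (\<lambda>B. kill Z (c B)) B"
proof -
  have eq: "kill Z (contract a c B) = contract a (\<lambda>B. kill Z (c B)) B" for a
    by (rule map_contract) (simp_all add: kill_def restr_uminus)
  have "kill Z (var a * contract a c B) = var a * contract a (\<lambda>B. kill Z (c B)) B" for a
    using assms[of a B] by (cases "a \<in> Z") (auto simp: kill_mult kill_var simp flip: eq)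
  then show ?thesis by (simp add: koszul_def kill_sum)
qed

text \<open>If setting \<open>Z\<close> to zero maps \<open>I\<close> into itself, then \<open>S/(I + (Z))\<close> is an algebra retract of
  \<open>S/I\<close>. On the Koszul complex of the other variables this retraction gives the bound; each
  variable of \<open>Z\<close> acts by zero on the quotient and contributes a second copy of the complex,
  shifted by one in both degrees. This is the regularity comparison for an induced subgraph.\<close>

theorem regular_kill:
  assumes X: "finite X" and Z: "Z \<subseteq> X" and I: "is_ideal X I"
    and kill: "\<And>p. p \<in> I \<Longrightarrow> kill Z p \<in> I"
    and I'_iff: "\<And>w. w \<in> I' \<longleftrightarrow> (\<exists>u\<in>I. \<exists>v\<in>gen X (var ` Z). w = u + v)"
    and r: "regular X I r"
  shows "regular X I' r"
proof -
  have vZ: "var ` Z \<subseteq> polys X" using Z by (auto intro: polys_var)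
  have genI: "is_ideal X (gen X (var ` Z))" by (rule gen_ideal[OF vZ])
  have I': "is_ideal X I'"
    unfolding is_ideal_def
  proof (intro conjI ballI subsetI)
    show "x \<in> polys X" if "x \<in> I'" for x
      using that ideal_sub[OF I] ideal_sub[OF genI] by (auto simp: I'_iff intro: polys_add)
    show "0 \<in> I'" unfolding I'_iff by (intro bexI[of _ 0]) (auto intro: ideal_0 I genI)
    show "p + q \<in> I'" if pq: "p \<in> I'" "q \<in> I'" for p q
    proof -
      obtain u v u' v' where "u \<in> I" "v \<in> gen X (var ` Z)" "p = u + v" "u' \<in> I" "v' \<in> gen X (var ` Z)" "q = u' + v'"
        using pq unfolding I'_iff by blast
      then show ?thesis unfolding I'_iff
        by (intro bexI[of _ "u + u'"] bexI[of _ "v + v'"]) (auto intro: ideal_add I genI)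
    qed
    show "p * q \<in> I'" if pq: "p \<in> polys X" "q \<in> I'" for p q
    proof -
      obtain u v where "u \<in> I" "v \<in> gen X (var ` Z)" "q = u + v" using pq unfolding I'_iff by blast
      then show ?thesis unfolding I'_iff using pq(1)
        by (intro bexI[of _ "p * u"] bexI[of _ "p * v"]) (auto intro: ideal_mult I genI simp: distrib_left)
    qed
  qed
  have sub: "p \<in> I' " if "p \<in> I" for p
    unfolding I'_iff using that by (intro bexI[of _ p] bexI[of _ 0]) (auto intro: gen_zero)
  have sub': "p \<in> I' " if "p \<in> gen X (var ` Z)" for p
    unfolding I'_iff using that ideal_0[OF I] by (intro bexI[of _ 0] bexI[of _ p]) auto
  have killI': "kill Z p \<in> I" if p: "p \<in> I'" for p
  proof -
    obtain u v where uv: "u \<in> I" "v \<in> gen X (var ` Z)" "p = u + v" using p unfolding I'_iff by blast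
    have "kill Z v \<in> {0}"
    proof (rule kill_gen_mem[OF uv(2)])
      show "is_ideal X {0}" by (auto simp: is_ideal_def)
    qed (auto simp: kill_var)
    then show ?thesis using kill[OF uv(1)] by (simp add: uv(3) kill_add)
  qed
  have claim: "\<exists>b. (\<forall>B. b B \<in> polys X) \<and> (\<forall>B. c B - koszul X b B \<in> I')"
    if "finite W" "W \<subseteq> Z" "e > r" "\<And>B. c B \<in> polys X" "\<And>B. homogeneous e (c B)" "\<And>B. koszul X c B \<in> I'"
      "\<And>z B. z \<in> Z - W \<Longrightarrow> contract z c B = 0"
    for W e c
    using that
  proof (induction W arbitrary: c rule: finite_induct)
    case empty
    have 1: "koszul X (\<lambda>B. kill Z (c B)) B \<in> I" for B
    proof -
      have "kill Z (koszul X c B) \<in> I" by (rule killI') (rule empty.prems(5))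
      then show ?thesis using kill_koszul[of Z c X B] empty.prems(6) by simp
    qed
    have 2: "homogeneous e (kill Z (c B))" for B
      using empty.prems(4)[of B] by (auto simp: homogeneous_def kill_def keys_restr)
    obtain b where b: "\<And>B. b B \<in> polys X" "\<And>B. kill Z (c B) - koszul X b B \<in> I"
      using regularE[OF r empty.prems(2) kill_polys[OF empty.prems(3)] 2 1] by blast
    have "c B - koszul X b B \<in> I'" for B
    proof -
      have "c B - koszul X b B = (kill Z (c B) - koszul X b B) + (c B - kill Z (c B))" by simp
      also have "\<dots> \<in> I'" by (intro ideal_add[OF I'] sub b(2) sub' diff_kill_mem empty.prems(3) Z)
      finally show ?thesis .
    qed
    then show ?case using b(1) by auto
  next
    case (insert z W)
    then have z: "z \<in> Z" "z \<in> X" using Z by auto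
    have vz: "var z * p \<in> I'" if "p \<in> polys X" for p
      using that z by (simp add: mult.commute[of "var z"]) (intro sub' gen_mult gen_base imageI)
    \<comment> \<open>split \<open>c\<close> into the part without \<open>e\<^sub>z\<close> and \<open>e\<^sub>z\<close> times \<open>g\<close>\<close>
    define a where "a = contract z (create z c)"
    define g where "g = contract z c"
    have c_eq: "c B = a B + create z g B" for B
      by (auto simp: a_def g_def contract_create_same create_contract_same)
    have zg: "koszul X (create z g) B = var z * g B - create z (koszul X g) B" for B
      using koszul_create[OF X z(2), of g B] by (simp add: algebra_simps)
    have dg: "koszul X g B \<in> I'" for B
    proof -
      have "koszul X g B = - contract z (koszul X c) B" using contract_koszul[of z X c B] by (simp add: g_def)
      also have "\<dots> \<in> I'" by (intro ideal_uminus[OF I'] contract_mem[OF I'] insert.prems(5))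
      finally show ?thesis .
    qed
    have gp: "g B \<in> polys X" and ap: "a B \<in> polys X" for B
      unfolding g_def a_def using insert.prems(3) by (auto intro!: contract_polys create_polys)
    have da: "koszul X a B \<in> I'" for B
    proof -
      have "koszul X a B = koszul X c B - koszul X (create z g) B"
        using koszul_diff[of X c "create z g" B] c_eq by simp
      also have "\<dots> = koszul X c B - var z * g B + create z (koszul X g) B" by (simp add: zg)
      finally show ?thesis
        by (simp only:) (intro ideal_add[OF I'] ideal_diff[OF I'] insert.prems(5) vz gp create_mem[OF I'] dg)
    qed
    have con0: "contract y a B = 0" "contract y g B = 0" if y: "y \<in> Z - W" for y B
    proof -
      have cc: "contract y c = (\<lambda>B. 0)" if "y \<noteq> z"
        using insert.prems(6)[of y] y that by (auto simp: fun_eq_iff)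
      show "contract y g B = 0"
      proof (cases "y = z")
        case True
        then show ?thesis by (simp add: g_def contract_def)
      next
        case False
        then show ?thesis using contract_contract[of y z c B] by (simp add: g_def cc contract_0)
      qed
      show "contract y a B = 0"
      proof (cases "y = z")
        case True
        then show ?thesis by (simp add: a_def contract_def)
      next
        case False
        have "contract y (create z c) B = 0" for B
          using create_contract[OF False, of c B] by (simp add: cc[OF False] create_0)
        then have "contract y (create z c) = (\<lambda>B. 0)" by (simp add: fun_eq_iff)
        then show ?thesis using contract_contract[of y z "create z c" B] by (simp add: a_def contract_0)
      qed
    qed
    have sgn: "homogeneous e (koszul_sign y B * p)" if p: "homogeneous e p" for y B and p :: "'a mpol"
      using homogeneous_uminus[OF p] p by (cases "even (card {b \<in> B. code b < code y})") (auto simp: koszul_sign_def)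
    have homg: "homogeneous e (g B)" and homa: "homogeneous e (a B)" for B
      using insert.prems(4) by (auto simp: g_def a_def contract_def create_def intro!: sgn)
    have WZ: "W \<subseteq> Z" using insert.prems(1) by simp
    obtain b1 where b1: "\<And>B. b1 B \<in> polys X" "\<And>B. a B - koszul X b1 B \<in> I'"
      using insert.IH[OF WZ insert.prems(2) ap homa da con0(1)] by blast
    obtain b2 where b2: "\<And>B. b2 B \<in> polys X" "\<And>B. g B - koszul X b2 B \<in> I'"
      using insert.IH[OF WZ insert.prems(2) gp homg dg con0(2)] by blast
    define b where "b = (\<lambda>B. b1 B - create z b2 B)"
    have "c B - koszul X b B = (a B - koszul X b1 B) + create z (\<lambda>B. g B - koszul X b2 B) B + var z * b2 B" for B
      using koszul_create[OF X z(2), of b2 B] by (simp add: b_def c_eq koszul_diff create_diff algebra_simps)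
    then have "c B - koszul X b B \<in> I'" for B
      by (simp only:) (intro ideal_add[OF I'] b1(2) create_mem[OF I'] b2(2) vz b2(1))
    moreover have "b B \<in> polys X" for B unfolding b_def using b1(1) b2(1) by (intro polys_diff create_polys)
    ultimately show ?case by blast
  qed
  show ?thesis
  proof (rule regularI)
    fix e and c :: "indet set \<Rightarrow> 'a mpol"
    assume "e > r" "\<And>B. c B \<in> polys X" "\<And>B. homogeneous e (c B)" "\<And>B. koszul X c B \<in> I'"
    then show "\<exists>b. (\<forall>B. b B \<in> polys X) \<and> (\<forall>B. c B - koszul X b B \<in> I')"
      by (intro claim[OF finite_subset[OF Z X] subset_refl]) auto
  qed
qed

lemma homogeneous_lookup_0:
  assumes "homogeneous e p" "e \<noteq> 0"
  shows "lookup p 0 = 0"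
proof (rule ccontr)
  assume "lookup p 0 \<noteq> 0"
  then have "0 \<in> keys p" by (simp add: in_keys_iff)
  then have "int (mon_degree 0) = e" using assms(1) unfolding homogeneous_def by blast
  then show False using assms(2) by simp
qed

text \<open>The Koszul homology of \<open>S\<close> itself consists of classes of constants.\<close>

lemma regular_zero:
  assumes "finite X"
  shows "regular X {0 :: 'k::field mpol} 0"
proof (rule regularI)
  fix e and c :: "indet set \<Rightarrow> 'k mpol"
  assume e: "e > 0" and c: "\<And>B. c B \<in> polys X" "\<And>B. homogeneous e (c B)" and d: "\<And>B. koszul X c B \<in> {0}"
  have c0: "lookup (c B) 0 = 0" for B
    by (rule homogeneous_lookup_0[OF c(2)]) (use e in simp)
  have dc: "koszul X c B = 0" for B using d by simp
  obtain b where b: "\<And>B. b B \<in> polys X" "\<And>B. koszul X b B = c B"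
    using koszul_acyclic[OF assms c(1) c0 dc] by blast
  then show "\<exists>b. (\<forall>B. b B \<in> polys X) \<and> (\<forall>B. c B - koszul X b B \<in> {0})"
    by (intro exI[of _ b]) simp
qed

section \<open>Deleting a vertex and completing its neighbourhood\<close>

definition edge_binomial :: "nat \<Rightarrow> nat \<Rightarrow> 'k::field mpol" where
  "edge_binomial i j = var (IX i) * var (IY j) - var (IX j) * var (IY i)"

lemma edge_binomial_swap: "edge_binomial j i = - edge_binomial i j"
  by (simp add: edge_binomial_def)

lemma edge_binomial_same [simp]: "edge_binomial i i = 0"
  by (simp add: edge_binomial_def)

lemma IX_indets [simp]: "IX i \<in> indets V \<longleftrightarrow> i \<in> V"
  and IY_indets [simp]: "IY i \<in> indets V \<longleftrightarrow> i \<in> V"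
  by (auto simp: indets_def)

lemma finite_indets: "finite V \<Longrightarrow> finite (indets V)"
  by (simp add: indets_def)

lemma edge_binomial_polys: "i \<in> V \<Longrightarrow> j \<in> V \<Longrightarrow> edge_binomial i j \<in> polys (indets V)"
  unfolding edge_binomial_def by (intro polys_diff polys_mult polys_var) simp_all

lemma homogeneous_edge_binomial: "homogeneous 2 (edge_binomial i j)"
  unfolding edge_binomial_def
  using homogeneous_mult[OF homogeneous_var homogeneous_var] by (intro homogeneous_diff) auto

lemma kill_edge_binomial:
  "kill Z (edge_binomial i j) =
     (if IX i \<in> Z \<or> IY j \<in> Z then 0 else var (IX i) * var (IY j))
     - (if IX j \<in> Z \<or> IY i \<in> Z then 0 else var (IX j) * var (IY i))"
  by (simp add: edge_binomial_def kill_diff kill_mult kill_var)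

definition edge_binomials :: "nat graph \<Rightarrow> 'k::field mpol set" where
  "edge_binomials G = {edge_binomial i j |i j. i < j \<and> {i, j} \<in> edges G}"

abbreviation edge_ideal :: "nat set \<Rightarrow> nat graph \<Rightarrow> 'k::field mpol set" where
  "edge_ideal V G \<equiv> gen (indets V) (edge_binomials G)"

lemma edge_in_gen:
  assumes "{i, j} \<in> edges G"
  shows "edge_binomial i j \<in> gen X (edge_binomials G)"
proof -
  consider "i < j" | "i = j" | "j < i" by linarith
  then show ?thesis
  proof cases
    case 1
    then show ?thesis using assms by (auto simp: edge_binomials_def intro!: gen_base)
  next
    case 2
    then show ?thesis by (simp add: gen_zero)
  next
    case 3
    moreover have "{j, i} \<in> edges G" using assms by (simp add: insert_commute)
    ultimately have "edge_binomial j i \<in> gen X (edge_binomials G)"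
      by (intro gen_base) (auto simp: edge_binomials_def)
    then have "(- 1) * edge_binomial j i \<in> gen X (edge_binomials G)"
      by (intro gen_mult polys_uminus) auto
    then show ?thesis by (simp add: edge_binomial_swap[of i j])
  qed
qed

lemma graph_edge:
  assumes "is_graph G" "{i, j} \<in> edges G"
  shows "i \<in> verts G" "j \<in> verts G" "i \<noteq> j"
  using assms unfolding is_graph_def by (auto dest!: bspec)

lemma edge_binomials_polys: "is_graph G \<Longrightarrow> verts G \<subseteq> V \<Longrightarrow> edge_binomials G \<subseteq> polys (indets V)"
  using graph_edge[of G] by (auto simp: edge_binomials_def intro!: edge_binomial_polys; blast)

lemma edge_binomials_hom_ideal:
  "is_graph G \<Longrightarrow> verts G \<subseteq> V \<Longrightarrow> hom_ideal (indets V) (edge_ideal V G)"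
  by (rule gen_hom_ideal[OF edge_binomials_polys])
    (auto simp: edge_binomials_def intro: homogeneous_edge_binomial)

lemma kill_vertex_edge_binomial:
  "kill {IX v, IY v} (edge_binomial i j) = (if i = v \<or> j = v then 0 else edge_binomial i j)"
  by (auto simp: kill_edge_binomial) (simp add: edge_binomial_def)

text \<open>Expanding a vanishing \<open>3 \<times> 3\<close> determinant with a repeated row. It
  puts \<open>(x\<^sub>v, y\<^sub>v) f\<^bsub>ij\<^esub>\<close> into \<open>J\<^sub>G\<close> for neighbours \<open>i, j\<close> of \<open>v\<close>.\<close>

lemma var_times_edge_binomial:
  "var (IX v) * edge_binomial i j = var (IX i) * edge_binomial v j + - var (IX j) * edge_binomial v i"
  "var (IY v) * edge_binomial i j = var (IY i) * edge_binomial v j + - var (IY j) * edge_binomial v i"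
  by (simp_all add: edge_binomial_def algebra_simps)

text \<open>The intersection \<open>J\<^sub>G = J\<^bsub>G\<^sub>v\<^esub> \<inter> ((x\<^sub>v, y\<^sub>v) + J\<^bsub>G-v\<^esub>)\<close> has an elementary proof. Let \<open>\<rho>\<close> set \<open>x\<^sub>v\<close> and
  \<open>y\<^sub>v\<close> to zero. By \<open>var_times_edge_binomial\<close>, \<open>f - \<rho>(f)\<close> lies in \<open>J\<^sub>G\<close> for every \<open>f\<close> in \<open>J\<^bsub>G\<^sub>v\<^esub>\<close>; and if \<open>f\<close>
  is also in \<open>(x\<^sub>v, y\<^sub>v) + J\<^bsub>G-v\<^esub>\<close>, then \<open>\<rho>(f)\<close> lies in \<open>J\<^bsub>G-v\<^esub>\<close>, hence in \<open>J\<^sub>G\<close>.\<close>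

theorem regular_vertex_step:
  fixes G :: "nat graph"
  assumes V: "finite V" "verts G \<subseteq> V" and G: "is_graph G" and v: "v \<in> verts G"
    and G': "is_graph (complete_at G v)" and H: "is_graph (delete_vertex G v)"
    and r: "regular (indets V) (edge_ideal V (complete_at G v) :: 'k::field mpol set) (r - 1)"
      "regular (indets V) (edge_ideal V (delete_vertex G v) :: 'k mpol set) r"
  shows "regular (indets V) (edge_ideal V G :: 'k mpol set) r"
proof -
  define X where "X = indets V"
  define Z where "Z = {IX v, IY v}"
  define G' where "G' = complete_at G v"
  define H where "H = delete_vertex G v"
  have X: "finite X" unfolding X_def by (rule finite_indets[OF V(1)])
  have Z: "Z \<subseteq> X" using v V(2) by (auto simp: Z_def X_def)
  have edgesG': "edges G' = edges G \<union> all_pairs (neighbours G v)"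
    and edgesH: "edges H = {e \<in> edges G. e \<subseteq> verts G - {v}}"
    by (simp_all add: G'_def H_def complete_at_def delete_vertex_def induced_def)
  have "verts G' = verts G" "verts H \<subseteq> verts G"
    by (auto simp: G'_def H_def complete_at_def delete_vertex_def induced_def)
  then have vV: "verts G' \<subseteq> V" "verts H \<subseteq> V" using V(2) by auto
  have gr: "is_graph G'" "is_graph H" using assms by (auto simp: G'_def H_def)
  let ?J = "\<lambda>G. gen X (edge_binomials G) :: 'k mpol set"
  have bH: "edge_binomials H \<subseteq> (edge_binomials G :: 'k mpol set)"
    and bG: "edge_binomials G \<subseteq> (edge_binomials G' :: 'k mpol set)"
    by (auto simp: edge_binomials_def edgesH edgesG')
  have varZ: "var ` Z \<subseteq> (polys X :: 'k mpol set)" using Z by (auto intro: polys_var)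
  have hom: "hom_ideal X (?J G)" "hom_ideal X (?J G')" "hom_ideal X (?J H)"
    unfolding X_def using G gr V(2) vV by (auto intro: edge_binomials_hom_ideal)
  note idl = hom[THEN hom_ideal_ideal]
  have pol: "edge_binomials G \<subseteq> (polys X :: 'k mpol set)" "edge_binomials G' \<subseteq> (polys X :: 'k mpol set)"
     "edge_binomials H \<subseteq> (polys X :: 'k mpol set)"
    unfolding X_def using G gr V(2) vV by (auto dest: edge_binomials_polys)
  have inX: "IX i \<in> X" "IY i \<in> X" if "i \<in> V" for i using that by (auto simp: X_def)
  have kill_sub: "kill Z a \<in> insert 0 {a}" if "a \<in> edge_binomials F" for a :: "'k mpol" and F
    using that by (auto simp: edge_binomials_def Z_def kill_vertex_edge_binomial)
  have kill_gen: "kill Z p \<in> ?J F" if "p \<in> ?J F" "is_ideal X (?J F)" for p F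
  proof (rule kill_gen_mem[OF that])
    fix a :: "'k mpol" assume "a \<in> edge_binomials F"
    then show "kill Z a \<in> ?J F" using kill_sub[of a F] gen_base[of a "edge_binomials F" X] by (auto intro: gen_zero)
  qed
  define J2 where "J2 = gen X (edge_binomials H \<union> var ` Z :: 'k mpol set)"
  define J3 where "J3 = gen X (edge_binomials G' \<union> var ` Z :: 'k mpol set)"
  have homJ2: "hom_ideal X J2"
    unfolding J2_def using pol(3) varZ
    by (intro gen_hom_ideal) (auto simp: edge_binomials_def intro: homogeneous_edge_binomial homogeneous_var)
  have rJ2: "regular X J2 r"
    by (rule regular_kill[OF X Z idl(3)])
      (use r(2) in \<open>auto simp: J2_def gen_Un H_def X_def idl(3)[unfolded H_def X_def] intro!: kill_gen[unfolded H_def X_def]\<close>)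
  have rJ3: "regular X J3 (r - 1)"
    by (rule regular_kill[OF X Z idl(2)])
      (use r(1) in \<open>auto simp: J3_def gen_Un G'_def X_def idl(2)[unfolded G'_def X_def] intro!: kill_gen[unfolded G'_def X_def]\<close>)
  have J3_iff: "w \<in> J3 \<longleftrightarrow> (\<exists>u\<in>?J G'. \<exists>v\<in>J2. w = u + v)" for w
  proof -
    have "edge_binomials G' \<union> var ` Z = (edge_binomials G' \<union> (edge_binomials H \<union> var ` Z) :: 'k mpol set)"
      using bH bG by blast
    then show ?thesis unfolding J3_def J2_def by (simp only: gen_Un)
  qed
  have zq: "var z * edge_binomial i j \<in> ?J G" if "i \<in> neighbours G v" "j \<in> neighbours G v" "z \<in> Z" for i j z
  proof -
    have ij: "{v, i} \<in> edges G" "{v, j} \<in> edges G" using that by (auto simp: neighbours_def)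
    then have ijV: "i \<in> V" "j \<in> V" using graph_edge[OF G] V(2) by blast+
    have "var (IX v) * edge_binomial i j \<in> ?J G" "var (IY v) * edge_binomial i j \<in> ?J G"
      unfolding var_times_edge_binomial[of v i j]
      by (intro gen_add gen_mult edge_in_gen polys_uminus polys_var inX ij ijV)+
    then show ?thesis using that(3) by (auto simp: Z_def)
  qed
  have mult: "q * edge_binomial i j \<in> ?J G"
    if "q \<in> gen X (var ` Z)" "i \<in> neighbours G v" "j \<in> neighbours G v" for q i j
    using that(1)
  proof (induction rule: gen.induct)
    case gen_zero then show ?case by (simp add: gen.gen_zero)
  next
    case (gen_step p a q)
    then obtain z where "z \<in> Z" "a = var z" by auto
    then have "a * edge_binomial i j \<in> ?J G" using zq that(2,3) by simp
    then have "p * (a * edge_binomial i j) \<in> ?J G" by (rule gen_mult[OF _ gen_step(1)])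
    then show ?case using gen_step by (simp add: distrib_right gen_add mult.assoc)
  qed
  have diff: "f - kill Z f \<in> ?J G" if "f \<in> ?J G'" for f
    using that
  proof (induction rule: gen.induct)
    case gen_zero then show ?case by (simp add: gen.gen_zero)
  next
    case (gen_step p a q)
    from gen_step(2) obtain i j where ij: "a = edge_binomial i j" "i < j" "{i, j} \<in> edges G'"
      by (auto simp: edge_binomials_def)
    have "p * a - kill Z (p * a) \<in> ?J G"
    proof (cases "{i, j} \<in> edges G")
      case True
      have "p * a \<in> ?J G" unfolding ij(1) by (intro gen_mult edge_in_gen gen_step(1) True)
      then show ?thesis by (intro ideal_diff[OF idl(1)] kill_gen idl(1))
    next
      case False
      then obtain i' j' where e: "{i, j} = {i', j'}" "i' \<in> neighbours G v" "j' \<in> neighbours G v"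
        using ij(3) by (auto simp: edgesG' all_pairs_def)
      then have n: "i \<in> neighbours G v" "j \<in> neighbours G v" by (auto simp: doubleton_eq_iff)
      then have "i \<noteq> v" "j \<noteq> v" using graph_edge(3)[OF G] by (auto simp: neighbours_def)
      then have "kill Z a = a" by (simp add: ij(1) Z_def kill_vertex_edge_binomial)
      then have "p * a - kill Z (p * a) = (p - kill Z p) * a" by (simp add: kill_mult left_diff_distrib)
      then show ?thesis using mult[OF diff_kill_mem[OF gen_step(1) Z] n] by (simp add: ij(1))
    qed
    moreover have "p * a + q - kill Z (p * a + q) = (p * a - kill Z (p * a)) + (q - kill Z q)"
      by (simp add: kill_add)
    ultimately show ?case using gen_add[of "p * a - kill Z (p * a)" X _ "q - kill Z q"] gen_step(4) by metis
  qed
  have "?J G = ?J G' \<inter> J2"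
  proof
    have "edge_binomials G \<subseteq> J2"
    proof
      fix a :: "'k mpol" assume "a \<in> edge_binomials G"
      then obtain i j where ij: "a = edge_binomial i j" "i < j" "{i, j} \<in> edges G" by (auto simp: edge_binomials_def)
      have V': "i \<in> V" "j \<in> V" using graph_edge[OF G ij(3)] V(2) by blast+
      have z: "p * var z \<in> J2" if "p \<in> polys X" "z \<in> Z" for p z
        unfolding J2_def using that by (intro gen_mult gen_base) auto
      show "a \<in> J2"
      proof (cases "i = v \<or> j = v")
        case False
        then have "{i, j} \<in> edges H" using ij graph_edge[OF G ij(3)] by (auto simp: edgesH)
        then show ?thesis using ij unfolding J2_def by (intro gen_base) (auto simp: edge_binomials_def)
      next
        case True
        have e: "a = var (IX i) * var (IY j) - var (IY i) * var (IX j)"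
          "a = var (IY j) * var (IX i) - var (IX j) * var (IY i)"
          by (simp_all add: ij(1) edge_binomial_def mult.commute)
        note d = ideal_diff[OF hom_ideal_ideal[OF homJ2]]
        from True show ?thesis
        proof
          assume "i = v"
          then show ?thesis unfolding e(2) by (intro d z polys_var inX V') (auto simp: Z_def)
        next
          assume "j = v"
          then show ?thesis unfolding e(1) by (intro d z polys_var inX V') (auto simp: Z_def)
        qed
      qed
    qed
    then show "?J G \<subseteq> ?J G' \<inter> J2"
      using gen_mono[OF bG] gen_least hom_ideal_ideal[OF homJ2] by blast
    show "?J G' \<inter> J2 \<subseteq> ?J G"
    proof
      fix f assume f: "f \<in> ?J G' \<inter> J2"
      have "kill Z f \<in> ?J G"
      proof (rule kill_gen_mem[OF _ idl(1)])
        show "f \<in> gen X (edge_binomials H \<union> var ` Z)" using f by (simp add: J2_def)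
        fix a :: "'k mpol" assume "a \<in> edge_binomials H \<union> var ` Z"
        then show "kill Z a \<in> ?J G"
        proof
          assume a: "a \<in> edge_binomials H"
          then have "a \<in> ?J G" using bH by (intro gen_base) blast
          then show ?thesis using kill_sub[OF a] by (auto simp: gen_zero)
        qed (auto simp: kill_var gen_zero)
      qed
      then show "f \<in> ?J G" using diff[of f] f gen_add[of "kill Z f" X _ "f - kill Z f"] by auto
    qed
  qed
  moreover have "regular X (?J G' \<inter> J2) r"
    by (rule regular_Int[OF X hom(2) homJ2 J3_iff _ rJ2 rJ3])
      (use r(1) in \<open>auto simp: G'_def X_def intro: regular_mono\<close>)
  ultimately show ?thesis by (simp add: X_def)
qed

section \<open>Disjoint unions of complete graphs\<close>

text \<open>The partition into cliques is encoded by labels: vertices with the same label \<open>Some l\<close> form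
  a clique, and \<open>None\<close> marks the isolated vertices. Taking a vertex or a whole clique out of the
  graph then only changes labels to \<open>None\<close>, and the ambient ring stays the same.\<close>

definition clique_binomials :: "nat set \<Rightarrow> (nat \<Rightarrow> nat option) \<Rightarrow> 'k::field mpol set" where
  "clique_binomials V \<kappa> = {edge_binomial i j |i j. i \<in> V \<and> j \<in> V \<and> \<kappa> i = \<kappa> j \<and> \<kappa> i \<noteq> None}"

definition clique_labels :: "nat set \<Rightarrow> (nat \<Rightarrow> nat option) \<Rightarrow> nat set" where
  "clique_labels V \<kappa> = {l. \<exists>i\<in>V. \<kappa> i = Some l}"

lemma clique_binomials_polys: "clique_binomials V \<kappa> \<subseteq> polys (indets V)"
  by (auto simp: clique_binomials_def intro!: edge_binomial_polys)

abbreviation clique_ideal :: "nat set \<Rightarrow> (nat \<Rightarrow> nat option) \<Rightarrow> 'k::field mpol set" where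
  "clique_ideal V \<kappa> \<equiv> gen (indets V) (clique_binomials V \<kappa>)"

lemma clique_binomialsI:
  "i \<in> V \<Longrightarrow> j \<in> V \<Longrightarrow> \<kappa> i = Some l \<Longrightarrow> \<kappa> j = Some l \<Longrightarrow> edge_binomial i j \<in> clique_binomials V \<kappa>"
  unfolding clique_binomials_def by (intro CollectI exI[of _ i] exI[of _ j]) simp

text \<open>The exponents seen by the parametrisation \<open>x\<^sub>i \<mapsto> s\<^sub>i a\<^sub>l\<close>, \<open>y\<^sub>i \<mapsto> s\<^sub>i b\<^sub>l\<close>, where \<open>l\<close> is the label
  of \<open>i\<close>; the variables of an isolated vertex are kept. Monomials in the variables of \<open>V\<close> have the same
  type when their images under this map agree.\<close>

definition same_type :: "nat set \<Rightarrow> (nat \<Rightarrow> nat option) \<Rightarrow> mon \<Rightarrow> mon \<Rightarrow> bool" where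
  "same_type V \<kappa> m m' \<longleftrightarrow>
     (\<forall>i. lookup m (IX i) + lookup m (IY i)
        = lookup m' (IX i) + lookup m' (IY i)) \<and>
     (\<forall>i. \<kappa> i = None \<longrightarrow> lookup m (IX i) = lookup m' (IX i)) \<and>
     (\<forall>l. (\<Sum>i\<in>{i \<in> V. \<kappa> i = Some l}. lookup m (IX i))
        = (\<Sum>i\<in>{i \<in> V. \<kappa> i = Some l}. lookup m' (IX i)))"

lemma same_type_refl [simp]: "same_type V \<kappa> m m"
  and same_type_sym: "same_type V \<kappa> m m' \<Longrightarrow> same_type V \<kappa> m' m"
  and same_type_trans: "same_type V \<kappa> m m' \<Longrightarrow> same_type V \<kappa> m' m'' \<Longrightarrow> same_type V \<kappa> m m''"
  by (simp_all add: same_type_def)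

lemma same_type_cong: "same_type V \<kappa> m m' \<Longrightarrow> same_type V \<kappa> m m0 \<longleftrightarrow> same_type V \<kappa> m' m0"
  by (simp add: same_type_def)

lemma same_type_add: "same_type V \<kappa> (t + m) (t + m') \<longleftrightarrow> same_type V \<kappa> m m'"
proof -
  have "(t + m) + (t + m) = (t + m' :: nat) + (t + m') \<longleftrightarrow> m = m'" for t m m' :: nat by auto
  have "a + m + (b + n) = a + m' + (b + n') \<longleftrightarrow> m + n = m' + n'" for a b m n m' n' :: nat by auto
  then show ?thesis by (simp add: same_type_def lookup_add sum.distrib)
qed

lemma same_type_swap:
  assumes "finite V" "i \<in> V" "j \<in> V" "\<kappa> i = Some l" "\<kappa> j = Some l"
  shows "same_type V \<kappa> (single (IX i) 1 + single (IY j) 1)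
           (single (IX j) 1 + single (IY i) 1)"
proof -
  have "(\<Sum>h\<in>{h \<in> V. \<kappa> h = Some l'}. (1::nat) when i = h) = (\<Sum>h\<in>{h \<in> V. \<kappa> h = Some l'}. 1 when j = h)" for l'
    using assms by (simp add: when_def sum.delta')
  then show ?thesis using assms
    by (auto simp: same_type_def lookup_add lookup_single when_def)
qed

lemma monomial_swap_mem:
  assumes "i \<in> V" "j \<in> V" "\<kappa> i = Some l" "\<kappa> j = Some l" "keys t \<subseteq> indets V"
  shows "single (t + (single (IX i) 1 + single (IY j) 1)) 1
       - single (t + (single (IX j) 1 + single (IY i) 1)) 1
     \<in> (clique_ideal V \<kappa> :: 'k::field mpol set)"
proof -
  have "single t 1 * edge_binomial i j \<in> (clique_ideal V \<kappa> :: 'k mpol set)"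
    using assms by (intro gen_mult gen_base clique_binomialsI) (auto simp: polys_def)
  then show ?thesis by (simp add: edge_binomial_def var_def mult_single right_diff_distrib)
qed

text \<open>If \<open>m\<close> and \<open>m'\<close> have the same type but different exponents, some \<open>x\<^sub>i\<close> occurs too often in \<open>m\<close>
  and some \<open>x\<^sub>j\<close> of the same clique too rarely; replacing \<open>x\<^sub>i y\<^sub>j\<close> by \<open>x\<^sub>j y\<^sub>i\<close> lowers the total
  excess.\<close>

lemma same_type_congruent:
  assumes V: "finite V" and st: "same_type V \<kappa> m m'"
    and m: "keys m \<subseteq> indets V" and m': "keys m' \<subseteq> indets V"
  shows "single m 1 - single m' 1 \<in> (clique_ideal V \<kappa> :: 'k::field mpol set)"
  using st m
proof (induction "\<Sum>i\<in>V. lookup m (IX i) - lookup m' (IX i)" arbitrary: m rule: less_induct)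
  case less
  let ?x = "\<lambda>m i. lookup m (IX i)" and ?y = "\<lambda>m i. lookup m (IY i)"
  have xy: "?x m i + ?y m i = ?x m' i + ?y m' i" for i using less.prems(1) by (simp add: same_type_def)
  have cl: "(\<Sum>i\<in>{i \<in> V. \<kappa> i = Some l}. ?x m i) = (\<Sum>i\<in>{i \<in> V. \<kappa> i = Some l}. ?x m' i)" for l
    using less.prems(1) by (simp add: same_type_def)
  have none: "?x m i = ?x m' i" if "\<kappa> i = None" for i using less.prems(1) that by (simp add: same_type_def)
  have out: "?x m i = 0" "?x m' i = 0" "?y m i = 0" "?y m' i = 0" if "i \<notin> V" for i
    using that less.prems(2) m' by (auto simp: not_in_keys_iff_lookup_eq_zero[symmetric])
  show ?case
  proof (cases "\<exists>i\<in>V. ?x m i > ?x m' i")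
    case False
    have x: "?x m i = ?x m' i" for i
    proof (cases "i \<in> V \<and> \<kappa> i \<noteq> None")
      case True
      then obtain l where l: "i \<in> V" "\<kappa> i = Some l" by auto
      show ?thesis
      proof (rule ccontr)
        assume "?x m i \<noteq> ?x m' i"
        then have "?x m i < ?x m' i" using False l by (meson linorder_neqE_nat)
        then have "(\<Sum>i\<in>{i \<in> V. \<kappa> i = Some l}. ?x m i) < (\<Sum>i\<in>{i \<in> V. \<kappa> i = Some l}. ?x m' i)"
          using V l False by (intro sum_strict_mono_ex1) (auto simp: not_less)
        then show False using cl[of l] by simp
      qed
    qed (use none out in auto)
    then have "?y m i = ?y m' i" for i using xy[of i] by simp
    then have "m = m'" using x by (intro poly_mapping_eqI) (metis indet.exhaust)
    then show ?thesis by (simp add: gen_zero)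
  next
    case True
    then obtain i where i: "i \<in> V" "?x m i > ?x m' i" by auto
    then obtain l where l: "\<kappa> i = Some l" using none by (cases "\<kappa> i") auto
    have "\<exists>j\<in>V. \<kappa> j = Some l \<and> ?x m j < ?x m' j"
    proof (rule ccontr)
      assume "\<not> ?thesis"
      then have "(\<Sum>i\<in>{i \<in> V. \<kappa> i = Some l}. ?x m' i) < (\<Sum>i\<in>{i \<in> V. \<kappa> i = Some l}. ?x m i)"
        using V i l by (intro sum_strict_mono_ex1) (auto simp: not_less)
      then show False using cl[of l] by simp
    qed
    then obtain j where j: "j \<in> V" "\<kappa> j = Some l" "?x m j < ?x m' j" by blast
    have ij: "i \<noteq> j" using i j by auto
    have yj: "?y m j > 0" using xy[of j] j(3) by simp
    define a where "a = single (IX i) (1::nat) + single (IY j) 1"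
    define b where "b = single (IX j) (1::nat) + single (IY i) 1"
    define t where "t = m - a"
    have mt: "m = t + a"
      using i(2) yj unfolding t_def a_def
      by (intro poly_mapping_eqI) (auto simp: lookup_add lookup_minus lookup_single when_def)
    have kt: "keys t \<subseteq> indets V" using less.prems(2) by (simp add: mt keys_add_nat)
    have kb: "keys (t + b) \<subseteq> indets V"
      using kt i j by (simp add: keys_add_nat b_def)
    have "same_type V \<kappa> b a" unfolding a_def b_def
      using same_type_swap[OF V j(1) i(1) j(2) l] .
    then have "same_type V \<kappa> (t + b) (t + a)" unfolding same_type_add .
    then have st': "same_type V \<kappa> (t + b) m'"
      by (rule same_type_trans) (use less.prems(1) mt in simp)
    have "(\<Sum>h\<in>V. ?x (t + b) h - ?x m' h) < (\<Sum>h\<in>V. ?x m h - ?x m' h)"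
    proof (rule sum_strict_mono_ex1[OF V])
      show "\<forall>h\<in>V. ?x (t + b) h - ?x m' h \<le> ?x m h - ?x m' h"
      proof
        fix h
        show "?x (t + b) h - ?x m' h \<le> ?x m h - ?x m' h"
          using j(3) ij unfolding mt by (auto simp: a_def b_def lookup_add lookup_single when_def)
      qed
      show "\<exists>h\<in>V. ?x (t + b) h - ?x m' h < ?x m h - ?x m' h"
        using i ij unfolding mt by (intro bexI[of _ i]) (auto simp: a_def b_def lookup_add lookup_single when_def)
    qed
    then have "single (t + b) 1 - single m' 1
        \<in> (clique_ideal V \<kappa> :: 'k mpol set)"
      using less.hyps st' kb by blast
    moreover have "single (t + a) 1 - single (t + b) 1
        \<in> (clique_ideal V \<kappa> :: 'k mpol set)"
      unfolding a_def b_def using monomial_swap_mem[OF i(1) j(1) l j(2) kt] .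
    ultimately show ?thesis
      using gen_add[of "single (t + a) 1 - single (t + b) 1"] unfolding mt by fastforce
  qed
qed

text \<open>The coefficient of the image of \<open>m0\<close> in the image of \<open>f\<close> under the parametrisation. The clique
  ideal turns out to be the common kernel of these functionals, that is, the toric ideal of the
  parametrisation.\<close>

definition type_sum :: "nat set \<Rightarrow> (nat \<Rightarrow> nat option) \<Rightarrow> mon \<Rightarrow> 'k::field mpol \<Rightarrow> 'k" where
  "type_sum V \<kappa> m0 f = (\<Sum>m\<in>{m \<in> keys f. same_type V \<kappa> m m0}. lookup f m)"

lemma type_sum_superset:
  "finite S \<Longrightarrow> keys f \<subseteq> S \<Longrightarrow>
    type_sum V \<kappa> m0 f = (\<Sum>m\<in>{m \<in> S. same_type V \<kappa> m m0}. lookup f m)"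
  unfolding type_sum_def by (rule sum.mono_neutral_left) (auto simp: in_keys_iff)

lemma type_sum_0 [simp]: "type_sum V \<kappa> m0 0 = 0"
  by (simp add: type_sum_def)

lemma type_sum_add: "type_sum V \<kappa> m0 (f + g) = type_sum V \<kappa> m0 f + type_sum V \<kappa> m0 g"
proof -
  let ?S = "keys f \<union> keys g"
  have "type_sum V \<kappa> m0 h = (\<Sum>m\<in>{m \<in> ?S. same_type V \<kappa> m m0}. lookup h m)"
    if "keys h \<subseteq> ?S" for h :: "'a mpol" using that by (intro type_sum_superset) auto
  from this[of f] this[of g] this[of "f + g"] show ?thesis
    using keys_add[of f g] by (simp add: lookup_add sum.distrib)
qed

lemma type_sum_single: "type_sum V \<kappa> m0 (single m c) = (if same_type V \<kappa> m m0 then c else 0)"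
proof -
  have "{m' \<in> {m}. same_type V \<kappa> m' m0} = (if same_type V \<kappa> m m0 then {m} else {})" by auto
  then show ?thesis using type_sum_superset[of "{m}" "single m c" V \<kappa> m0] by simp
qed

lemma type_sum_diff: "type_sum V \<kappa> m0 (f - g) = type_sum V \<kappa> m0 f - type_sum V \<kappa> m0 g"
  using type_sum_add[of V \<kappa> m0 "f - g" g] by simp

lemma type_sum_clique:
  assumes V: "finite V" and f: "f \<in> clique_ideal V \<kappa>"
  shows "type_sum V \<kappa> m0 f = 0"
  using f
proof (induction rule: gen.induct)
  case (gen_step p a q)
  then obtain i j l where a: "a = edge_binomial i j" and ij: "i \<in> V" "j \<in> V" "\<kappa> i = Some l" "\<kappa> j = Some l"
    unfolding clique_binomials_def by force
  have "type_sum V \<kappa> m0 (p * a) = 0"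
  proof (induction p rule: mpol_induct)
    case (monomial n c p)
    let ?a = "single (IX i) (1::nat) + single (IY j) 1"
    let ?b = "single (IX j) (1::nat) + single (IY i) 1"
    have "same_type V \<kappa> (n + ?a) (n + ?b)"
      unfolding same_type_add by (rule same_type_swap[OF V ij])
    then have "same_type V \<kappa> (n + ?a) m0 \<longleftrightarrow> same_type V \<kappa> (n + ?b) m0"
      by (rule same_type_cong)
    moreover have "single n c * a = single (n + ?a) c - single (n + ?b) c"
      by (simp add: a edge_binomial_def var_def mult_single right_diff_distrib)
    ultimately show ?case using monomial by (simp add: distrib_right type_sum_add type_sum_diff type_sum_single)
  qed simp
  then show ?case using gen_step by (simp add: type_sum_add)
qed simp

text \<open>A monomial of \<open>f\<close> cannot be alone in its type, and moving its coefficient to another monomial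
  of that type changes \<open>f\<close> by an element of the ideal and shortens it.\<close>

lemma type_sum_0_imp_mem:
  assumes V: "finite V" and "f \<in> polys (indets V)" "\<And>m0. type_sum V \<kappa> m0 f = 0"
  shows "f \<in> (clique_ideal V \<kappa> :: 'k::field mpol set)"
  using assms(2,3)
proof (induction "card (keys f)" arbitrary: f rule: less_induct)
  case less
  show ?case
  proof (cases "keys f = {}")
    case True
    then show ?thesis by (simp add: gen_zero)
  next
    case False
    then obtain m where m: "m \<in> keys f" by blast
    have "\<exists>m'\<in>keys f. m' \<noteq> m \<and> same_type V \<kappa> m' m"
    proof (rule ccontr)
      assume "\<not> ?thesis"
      then have "{m' \<in> keys f. same_type V \<kappa> m' m} = {m}" using m by auto
      then have "type_sum V \<kappa> m f = lookup f m" by (simp add: type_sum_def)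
      then show False using less.prems(2)[of m] m by (simp add: in_keys_iff)
    qed
    then obtain m' where m': "m' \<in> keys f" "m' \<noteq> m" "same_type V \<kappa> m' m" by blast
    define c where "c = lookup f m"
    define g where "g = f - (single m c - single m' c)"
    have lg: "lookup g n = (if n = m then 0 else if n = m' then lookup f m' + c else lookup f n)" for n
      using m'(2) by (auto simp: g_def lookup_minus lookup_single when_def c_def)
    have "keys g \<subseteq> keys f - {m}" using m'(1) by (auto simp: in_keys_iff lg split: if_splits)
    then have card: "card (keys g) < card (keys f)"
      using m by (metis card_Diff1_less card_mono finite_Diff finite_keys le_less_trans)
    have k: "keys m \<subseteq> indets V" "keys m' \<subseteq> indets V"
      using m m'(1) less.prems(1) by (auto simp: polys_def)
    then have "g \<in> polys (indets V)"
      unfolding g_def using less.prems(1) by (intro polys_diff) (auto simp: polys_def)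
    moreover have "type_sum V \<kappa> m0 g = 0" for m0
    proof -
      have "same_type V \<kappa> m' m0 \<longleftrightarrow> same_type V \<kappa> m m0"
        by (rule same_type_cong[OF m'(3)])
      then show ?thesis using less.prems(2) by (simp add: g_def type_sum_diff type_sum_single)
    qed
    ultimately have "g \<in> clique_ideal V \<kappa>" using less.hyps[OF card] by blast
    moreover have "single 0 c * (single m 1 - single m' 1)
        \<in> clique_ideal V \<kappa>"
      by (intro gen_mult same_type_congruent[OF V same_type_sym[OF m'(3)] k]) simp
    moreover have "f = g + single 0 c * (single m 1 - single m' 1)"
      by (simp add: g_def right_diff_distrib mult_single)
    ultimately show ?thesis using gen_add by metis
  qed
qed

text \<open>Multiplication by a variable acts injectively on types, so every type sum of \<open>f\<close> is also a
  type sum of its multiple.\<close>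

theorem clique_nonzerodivisor:
  assumes V: "finite V" and f: "f \<in> polys (indets V)"
    and zf: "var z * f \<in> (clique_ideal V \<kappa> :: 'k::field mpol set)"
  shows "f \<in> clique_ideal V \<kappa>"
proof (rule type_sum_0_imp_mem[OF V f])
  fix m0
  let ?s = "single z (1::nat)"
  have "{m \<in> keys (var z * f). same_type V \<kappa> m (?s + m0)}
      = (+) ?s ` {m \<in> keys f. same_type V \<kappa> m m0}"
    unfolding keys_var_mult using same_type_add[of V \<kappa> ?s _ m0] by blast
  then have "type_sum V \<kappa> (?s + m0) (var z * f)
      = (\<Sum>m\<in>{m \<in> keys f. same_type V \<kappa> m m0}. lookup (var z * f) (?s + m))"
    unfolding type_sum_def by (simp add: sum.reindex)
  also have "\<dots> = type_sum V \<kappa> m0 f"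
    by (simp add: type_sum_def lookup_var_mult lookup_add)
  finally show "type_sum V \<kappa> m0 f = 0" using type_sum_clique[OF V zf] by simp
qed

lemma clique_hom_ideal: "hom_ideal (indets V) (clique_ideal V \<kappa>)"
  by (rule gen_hom_ideal[OF clique_binomials_polys])
    (auto simp: clique_binomials_def intro: homogeneous_edge_binomial)

lemma finite_clique_labels: "finite V \<Longrightarrow> finite (clique_labels V \<kappa>)"
proof -
  assume "finite V"
  moreover have "clique_labels V \<kappa> \<subseteq> (\<lambda>i. the (\<kappa> i)) ` V" by (force simp: clique_labels_def)
  ultimately show ?thesis by (metis finite_imageI finite_subset)
qed

lemma clique_binomialsE:
  assumes "a \<in> clique_binomials V \<kappa>"
  obtains i j l where "a = edge_binomial i j" "i \<in> V" "j \<in> V" "\<kappa> i = Some l" "\<kappa> j = Some l"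
  using assms unfolding clique_binomials_def by force

lemma clique_binomials_mono:
  assumes "\<And>i l. \<kappa>' i = Some l \<Longrightarrow> \<kappa> i = Some l"
  shows "clique_binomials V \<kappa>' \<subseteq> clique_binomials V \<kappa>"
proof
  fix a :: "'a mpol" assume "a \<in> clique_binomials V \<kappa>'"
  then obtain i j l where "a = edge_binomial i j" "i \<in> V" "j \<in> V" "\<kappa>' i = Some l" "\<kappa>' j = Some l"
    by (rule clique_binomialsE)
  then show "a \<in> clique_binomials V \<kappa>" using assms by (simp add: clique_binomialsI)
qed

text \<open>Singletons with a label count as cliques, which keeps the induction uniform. For a vertex
  \<open>v\<close> in the clique \<open>C\<close>, divide by the nonzerodivisor \<open>x\<^sub>v\<close> and then apply the colon sequence for
  \<open>y\<^sub>v\<close>. On the colon side \<open>C\<close> disappears, so the bound there drops by one, as the sequence requires;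
  on the other side only \<open>v\<close> leaves its clique.\<close>

theorem regular_clique:
  assumes V: "finite V"
  shows "regular (indets V) (clique_ideal V \<kappa> :: 'k::field mpol set) (int (card (clique_labels V \<kappa>)))"
proof (induction "card {i \<in> V. \<kappa> i \<noteq> None}" arbitrary: \<kappa> rule: less_induct)
  case less
  define X where "X = indets V"
  have X: "finite X" unfolding X_def by (rule finite_indets[OF V])
  let ?K = "clique_binomials V :: _ \<Rightarrow> 'k mpol set"
  let ?r = "int (card (clique_labels V \<kappa>))"
  show ?case
  proof (cases "\<exists>v\<in>V. \<kappa> v \<noteq> None")
    case False
    then have "?K \<kappa> = {}" by (auto simp: clique_binomials_def)
    then have "gen X (?K \<kappa>) = {0}" by (auto intro: gen_zero elim: gen.cases)
    moreover have "regular X {0 :: 'k mpol} ?r" by (rule regular_mono[OF regular_zero[OF X]]) simp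
    ultimately show ?thesis by (simp add: X_def)
  next
    case True
    then obtain v l where v: "v \<in> V" "\<kappa> v = Some l" by auto
    define C where "C = {i \<in> V. \<kappa> i = Some l}"
    define \<kappa>1 where "\<kappa>1 = \<kappa>(v := None)"
    define \<kappa>2 where "\<kappa>2 = (\<lambda>i. if \<kappa> i = Some l then None else \<kappa> i)"
    have pol: "?K \<kappa> \<subseteq> polys X" for \<kappa> unfolding X_def by (rule clique_binomials_polys)
    have inX: "IX i \<in> X" "IY i \<in> X" if "i \<in> V" for i using that by (auto simp: X_def)
    have px: "(var (IX i) :: 'k mpol) \<in> polys X" "(var (IY i) :: 'k mpol) \<in> polys X" if "i \<in> V" for i
      using inX[OF that] by (auto intro: polys_var)
    have sub1: "{i \<in> V. \<kappa>1 i \<noteq> None} \<subseteq> {i \<in> V. \<kappa> i \<noteq> None} - {v}"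
      by (auto simp: \<kappa>1_def)
    have sub2: "{i \<in> V. \<kappa>2 i \<noteq> None} \<subseteq> {i \<in> V. \<kappa> i \<noteq> None} - {v}"
      using v by (auto simp: \<kappa>2_def split: if_splits)
    have fin: "finite ({i \<in> V. \<kappa> i \<noteq> None} - {v})" using V by simp
    have less_v: "card ({i \<in> V. \<kappa> i \<noteq> None} - {v}) < card {i \<in> V. \<kappa> i \<noteq> None}"
      using V v by (intro card_Diff1_less) auto
    note small = le_less_trans[OF card_mono[OF fin sub1] less_v] le_less_trans[OF card_mono[OF fin sub2] less_v]
    have "clique_labels V \<kappa>1 \<subseteq> clique_labels V \<kappa>"
      by (auto simp: clique_labels_def \<kappa>1_def split: if_splits)
    then have c1: "card (clique_labels V \<kappa>1) \<le> card (clique_labels V \<kappa>)"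
      by (rule card_mono[OF finite_clique_labels[OF V]])
    have "\<kappa>2 i = Some x \<longleftrightarrow> \<kappa> i = Some x \<and> x \<noteq> l" for i x by (auto simp: \<kappa>2_def)
    then have lab2: "clique_labels V \<kappa>2 = clique_labels V \<kappa> - {l}" by (auto simp: clique_labels_def)
    have lab: "l \<in> clique_labels V \<kappa>" using v unfolding clique_labels_def by blast
    have "Suc (card (clique_labels V \<kappa>2)) = card (clique_labels V \<kappa>)"
      unfolding lab2 by (rule card_Suc_Diff1[OF finite_clique_labels[OF V] lab])
    then have c2: "int (card (clique_labels V \<kappa>2)) = ?r - 1" by linarith
    have r1: "regular X (gen X (?K \<kappa>1)) ?r"
      using regular_mono[OF less.hyps[OF small(1)], of ?r] c1 unfolding X_def by simp
    have r2: "regular X (gen X (?K \<kappa>2)) (?r - 1)"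
      using less.hyps[OF small(2)] unfolding X_def c2 .
    have ideal: "is_ideal X (gen X (?K \<kappa>))" for \<kappa>
      unfolding X_def by (rule hom_ideal_ideal[OF clique_hom_ideal])
    define xv where "xv = (var (IX v) :: 'k mpol)"
    define yv where "yv = (var (IY v) :: 'k mpol)"
    define Iz where "Iz = gen X (insert xv (?K \<kappa>))"
    define Izz where "Izz = gen X (insert yv (insert xv (?K \<kappa>)))"
    define I' where "I' = gen X (?K \<kappa>2 \<union> var ` IX ` C)"
    have CV: "IX ` C \<subseteq> X" using inX by (auto simp: C_def)
    have polz: "insert yv (insert xv (?K \<kappa>)) \<subseteq> polys X"
      using pol[of \<kappa>] px[OF v(1)] by (simp add: xv_def yv_def)
    have homz: "\<exists>d. homogeneous d a" if "a \<in> insert yv (insert xv (?K \<kappa>))" for a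
      using that by (auto simp: xv_def yv_def clique_binomials_def intro: homogeneous_edge_binomial homogeneous_var)
    have hom: "hom_ideal X Iz" "hom_ideal X Izz"
      unfolding Iz_def Izz_def using polz homz by (intro gen_hom_ideal; simp)+
    note idz = hom[THEN hom_ideal_ideal]
    have polI': "?K \<kappa>2 \<union> var ` IX ` C \<subseteq> polys X" using pol[of \<kappa>2] CV by (auto intro: polys_var)
    have I'sub: "I' \<subseteq> polys X" and idI': "is_ideal X I'"
      unfolding I'_def using gen_ideal[OF polI'] by (auto simp: is_ideal_def)
    have regI': "regular X I' (?r - 1)"
    proof (rule regular_kill[OF X CV ideal _ _ r2])
      show "w \<in> I' \<longleftrightarrow> (\<exists>u\<in>gen X (?K \<kappa>2). \<exists>v\<in>gen X (var ` IX ` C). w = u + v)" for w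
        by (simp add: I'_def gen_Un)
      show "kill (IX ` C) p \<in> gen X (?K \<kappa>2)" if "p \<in> gen X (?K \<kappa>2)" for p
      proof (rule kill_gen_mem[OF that ideal])
        fix a assume a: "a \<in> ?K \<kappa>2"
        then have "kill (IX ` C) a = a"
          by (auto simp: clique_binomials_def kill_edge_binomial C_def \<kappa>2_def split: if_splits) (simp_all add: edge_binomial_def)
        then show "kill (IX ` C) a \<in> gen X (?K \<kappa>2)" using a by (simp add: gen_base)
      qed
    qed
    have Izz_eq: "Izz = gen X (?K \<kappa>1 \<union> var ` {IX v, IY v})"
    proof
      have A: "is_ideal X (gen X (?K \<kappa>1 \<union> var ` {IX v, IY v}))"
        using pol px v by (intro gen_ideal) auto
      have "a \<in> gen X (?K \<kappa>1 \<union> var ` {IX v, IY v})" if a: "a \<in> ?K \<kappa>" for a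
      proof -
        obtain i j k where ij: "a = edge_binomial i j" "i \<in> V" "j \<in> V" "\<kappa> i = Some k" "\<kappa> j = Some k"
          using a by (rule clique_binomialsE)
        have z: "p * var z \<in> gen X (?K \<kappa>1 \<union> var ` {IX v, IY v})" if "p \<in> polys X" "z \<in> {IX v, IY v}" for p z
          using that by (intro gen_mult gen_base) auto
        have e: "a = var (IX i) * var (IY j) - var (IY i) * var (IX j)"
          "a = var (IY j) * var (IX i) - var (IX j) * var (IY i)"
          by (simp_all add: ij(1) edge_binomial_def mult.commute)
        consider "i = v" | "j = v" | "i \<noteq> v" "j \<noteq> v" by blast
        then show ?thesis
        proof cases
          case 1
          then show ?thesis unfolding e(2) by (intro ideal_diff[OF A] z px ij) auto
        next
          case 2
          then show ?thesis unfolding e(1) by (intro ideal_diff[OF A] z px ij) auto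
        next
          case 3
          then have "a \<in> ?K \<kappa>1" unfolding ij(1) using ij
            by (intro clique_binomialsI[of _ _ _ _ k]) (auto simp: \<kappa>1_def)
          then show ?thesis by (intro gen_base) simp
        qed
      qed
      moreover have "xv \<in> gen X (?K \<kappa>1 \<union> var ` {IX v, IY v})" "yv \<in> gen X (?K \<kappa>1 \<union> var ` {IX v, IY v})"
        by (intro gen_base; simp add: xv_def yv_def)+
      ultimately show "Izz \<subseteq> gen X (?K \<kappa>1 \<union> var ` {IX v, IY v})"
        unfolding Izz_def using gen_least[OF _ A] by blast
      have "?K \<kappa>1 \<subseteq> ?K \<kappa>" by (rule clique_binomials_mono) (auto simp: \<kappa>1_def split: if_splits)
      then show "gen X (?K \<kappa>1 \<union> var ` {IX v, IY v}) \<subseteq> Izz"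
        unfolding Izz_def by (intro gen_mono) (auto simp: xv_def yv_def)
    qed
    have regIzz: "regular X Izz ?r"
    proof (rule regular_kill[OF X _ ideal _ _ r1])
      show "{IX v, IY v} \<subseteq> X" using inX v by auto
      show "w \<in> Izz \<longleftrightarrow> (\<exists>u\<in>gen X (?K \<kappa>1). \<exists>v\<in>gen X (var ` {IX v, IY v}). w = u + v)" for w
        unfolding Izz_eq by (rule gen_Un)
      show "kill {IX v, IY v} p \<in> gen X (?K \<kappa>1)" if "p \<in> gen X (?K \<kappa>1)" for p
      proof (rule kill_gen_mem[OF that ideal])
        fix a assume a: "a \<in> ?K \<kappa>1"
        then have "kill {IX v, IY v} a = a"
          by (auto simp: clique_binomials_def kill_vertex_edge_binomial \<kappa>1_def split: if_splits)
        then show "kill {IX v, IY v} a \<in> gen X (?K \<kappa>1)" using a by (simp add: gen_base)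
      qed
    qed
    have colon: "yv * f \<in> Iz \<longleftrightarrow> f \<in> I'" if f: "f \<in> polys X" for f
    proof
      assume "f \<in> I'"
      then show "yv * f \<in> Iz"
        unfolding I'_def
      proof (induction rule: gen.induct)
        case gen_zero
        then show ?case using ideal_0[OF idz(1)] by simp
      next
        case (gen_step p a q)
        have "yv * a \<in> Iz"
        proof (cases "a \<in> ?K \<kappa>2")
          case True
          moreover have "?K \<kappa>2 \<subseteq> ?K \<kappa>" by (rule clique_binomials_mono) (auto simp: \<kappa>2_def split: if_splits)
          ultimately have "a \<in> ?K \<kappa>" by blast
          then have "a \<in> Iz" unfolding Iz_def by (intro gen_base) simp
          then show ?thesis using px(2)[OF v(1)] idz(1) by (auto simp: yv_def intro: ideal_mult)
        next
          case False
          then obtain i where i: "i \<in> V" "\<kappa> i = Some l" "a = var (IX i)" using gen_step(2) by (auto simp: C_def)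
          have "edge_binomial i v \<in> ?K \<kappa>" by (rule clique_binomialsI[OF i(1) v(1) i(2) v(2)])
          then have "edge_binomial i v \<in> Iz" unfolding Iz_def by (intro gen_base) simp
          moreover have "var (IY i) * xv \<in> Iz" unfolding Iz_def by (intro gen_mult gen_base px i) simp
          moreover have "yv * a = edge_binomial i v + var (IY i) * xv"
            by (simp add: i(3) yv_def xv_def edge_binomial_def mult.commute)
          ultimately show ?thesis using ideal_add[OF idz(1)] by simp
        qed
        then have "p * (yv * a) \<in> Iz" using gen_step(1) by (rule ideal_mult[OF idz(1), rotated])
        then show ?case using ideal_add[OF idz(1) _ gen_step(4)] by (simp add: distrib_left mult.left_commute)
      qed
    next
      assume yf: "yv * f \<in> Iz"
      have "kill (IX ` C) (yv * f) \<in> gen X (?K \<kappa>2)"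
      proof (rule kill_gen_mem[OF yf[unfolded Iz_def] ideal])
        fix a assume a: "a \<in> insert xv (?K \<kappa>)"
        show "kill (IX ` C) a \<in> gen X (?K \<kappa>2)"
        proof (cases "a = xv")
          case True
          then show ?thesis using v by (simp add: xv_def kill_var C_def gen_zero)
        next
          case False
          then have "a \<in> ?K \<kappa>" using a by simp
          then obtain i j k where ij: "a = edge_binomial i j" "i \<in> V" "j \<in> V" "\<kappa> i = Some k" "\<kappa> j = Some k"
            by (rule clique_binomialsE)
          show ?thesis
          proof (cases "k = l")
            case True
            then show ?thesis using ij by (simp add: kill_edge_binomial C_def gen_zero image_iff)
          next
            case False
            then have "kill (IX ` C) a = a"
              using ij by (auto simp: kill_edge_binomial C_def) (simp add: edge_binomial_def)
            moreover have "a \<in> ?K \<kappa>2" unfolding ij(1) using ij False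
              by (intro clique_binomialsI[of _ _ _ _ k]) (auto simp: \<kappa>2_def)
            ultimately show ?thesis by (simp add: gen_base)
          qed
        qed
      qed
      then have "var (IY v) * kill (IX ` C) f \<in> gen X (?K \<kappa>2)"
        by (simp add: kill_mult yv_def kill_var image_iff)
      then have "kill (IX ` C) f \<in> gen X (?K \<kappa>2)"
        using clique_nonzerodivisor[OF V kill_polys[OF f[unfolded X_def]]] unfolding X_def by blast
      then show "f \<in> I'" unfolding I'_def gen_Un
        using diff_kill_mem[OF f CV] by (intro bexI[of _ "kill (IX ` C) f"] bexI[of _ "f - kill (IX ` C) f"]) auto
    qed
    have regIz: "regular X Iz ?r"
    proof (rule regular_colon[OF X _ hom _ _ I'sub regIzz regI'])
      show "IY v \<in> X" using inX v by auto
      show "w \<in> Izz \<longleftrightarrow> (\<exists>u\<in>Iz. \<exists>p\<in>polys X. w = u + var (IY v) * p)" for w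
        unfolding Izz_def Iz_def gen_insert[of w] yv_def by simp
      show "var (IY v) * f \<in> Iz \<longleftrightarrow> f \<in> I'" if "f \<in> polys X" for f
        using colon[OF that] by (simp add: yv_def)
    qed
    have "regular X (gen X (?K \<kappa>)) ?r"
    proof (rule regular_nonzerodivisor[OF X _ ideal _ _ regIz])
      show "IX v \<in> X" using inX v by auto
      show "w \<in> Iz \<longleftrightarrow> (\<exists>u\<in>gen X (?K \<kappa>). \<exists>p\<in>polys X. w = u + var (IX v) * p)" for w
        unfolding Iz_def xv_def by (rule gen_insert)
      show "f \<in> gen X (?K \<kappa>)" if "f \<in> polys X" "var (IX v) * f \<in> gen X (?K \<kappa>)" for f
        using clique_nonzerodivisor[OF V] that unfolding X_def by blast
    qed
    then show ?thesis by (simp add: X_def)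
  qed
qed

section \<open>Compatible maps\<close>

lemma UN_bij: "bij_betw h A L \<Longrightarrow> (\<Union>k\<in>L. F k) = (\<Union>i\<in>A. F (h i))"
  unfolding bij_betw_def by blast

text \<open>Cliques with a single vertex do not contribute to the ideal. Without them the graph is
  \<open>delete_isolated G\<close>, to which the first two conditions of compatibility apply.\<close>

lemma regular_disjoint_union_complete:
  assumes V: "finite V" "verts G \<subseteq> V" and G: "is_graph G" and \<phi>: "compatible \<phi>"
    and U: "is_disjoint_union_complete G t m"
  shows "regular (indets V) (edge_ideal V G :: 'k::field mpol set) (int (\<phi> G))"
proof -
  from U obtain C where "(\<forall>i\<in>{1..t}. finite (C i) \<and> card (C i) = m i) \<and> disjoint_family_on C {1..t} \<and>
      verts G = (\<Union>i\<in>{1..t}. C i) \<and> edges G = (\<Union>i\<in>{1..t}. all_pairs (C i))"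
    unfolding is_disjoint_union_complete_def by (rule exE)
  then have C: "\<And>i. i \<in> {1..t} \<Longrightarrow> finite (C i) \<and> card (C i) = m i"
    "disjoint_family_on C {1..t}" "verts G = (\<Union>i\<in>{1..t}. C i)" "edges G = (\<Union>i\<in>{1..t}. all_pairs (C i))"
    by simp_all
  define L where "L = {k \<in> {1..t}. m k \<ge> 2}"
  have uniq: "k = k'" if "k \<in> {1..t}" "k' \<in> {1..t}" "i \<in> C k" "i \<in> C k'" for k k' i
    using C(2) that unfolding disjoint_family_on_def by blast
  define \<kappa> where "\<kappa> = (\<lambda>i. if \<exists>k\<in>L. i \<in> C k then Some (THE k. k \<in> L \<and> i \<in> C k) else None)"
  have \<kappa>: "\<kappa> i = Some k \<longleftrightarrow> k \<in> L \<and> i \<in> C k" for i k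
  proof
    assume kL: "k \<in> L \<and> i \<in> C k"
    then have "(THE k. k \<in> L \<and> i \<in> C k) = k" using uniq by (intro the_equality) (auto simp: L_def)
    then show "\<kappa> i = Some k" using kL by (auto simp: \<kappa>_def)
  next
    assume k: "\<kappa> i = Some k"
    then obtain k' where k': "k' \<in> L" "i \<in> C k'" by (auto simp: \<kappa>_def split: if_splits)
    then have "(THE k. k \<in> L \<and> i \<in> C k) = k'" using uniq by (intro the_equality) (auto simp: L_def)
    then show "k \<in> L \<and> i \<in> C k" using k k' by (auto simp: \<kappa>_def split: if_splits)
  qed
  have two: "\<exists>j\<in>C k. j \<noteq> i" if "k \<in> L" for k i
  proof (rule ccontr)
    assume "\<not> ?thesis"
    then have "C k \<subseteq> {i}" by auto
    then have "card (C k) \<le> 1" using card_mono[of "{i}" "C k"] by simp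
    then show False using that C(1)[of k] by (auto simp: L_def)
  qed
  have large: "k \<in> L" if "k \<in> {1..t}" "i \<in> C k" "j \<in> C k" "i \<noteq> j" for i j k
  proof -
    have "card {i, j} \<le> card (C k)" using that C(1)[OF that(1)] by (intro card_mono) auto
    then show ?thesis using that C(1)[OF that(1)] by (simp add: L_def)
  qed
  have edge: "{i, j} \<in> edges G \<longleftrightarrow> i \<noteq> j \<and> (\<exists>k\<in>L. i \<in> C k \<and> j \<in> C k)" for i j
  proof
    assume "{i, j} \<in> edges G"
    then obtain k u w where "k \<in> {1..t}" "{i, j} = {u, w}" "u \<in> C k" "w \<in> C k" "u \<noteq> w"
      unfolding C(4) all_pairs_def by blast
    then show "i \<noteq> j \<and> (\<exists>k\<in>L. i \<in> C k \<and> j \<in> C k)" using large by (auto simp: doubleton_eq_iff)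
  next
    assume "i \<noteq> j \<and> (\<exists>k\<in>L. i \<in> C k \<and> j \<in> C k)"
    then show "{i, j} \<in> edges G" unfolding C(4) all_pairs_def L_def by blast
  qed
  have CV: "C k \<subseteq> V" if "k \<in> L" for k using that V(2) unfolding C(3) L_def by blast
  have "edge_ideal V G = (clique_ideal V \<kappa> :: 'k mpol set)"
  proof
    show "edge_ideal V G \<subseteq> (clique_ideal V \<kappa> :: 'k mpol set)"
    proof (rule gen_mono, rule subsetI)
      fix a :: "'k mpol" assume "a \<in> edge_binomials G"
      then obtain i j where a: "a = edge_binomial i j" "{i, j} \<in> edges G" by (auto simp: edge_binomials_def)
      then obtain k where k: "k \<in> L" "i \<in> C k" "j \<in> C k" using edge[of i j] by auto
      show "a \<in> clique_binomials V \<kappa>"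
        unfolding a(1) using k CV[OF k(1)] by (intro clique_binomialsI[of _ _ _ _ k]) (auto simp: \<kappa>)
    qed
    show "(clique_ideal V \<kappa> :: 'k mpol set) \<subseteq> edge_ideal V G"
    proof
      fix p :: "'k mpol" assume "p \<in> clique_ideal V \<kappa>"
      then show "p \<in> edge_ideal V G"
      proof (rule gen_least)
        show "is_ideal (indets V) (edge_ideal V G :: 'k mpol set)"
          by (rule hom_ideal_ideal[OF edge_binomials_hom_ideal[OF G V(2)]])
        show "clique_binomials V \<kappa> \<subseteq> (edge_ideal V G :: 'k mpol set)"
        proof
          fix a :: "'k mpol" assume "a \<in> clique_binomials V \<kappa>"
          then obtain i j k where ij: "a = edge_binomial i j" "\<kappa> i = Some k" "\<kappa> j = Some k"
            by (rule clique_binomialsE)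
          show "a \<in> edge_ideal V G"
          proof (cases "i = j")
            case True
            then show ?thesis by (simp add: ij(1) gen_zero)
          next
            case False
            then have "{i, j} \<in> edges G" using edge ij \<kappa> by blast
            then show ?thesis unfolding ij(1) by (rule edge_in_gen)
          qed
        qed
      qed
    qed
  qed
  moreover have "clique_labels V \<kappa> = L"
  proof -
    have "\<exists>i\<in>V. i \<in> C k" if "k \<in> L" for k using two[OF that] CV[OF that] by blast
    then show ?thesis by (auto simp: clique_labels_def \<kappa>)
  qed
  ultimately have reg: "regular (indets V) (edge_ideal V G :: 'k mpol set) (int (card L))"
    using regular_clique[OF V(1), of \<kappa>] by simp
  have "finite L" by (simp add: L_def)
  then obtain h where h: "bij_betw h {1..card L} L" using ex_bij_betw_nat_finite_1 by blast
  have hL: "h ` {1..card L} = L" and hinj: "inj_on h {1..card L}" using h by (auto simp: bij_betw_def)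
  have hk: "h i \<in> L" if "i \<in> {1..card L}" for i using that hL by blast
  have vH: "verts (delete_isolated G) = (\<Union>i\<in>{1..card L}. C (h i))"
  proof -
    have "{v \<in> verts G. neighbours G v \<noteq> {}} = (\<Union>k\<in>L. C k)"
    proof
      show "{v \<in> verts G. neighbours G v \<noteq> {}} \<subseteq> (\<Union>k\<in>L. C k)" by (auto simp: neighbours_def edge)
      show "(\<Union>k\<in>L. C k) \<subseteq> {v \<in> verts G. neighbours G v \<noteq> {}}"
      proof
        fix v assume "v \<in> (\<Union>k\<in>L. C k)"
        then obtain k where k: "k \<in> L" "v \<in> C k" by blast
        then obtain w where "w \<in> C k" "w \<noteq> v" using two by blast
        then have "{v, w} \<in> edges G" using edge k by blast
        then show "v \<in> {v \<in> verts G. neighbours G v \<noteq> {}}" using graph_edge(1)[OF G] by (auto simp: neighbours_def)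
      qed
    qed
    also have "\<dots> = (\<Union>i\<in>{1..card L}. C (h i))" by (rule UN_bij[OF h])
    finally show ?thesis by (simp add: delete_isolated_def induced_def)
  qed
  have eH: "edges (delete_isolated G) = (\<Union>i\<in>{1..card L}. all_pairs (C (h i)))"
  proof -
    have "edges (delete_isolated G) = edges G"
    proof -
      have "e \<subseteq> {v \<in> verts G. neighbours G v \<noteq> {}}" if eG: "e \<in> edges G" for e
      proof -
        obtain u w where e: "e = {u, w}" using eG unfolding C(4) all_pairs_def by blast
        then have "{u, w} \<in> edges G" "{w, u} \<in> edges G" using eG by (auto simp: insert_commute)
        then show ?thesis using graph_edge(1,2)[OF G] by (auto simp: e neighbours_def)
      qed
      then show ?thesis by (auto simp: delete_isolated_def induced_def)
    qed
    also have "\<dots> = (\<Union>k\<in>L. all_pairs (C k))"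
    proof
      show "edges G \<subseteq> (\<Union>k\<in>L. all_pairs (C k))"
        unfolding C(4) all_pairs_def using large by blast
      show "(\<Union>k\<in>L. all_pairs (C k)) \<subseteq> edges G" unfolding C(4) L_def by blast
    qed
    also have "\<dots> = (\<Union>i\<in>{1..card L}. all_pairs (C (h i)))" by (rule UN_bij[OF h])
    finally show ?thesis .
  qed
  have "is_disjoint_union_complete (delete_isolated G) (card L) (m \<circ> h)"
    unfolding is_disjoint_union_complete_def
  proof (intro exI[of _ "C \<circ> h"] conjI ballI)
    fix i assume "i \<in> {1..card L}"
    then have "h i \<in> {1..t}" using hk by (auto simp: L_def)
    then show "finite ((C \<circ> h) i)" "card ((C \<circ> h) i) = (m \<circ> h) i" using C(1) by auto
  next
    show "disjoint_family_on (C \<circ> h) {1..card L}"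
      unfolding disjoint_family_on_def
    proof (intro ballI impI)
      fix i j assume ij: "i \<in> {1..card L}" "j \<in> {1..card L}" "i \<noteq> j"
      then have "h i \<noteq> h j" using hinj by (meson inj_onD)
      moreover have "h i \<in> {1..t}" "h j \<in> {1..t}" using hk ij by (auto simp: L_def)
      ultimately show "(C \<circ> h) i \<inter> (C \<circ> h) j = {}" using uniq[of "h i" "h j"] by (auto simp: disjoint_iff)
    qed
  qed (simp_all add: vH eH)
  moreover have "is_graph (delete_isolated G)"
    using G unfolding is_graph_def delete_isolated_def induced_def by auto
  moreover have "\<forall>i\<in>{1..card L}. (m \<circ> h) i \<ge> 2" using hk by (auto simp: L_def)
  ultimately have "card L \<le> \<phi> (delete_isolated G)" using \<phi> unfolding compatible_def by blast
  also have "\<dots> \<le> \<phi> G" using \<phi> G unfolding compatible_def by blast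
  finally show ?thesis by (intro regular_mono[OF reg]) simp
qed

text \<open>Keeping \<open>V\<close> fixed while vertices are deleted from \<open>G\<close> lets all ideals of the induction live in
  one ring, as the intersection behind \<open>regular_vertex_step\<close> requires. If no edge were added in
  passing to \<open>complete_at G v\<close>, the two graphs would be equal, against the strict inequality in the
  third condition of compatibility.\<close>

theorem regular_compatible:
  assumes V: "finite V" and \<phi>: "compatible \<phi>"
  shows "is_graph G \<Longrightarrow> verts G \<subseteq> V \<Longrightarrow>
    regular (indets V) (edge_ideal V G :: 'k::field mpol set) (int (\<phi> G))"
proof (induction G rule: wf_induct[OF wf_measures[of "[\<lambda>G. card (verts G), \<lambda>G. card (Pow V) - card (edges G)]"]])
  case (1 G)
  note G = 1(2) and GV = 1(3)
  show ?case
  proof (cases "\<exists>t m. (\<forall>i\<in>{1..t}. m i \<ge> 1) \<and> is_disjoint_union_complete G t m")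
    case True
    then show ?thesis using regular_disjoint_union_complete[OF V GV G \<phi>] by blast
  next
    case False
    then obtain v where v: "v \<in> verts G" "\<phi> (delete_vertex G v) \<le> \<phi> G" "\<phi> (complete_at G v) < \<phi> G"
      using \<phi> G unfolding compatible_def by blast
    let ?H = "delete_vertex G v" and ?G' = "complete_at G v"
    have fin: "finite (verts G)" using G by (simp add: is_graph_def)
    have H: "is_graph ?H" "verts ?H \<subseteq> V"
      using G GV by (auto simp: is_graph_def delete_vertex_def induced_def)
    have nv: "neighbours G v \<subseteq> verts G" using graph_edge(2)[OF G] by (auto simp: neighbours_def)
    have ap: "e \<subseteq> verts G \<and> card e = 2" if "e \<in> all_pairs (neighbours G v)" for e
      using that nv by (auto simp: all_pairs_def card_2_iff)
    have G': "is_graph ?G'" "verts ?G' \<subseteq> V"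
      using G GV ap by (auto simp: is_graph_def complete_at_def)
    have "edges ?G' \<noteq> edges G"
    proof
      assume "edges ?G' = edges G"
      then have "?G' = G" by (simp add: complete_at_def)
      then show False using v(3) by simp
    qed
    then have "edges G \<subset> edges ?G'" by (auto simp: complete_at_def)
    moreover have sub: "edges ?G' \<subseteq> Pow V" using G' unfolding is_graph_def by blast
    moreover have "finite (Pow V)" using V by simp
    ultimately have "card (edges G) < card (edges ?G')" "card (edges ?G') \<le> card (Pow V)"
      by (meson finite_subset psubset_card_mono card_mono)+
    then have m': "(?G', G) \<in> measures [\<lambda>G. card (verts G), \<lambda>G. card (Pow V) - card (edges G)]"
      by (auto simp: complete_at_def)
    have "card (verts ?H) < card (verts G)"
      unfolding delete_vertex_def induced_def graph.simps by (rule card_Diff1_less[OF fin v(1)])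
    then have mH: "(?H, G) \<in> measures [\<lambda>G. card (verts G), \<lambda>G. card (Pow V) - card (edges G)]"
      by simp
    have "regular (indets V) (edge_ideal V ?G' :: 'k mpol set) (int (\<phi> ?G'))"
      using 1(1) m' G' by blast
    then have "regular (indets V) (edge_ideal V ?G' :: 'k mpol set) (int (\<phi> G) - 1)"
      by (rule regular_mono) (use v(3) in simp)
    moreover have "regular (indets V) (edge_ideal V ?H :: 'k mpol set) (int (\<phi> ?H))"
      using 1(1) mH H by blast
    then have "regular (indets V) (edge_ideal V ?H :: 'k mpol set) (int (\<phi> G))"
      by (rule regular_mono) (use v(2) in simp)
    ultimately show ?thesis by (intro regular_vertex_step[OF V GV G v(1) G'(1) H(1)])
  qed
qed

section \<open>Ideals of the polynomial ring as a record\<close>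

lemma carrier_S_ring: "carrier (S_ring V) = polys (indets V)"
  by (simp add: S_ring_def polys_def)

lemma S_ring_simps [simp]:
  "x \<oplus>\<^bsub>S_ring V\<^esub> y = x + y" "x \<otimes>\<^bsub>S_ring V\<^esub> y = x * y" "\<zero>\<^bsub>S_ring V\<^esub> = 0" "\<one>\<^bsub>S_ring V\<^esub> = 1"
  by (simp_all add: S_ring_def)

lemma ring_S_ring: "ring (S_ring V :: 'k::field mpol ring)"
proof (rule ringI)
  show "abelian_group (S_ring V :: 'k mpol ring)"
  proof (rule abelian_groupI)
    fix x :: "'k mpol" assume "x \<in> carrier (S_ring V)"
    then show "\<exists>y\<in>carrier (S_ring V). y \<oplus>\<^bsub>S_ring V\<^esub> x = \<zero>\<^bsub>S_ring V\<^esub>"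
      by (intro bexI[of _ "- x"]) (auto simp: carrier_S_ring polys_uminus)
  qed (auto simp: carrier_S_ring add.assoc add.commute intro: polys_add)
  show "Group.monoid (S_ring V :: 'k mpol ring)"
    by (rule monoidI) (auto simp: carrier_S_ring mult.assoc intro: polys_mult)
qed (auto simp: distrib_left distrib_right)

lemma ideal_S_ring: "ideal I (S_ring V :: 'k::field mpol ring) \<longleftrightarrow> is_ideal (indets V) I"
proof
  let ?S = "S_ring V :: 'k mpol ring"
  assume I: "ideal I ?S"
  interpret ideal I ?S by (rule I)
  show "is_ideal (indets V) I"
    unfolding is_ideal_def carrier_S_ring[symmetric]
  proof (intro conjI ballI)
    show "I \<subseteq> carrier ?S" by (rule a_subset)
    show "0 \<in> I" using additive_subgroup.zero_closed[OF is_additive_subgroup] by simp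
    show "p + q \<in> I" if "p \<in> I" "q \<in> I" for p q using additive_subgroup.a_closed[OF is_additive_subgroup that] by simp
    show "p * q \<in> I" if "p \<in> carrier ?S" "q \<in> I" for p q using I_l_closed[OF that(2,1)] by simp
  qed
next
  let ?S = "S_ring V :: 'k mpol ring"
  assume I: "is_ideal (indets V) I"
  interpret ring ?S by (rule ring_S_ring)
  have inv: "\<ominus>\<^bsub>?S\<^esub> x = - x" if "x \<in> I" for x
    by (rule minus_equality)
      (use ideal_sub[OF I that] in \<open>auto simp: carrier_S_ring polys_uminus\<close>)
  show "ideal I ?S"
  proof (rule idealI[OF ring_S_ring])
    show "subgroup I (add_monoid ?S)"
    proof
      show "I \<subseteq> carrier (add_monoid ?S)" using ideal_sub[OF I] by (auto simp: carrier_S_ring)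
      show "x \<otimes>\<^bsub>add_monoid ?S\<^esub> y \<in> I" if "x \<in> I" "y \<in> I" for x y
        using ideal_add[OF I that] by simp
      show "\<one>\<^bsub>add_monoid ?S\<^esub> \<in> I" using ideal_0[OF I] by simp
      show "inv\<^bsub>add_monoid ?S\<^esub> x \<in> I" if "x \<in> I" for x
        using ideal_uminus[OF I that] inv[OF that] by (simp add: a_inv_def)
    qed
    fix a x assume ax: "a \<in> I" "x \<in> carrier ?S"
    then have "x * a \<in> I" using I by (auto simp: carrier_S_ring intro: ideal_mult)
    then show "x \<otimes>\<^bsub>?S\<^esub> a \<in> I" "a \<otimes>\<^bsub>?S\<^esub> x \<in> I" by (simp_all add: mult.commute)
  qed
qed

lemma genideal_S_ring:
  assumes "A \<subseteq> polys (indets V)"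
  shows "genideal (S_ring V) A = gen (indets V) A"
proof
  have "is_ideal (indets V) (gen (indets V) A)" by (rule gen_ideal[OF assms])
  moreover have "A \<subseteq> gen (indets V) A" by (auto intro: gen_base)
  ultimately show "genideal (S_ring V) A \<subseteq> gen (indets V) A"
    unfolding genideal_def ideal_S_ring by blast
  show "gen (indets V) A \<subseteq> genideal (S_ring V) A"
    unfolding genideal_def ideal_S_ring by (auto intro: gen_least)
qed

lemma binomial_edge_ideal_gen:
  assumes "is_graph G"
  shows "binomial_edge_ideal G = gen (indets (verts G)) (edge_binomials G)"
  unfolding binomial_edge_ideal_def edge_binomials_def[unfolded edge_binomial_def, symmetric]
  by (rule genideal_S_ring[OF edge_binomials_polys[OF assms subset_refl]])

lemma lookup_0_mult:
  fixes p q :: "'k::field mpol"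
  assumes "lookup q 0 = 0"
  shows "lookup (p * q) 0 = 0"
proof (rule ccontr)
  assume "lookup (p * q) 0 \<noteq> 0"
  then have "0 \<in> keys (p * q)" by (simp add: in_keys_iff)
  then obtain a b where "0 = a + b" "b \<in> keys q" by (rule keys_multE)
  moreover from this(1) have "mon_degree a + mon_degree b = 0" by (metis mon_degree_add mon_degree_0)
  then have "b = 0" by (simp add: mon_degree_eq_0)
  ultimately show False using assms by (simp add: in_keys_iff)
qed

lemma irrelevant_ideal_iff:
  "p \<in> irrelevant_ideal V \<longleftrightarrow> p \<in> polys (indets V) \<and> lookup p 0 = 0"
proof -
  have v: "(var ` indets V :: 'a mpol set) \<subseteq> polys (indets V)" by (auto intro: polys_var)
  have eq: "irrelevant_ideal V = gen (indets V) (var ` indets V :: 'a mpol set)"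
    unfolding irrelevant_ideal_def by (rule genideal_S_ring[OF v])
  show ?thesis
  proof
    assume "p \<in> irrelevant_ideal V"
    then have p: "p \<in> gen (indets V) (var ` indets V)" by (simp add: eq)
    then have "lookup p 0 = 0"
    proof (induction rule: gen.induct)
      case (gen_step p a q)
      have "lookup a 0 = 0" using gen_step(2) homogeneous_lookup_0[OF homogeneous_var] by auto
      then show ?case using gen_step by (simp add: lookup_add lookup_0_mult)
    qed simp
    then show "p \<in> polys (indets V) \<and> lookup p 0 = 0"
      using gen_least[OF p is_ideal_polys v] by simp
  next
    assume p: "p \<in> polys (indets V) \<and> lookup p 0 = 0"
    have "kill (indets V) p = 0"
    proof (rule poly_mapping_eqI)
      fix m :: mon
      show "lookup (kill (indets V) p) m = lookup 0 m"
      proof (cases "m = 0 \<or> m \<notin> keys p")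
        case True
        then show ?thesis using p by (auto simp: kill_def lookup_restr in_keys_iff)
      next
        case False
        then have "keys m \<noteq> {}" "keys m \<subseteq> indets V" using p by (auto simp: polys_def)
        then have "keys m \<inter> indets V \<noteq> {}" by blast
        then show ?thesis by (simp add: kill_def lookup_restr)
      qed
    qed
    then show "p \<in> irrelevant_ideal V"
      using diff_kill_mem[of p "indets V" "indets V"] p by (simp add: eq)
  qed
qed

section \<open>Koszul regularity of submodules of free modules\<close>

definition no_constants :: "nat \<Rightarrow> 'k::field mpol vec \<Rightarrow> bool" where
  "no_constants n v \<longleftrightarrow> (\<forall>k<n. lookup (v $ k) 0 = 0)"

text \<open>The analogue of \<open>regular\<close> for the module \<open>F/U\<close>, where \<open>F\<close> is free with basis elements in
  the degrees \<open>ds\<close>. The family \<open>c\<close> lists the components of a chain with values in \<open>F\<close>; an element of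
  \<open>F\<close> of degree \<open>e\<close> has components of degree \<open>e - ds ! k\<close>.\<close>

definition vec_regular :: "nat set \<Rightarrow> int list \<Rightarrow> 'k::field mpol vec set \<Rightarrow> int \<Rightarrow> bool" where
  "vec_regular V ds U s \<longleftrightarrow>
     (\<forall>e>s. \<forall>c. (\<forall>k<length ds. \<forall>B. c k B \<in> polys (indets V) \<and> homogeneous (e - ds ! k) (c k B)) \<longrightarrow>
        (\<forall>B. vec (length ds) (\<lambda>k. koszul (indets V) (c k) B) \<in> U) \<longrightarrow>
        (\<exists>b. (\<forall>k<length ds. \<forall>B. b k B \<in> polys (indets V)) \<and>
             (\<forall>B. vec (length ds) (\<lambda>k. c k B - koszul (indets V) (b k) B) \<in> U)))"

lemma vec_regularI:
  assumes "\<And>e c. e > s \<Longrightarrow> (\<And>k B. k < length ds \<Longrightarrow> c k B \<in> polys (indets V)) \<Longrightarrow>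
     (\<And>k B. k < length ds \<Longrightarrow> homogeneous (e - ds ! k) (c k B)) \<Longrightarrow>
     (\<And>B. vec (length ds) (\<lambda>k. koszul (indets V) (c k) B) \<in> U) \<Longrightarrow>
     \<exists>b. (\<forall>k<length ds. \<forall>B. b k B \<in> polys (indets V)) \<and>
         (\<forall>B. vec (length ds) (\<lambda>k. c k B - koszul (indets V) (b k) B) \<in> U)"
  shows "vec_regular V ds U s"
  unfolding vec_regular_def
proof (intro allI impI)
  fix e and c :: "nat \<Rightarrow> indet set \<Rightarrow> 'a mpol"
  assume "s < e" "\<forall>k<length ds. \<forall>B. c k B \<in> polys (indets V) \<and> homogeneous (e - ds ! k) (c k B)"
    "\<forall>B. vec (length ds) (\<lambda>k. koszul (indets V) (c k) B) \<in> U"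
  then show "\<exists>b. (\<forall>k<length ds. \<forall>B. b k B \<in> polys (indets V)) \<and>
         (\<forall>B. vec (length ds) (\<lambda>k. c k B - koszul (indets V) (b k) B) \<in> U)"
    by (intro assms[of e c]) simp_all
qed

lemma vec_regularE:
  assumes "vec_regular V ds U s" "e > s" "\<And>k B. k < length ds \<Longrightarrow> c k B \<in> polys (indets V)"
     "\<And>k B. k < length ds \<Longrightarrow> homogeneous (e - ds ! k) (c k B)"
     "\<And>B. vec (length ds) (\<lambda>k. koszul (indets V) (c k) B) \<in> U"
  obtains b where "\<And>k B. k < length ds \<Longrightarrow> b k B \<in> polys (indets V)"
    "\<And>B. vec (length ds) (\<lambda>k. c k B - koszul (indets V) (b k) B) \<in> U"
proof -
  have "\<exists>b. (\<forall>k<length ds. \<forall>B. b k B \<in> polys (indets V)) \<and>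
         (\<forall>B. vec (length ds) (\<lambda>k. c k B - koszul (indets V) (b k) B) \<in> U)"
    using assms(1)[unfolded vec_regular_def, rule_format, OF assms(2), of c] assms(3-5) by simp
  then show ?thesis using that by auto
qed

lemma free_module_iff:
  "v \<in> free_module V n \<longleftrightarrow> v \<in> carrier_vec n \<and> (\<forall>k<n. v $ k \<in> polys (indets V))"
  by (simp add: free_module_def carrier_S_ring)

lemma vec_free_module: "(\<And>k. k < n \<Longrightarrow> f k \<in> polys (indets V)) \<Longrightarrow> vec n f \<in> free_module V n"
  by (simp add: free_module_iff)

lemma mult_mat_vec_sum:
  assumes "A \<in> carrier_mat n n'" "w \<in> carrier_vec n'"
  shows "A *\<^sub>v w = vec n (\<lambda>r. \<Sum>c<n'. A $$ (r, c) * w $ c)"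
  using assms by (intro eq_vecI) (auto simp: scalar_prod_def atLeast0LessThan)

text \<open>A basis element is a cycle of homological degree \<open>0\<close>. If its degree exceeds \<open>s\<close>, it is a
  boundary modulo \<open>U\<close> and so lies in the maximal ideal times \<open>F\<close>, as \<open>U\<close> does; but one of its
  components is \<open>1\<close>.\<close>

lemma vec_regular_bound:
  assumes "vec_regular V ds U s" and pos: "\<And>u. u \<in> U \<Longrightarrow> no_constants (length ds) u" and z: "0\<^sub>v (length ds) \<in> U"
    and k: "k < length ds"
  shows "ds ! k \<le> s"
proof (rule ccontr)
  assume "\<not> ds ! k \<le> s"
  then have e: "ds ! k > s" by simp
  define c :: "nat \<Rightarrow> indet set \<Rightarrow> 'a mpol" where "c = (\<lambda>k' B. if k' = k \<and> B = {} then 1 else 0)"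
  have "koszul (indets V) (c k') B = 0" for k' B
    by (auto simp: koszul_def contract_def c_def intro!: sum.neutral)
  then have c3: "vec (length ds) (\<lambda>k. koszul (indets V) (c k) B) \<in> U" for B
    using z by (simp add: zero_vec_def)
  have c1: "c k' B \<in> polys (indets V)" and c2: "homogeneous (ds ! k - ds ! k') (c k' B)"
    if "k' < length ds" for k' B
    by (auto simp: c_def)
  obtain b where b: "\<And>k B. k < length ds \<Longrightarrow> b k B \<in> polys (indets V)"
    "\<And>B. vec (length ds) (\<lambda>k. c k B - koszul (indets V) (b k) B) \<in> U"
    using vec_regularE[OF assms(1) e c1 c2 c3] by blast
  have "lookup (c k {} - koszul (indets V) (b k) {}) 0 = 0"
    using pos[OF b(2)[of "{}"]] k by (auto simp: no_constants_def)
  moreover have "lookup (koszul (indets V) (b k) {}) 0 = 0"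
    by (simp add: koszul_def lookup_sum lookup_var_mult)
  ultimately show False by (simp add: c_def lookup_minus)
qed

text \<open>The start of a resolution: \<open>F/U\<close> is isomorphic to \<open>S/I\<close>.\<close>

lemma vec_regular_quotient:
  assumes a: "a \<in> free_module V (length ds)" "\<And>k. k < length ds \<Longrightarrow> homogeneous (ds ! k) (a $ k)"
    and I: "is_ideal (indets V) I" and r: "regular (indets V) I r"
    and surj: "\<And>p. p \<in> polys (indets V) \<Longrightarrow> \<exists>v\<in>free_module V (length ds). p - a \<bullet> v \<in> I"
  shows "vec_regular V ds {v \<in> free_module V (length ds). a \<bullet> v \<in> I} r"
proof (rule vec_regularI)
  let ?n = "length ds" and ?X = "indets V"
  have ap: "a $ k \<in> polys ?X" if "k < ?n" for k using a(1) that by (simp add: free_module_iff)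
  fix e and c :: "nat \<Rightarrow> indet set \<Rightarrow> 'a mpol"
  assume e: "e > r" and c: "\<And>k B. k < ?n \<Longrightarrow> c k B \<in> polys ?X"
    "\<And>k B. k < ?n \<Longrightarrow> homogeneous (e - ds ! k) (c k B)"
    and d: "\<And>B. vec ?n (\<lambda>k. koszul ?X (c k) B) \<in> {v \<in> free_module V ?n. a \<bullet> v \<in> I}"
  have dot: "a \<bullet> vec ?n f = (\<Sum>k<?n. a $ k * f k)" for f
    by (simp add: scalar_prod_def atLeast0LessThan)
  have dot': "a \<bullet> v = (\<Sum>k<?n. a $ k * v $ k)" if v: "v \<in> free_module V ?n" for v
  proof -
    have "dim_vec v = ?n" using v by (auto simp: free_module_iff)
    then show ?thesis by (simp add: scalar_prod_def atLeast0LessThan)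
  qed
  define g where "g = (\<lambda>B. \<Sum>k<?n. a $ k * c k B)"
  have g1: "g B \<in> polys ?X" for B unfolding g_def using ap c(1) by (intro polys_sum polys_mult) auto
  have g2: "homogeneous e (g B)" for B
    unfolding g_def
  proof (rule homogeneous_sum)
    fix k assume "k \<in> {..<?n}"
    then show "homogeneous e (a $ k * c k B)"
      using homogeneous_mult[OF a(2) c(2), of k k B] by simp
  qed
  have g3: "koszul ?X g B \<in> I" for B
    using d[of B] by (simp add: g_def koszul_sum koszul_mult dot)
  obtain b where b: "\<And>B. b B \<in> polys ?X" "\<And>B. g B - koszul ?X b B \<in> I"
    using regularE[OF r e g1 g2 g3] by blast
  have "\<forall>B. \<exists>v. v \<in> free_module V ?n \<and> b B - a \<bullet> v \<in> I" using surj[OF b(1)] by blast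
  then obtain v where v: "\<And>B. v B \<in> free_module V ?n" "\<And>B. b B - a \<bullet> v B \<in> I" by metis
  define b' where "b' = (\<lambda>k B. v B $ k)"
  have b'p: "b' k B \<in> polys ?X" if "k < ?n" for k B using v(1)[of B] that by (simp add: b'_def free_module_iff)
  have "a \<bullet> vec ?n (\<lambda>k. c k B - koszul ?X (b' k) B) = (g B - koszul ?X b B) + koszul ?X (\<lambda>B. b B - a \<bullet> v B) B" for B
  proof -
    have "a \<bullet> vec ?n (\<lambda>k. c k B - koszul ?X (b' k) B) = g B - koszul ?X (\<lambda>B. \<Sum>k<?n. a $ k * b' k B) B"
      by (simp add: dot g_def right_diff_distrib sum_subtractf koszul_sum koszul_mult)
    also have "(\<lambda>B. \<Sum>k<?n. a $ k * b' k B) = (\<lambda>B. a \<bullet> v B)" using dot'[OF v(1)] by (simp add: b'_def)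
    finally show ?thesis by (simp add: koszul_diff)
  qed
  moreover have "(g B - koszul ?X b B) + koszul ?X (\<lambda>B. b B - a \<bullet> v B) B \<in> I" for B
    by (intro ideal_add[OF I] b(2) koszul_mem[OF I] v(2))
  moreover have "vec ?n (\<lambda>k. c k B - koszul ?X (b' k) B) \<in> free_module V ?n" for B
    by (intro vec_free_module polys_diff c(1) koszul_polys b'p)
  ultimately show "\<exists>b. (\<forall>k<?n. \<forall>B. b k B \<in> polys ?X) \<and>
         (\<forall>B. vec ?n (\<lambda>k. c k B - koszul ?X (b k) B) \<in> {v \<in> free_module V ?n. a \<bullet> v \<in> I})"
    using b'p by (intro exI[of _ b']) auto
qed

definition hcomp_vec :: "int list \<Rightarrow> int \<Rightarrow> 'k::field mpol vec \<Rightarrow> 'k mpol vec" where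
  "hcomp_vec ds e v = vec (length ds) (\<lambda>k. hcomp (e - ds ! k) (v $ k))"

text \<open>Dimension shifting. Let \<open>U\<close> be the image of \<open>A : F' \<rightarrow> F\<close>. A cycle of \<open>F'/ker A\<close>, which is
  isomorphic to \<open>U\<close>, maps to a cycle in \<open>F\<close> with coefficients in the maximal ideal, because the
  entries of \<open>A\<close> are there. By acyclicity it is the boundary of a chain in \<open>F\<close>. That chain is a
  cycle modulo \<open>U\<close> of one degree less, and the hypothesis on \<open>F/U\<close> moves it into \<open>U\<close>.
  Minimality is what makes homological degree \<open>0\<close> no exception.\<close>

lemma vec_regular_syzygies:
  fixes A :: "'k::field mpol mat"
  assumes V: "finite V" and A: "graded_matrix V ds ds' A"
    and pos: "\<And>r c. r < length ds \<Longrightarrow> c < length ds' \<Longrightarrow> lookup (A $$ (r, c)) 0 = 0"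
    and r: "vec_regular V ds ((\<lambda>w. A *\<^sub>v w) ` free_module V (length ds')) s"
  shows "vec_regular V ds' {w \<in> free_module V (length ds'). A *\<^sub>v w = 0\<^sub>v (length ds)} (s + 1)"
proof (rule vec_regularI)
  let ?n = "length ds" and ?n' = "length ds'" and ?X = "indets V"
  let ?U = "(\<lambda>w. A *\<^sub>v w) ` free_module V ?n'"
  have X: "finite ?X" by (rule finite_indets[OF V])
  have Am: "A \<in> carrier_mat ?n ?n'" using A by (simp add: graded_matrix_def)
  have Ap: "A $$ (r, c) \<in> polys ?X" and Ah: "homogeneous (ds' ! c - ds ! r) (A $$ (r, c))"
    if "r < ?n" "c < ?n'" for r c
    using A that by (auto simp: graded_matrix_def carrier_S_ring)
  have mult: "A *\<^sub>v w = vec ?n (\<lambda>r. \<Sum>c<?n'. A $$ (r, c) * w $ c)" if "w \<in> carrier_vec ?n'" for w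
    by (rule mult_mat_vec_sum[OF Am that])
  fix e and c :: "nat \<Rightarrow> indet set \<Rightarrow> 'k mpol"
  assume e: "e > s + 1" and c: "\<And>k B. k < ?n' \<Longrightarrow> c k B \<in> polys ?X"
    "\<And>k B. k < ?n' \<Longrightarrow> homogeneous (e - ds' ! k) (c k B)"
    and d: "\<And>B. vec ?n' (\<lambda>k. koszul ?X (c k) B) \<in> {w \<in> free_module V ?n'. A *\<^sub>v w = 0\<^sub>v ?n}"
  define g where "g = (\<lambda>r B. \<Sum>k<?n'. A $$ (r, k) * c k B)"
  have g1: "g r B \<in> polys ?X" if "r < ?n" for r B
    unfolding g_def using that by (intro polys_sum polys_mult Ap c(1)) auto
  have g2: "homogeneous (e - ds ! r) (g r B)" if "r < ?n" for r B
    unfolding g_def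
  proof (rule homogeneous_sum)
    fix k assume "k \<in> {..<?n'}"
    then show "homogeneous (e - ds ! r) (A $$ (r, k) * c k B)"
      using homogeneous_mult[OF Ah c(2), of r k k B] that by simp
  qed
  have g0: "lookup (g r B) 0 = 0" if "r < ?n" for r B
    unfolding g_def lookup_sum
  proof (rule sum.neutral, rule ballI)
    fix k assume "k \<in> {..<?n'}"
    then have "lookup (c k B * A $$ (r, k)) 0 = 0" using pos that by (intro lookup_0_mult) auto
    then show "lookup (A $$ (r, k) * c k B) 0 = 0" by (simp add: mult.commute)
  qed
  have dg: "koszul ?X (g r) B = 0" if "r < ?n" for r B
  proof -
    have "koszul ?X (g r) B = (\<Sum>k<?n'. A $$ (r, k) * koszul ?X (c k) B)"
      by (simp add: g_def koszul_sum koszul_mult)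
    also have "\<dots> = (A *\<^sub>v vec ?n' (\<lambda>k. koszul ?X (c k) B)) $ r"
      using that by (simp add: mult)
    also have "\<dots> = 0" using d[of B] that by simp
    finally show ?thesis .
  qed
  have "\<forall>r. \<exists>b. r < ?n \<longrightarrow> (\<forall>B. b B \<in> polys ?X \<and> homogeneous (e - ds ! r - 1) (b B) \<and> koszul ?X b B = g r B)"
    using koszul_acyclic_graded[OF X g1 g0 dg g2] by blast
  then obtain b where b: "\<forall>r. r < ?n \<longrightarrow> (\<forall>B. b r B \<in> polys ?X \<and> homogeneous (e - ds ! r - 1) (b r B) \<and> koszul ?X (b r) B = g r B)"
    by (rule exE[OF choice])
  have b1: "b r B \<in> polys ?X" and b2: "homogeneous (e - 1 - ds ! r) (b r B)" and b3: "koszul ?X (b r) B = g r B"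
    if "r < ?n" for r B
  proof -
    have "e - ds ! r - 1 = e - 1 - ds ! r" by simp
    then show "b r B \<in> polys ?X" "homogeneous (e - 1 - ds ! r) (b r B)" "koszul ?X (b r) B = g r B"
      using b that by metis+
  qed
  have b4: "vec ?n (\<lambda>r. koszul ?X (b r) B) \<in> ?U" for B
  proof -
    have "vec ?n (\<lambda>r. koszul ?X (b r) B) = A *\<^sub>v vec ?n' (\<lambda>k. c k B)"
      by (subst mult) (auto simp: b3 g_def intro!: eq_vecI)
    then show ?thesis using vec_free_module[of ?n' "\<lambda>k. c k B" V] c(1) by blast
  qed
  have e1: "e - 1 > s" using e by simp
  obtain f where f: "\<And>k B. k < ?n \<Longrightarrow> f k B \<in> polys ?X"
    "\<And>B. vec ?n (\<lambda>k. b k B - koszul ?X (f k) B) \<in> ?U"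
    using vec_regularE[OF r e1 b1 b2 b4] by blast
  have "\<forall>B. \<exists>w. w \<in> free_module V ?n' \<and> vec ?n (\<lambda>k. b k B - koszul ?X (f k) B) = A *\<^sub>v w" using f(2) by blast
  then obtain w where w: "\<And>B. w B \<in> free_module V ?n'"
    "\<And>B. vec ?n (\<lambda>k. b k B - koszul ?X (f k) B) = A *\<^sub>v w B" by metis
  have wr: "b r B - koszul ?X (f r) B = (\<Sum>k<?n'. A $$ (r, k) * w B $ k)" if "r < ?n" for r B
  proof -
    have "(vec ?n (\<lambda>k. b k B - koszul ?X (f k) B)) $ r = (A *\<^sub>v w B) $ r" by (simp only: w(2))
    then show ?thesis using that w(1)[of B] by (simp add: mult free_module_iff)
  qed
  define h where "h = (\<lambda>k B. w B $ k)"
  have hp: "h k B \<in> polys ?X" if "k < ?n'" for k B using w(1)[of B] that by (simp add: h_def free_module_iff)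
  have "A *\<^sub>v vec ?n' (\<lambda>k. c k B - koszul ?X (h k) B) = 0\<^sub>v ?n" for B
  proof (rule eq_vecI)
    fix r assume "r < dim_vec (0\<^sub>v ?n)"
    then have r: "r < ?n" by simp
    have "g r B = koszul ?X (\<lambda>B. b r B - koszul ?X (f r) B) B"
      by (simp add: koszul_diff koszul_koszul[OF X] b3[OF r])
    also have "\<dots> = (\<Sum>k<?n'. A $$ (r, k) * koszul ?X (h k) B)"
      unfolding wr[OF r] by (simp add: koszul_sum koszul_mult h_def)
    finally show "(A *\<^sub>v vec ?n' (\<lambda>k. c k B - koszul ?X (h k) B)) $ r = 0\<^sub>v ?n $ r"
      using r by (simp add: mult g_def right_diff_distrib sum_subtractf)
  qed (use Am in simp)
  moreover have "vec ?n' (\<lambda>k. c k B - koszul ?X (h k) B) \<in> free_module V ?n'" for B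
    by (intro vec_free_module polys_diff c(1) koszul_polys hp)
  ultimately show "\<exists>b. (\<forall>k<?n'. \<forall>B. b k B \<in> polys ?X) \<and>
         (\<forall>B. vec ?n' (\<lambda>k. c k B - koszul ?X (b k) B) \<in> {w \<in> free_module V ?n'. A *\<^sub>v w = 0\<^sub>v ?n})"
    using hp by (intro exI[of _ h]) auto
qed

section \<open>Minimal homogeneous generators\<close>

definition graded_submodule :: "nat set \<Rightarrow> int list \<Rightarrow> 'k::field mpol vec set \<Rightarrow> bool" where
  "graded_submodule V ds U \<longleftrightarrow> U \<subseteq> free_module V (length ds) \<and> 0\<^sub>v (length ds) \<in> U \<and>
     (\<forall>u\<in>U. \<forall>w\<in>U. u + w \<in> U) \<and> (\<forall>p\<in>polys (indets V). \<forall>u\<in>U. p \<cdot>\<^sub>v u \<in> U) \<and>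
     (\<forall>e. \<forall>u\<in>U. hcomp_vec ds e u \<in> U)"

lemma graded_submoduleD:
  assumes "graded_submodule V ds U"
  shows "\<And>u. u \<in> U \<Longrightarrow> u \<in> free_module V (length ds)" "0\<^sub>v (length ds) \<in> U"
    "\<And>u w. u \<in> U \<Longrightarrow> w \<in> U \<Longrightarrow> u + w \<in> U" "\<And>p u. p \<in> polys (indets V) \<Longrightarrow> u \<in> U \<Longrightarrow> p \<cdot>\<^sub>v u \<in> U"
    "\<And>e u. u \<in> U \<Longrightarrow> hcomp_vec ds e u \<in> U"
  using assms unfolding graded_submodule_def by blast+

definition level :: "int list \<Rightarrow> int \<Rightarrow> 'k::field mpol vec \<Rightarrow> bool" where
  "level ds e u \<longleftrightarrow> (\<forall>k<length ds. homogeneous (e - ds ! k) (u $ k))"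

lemma level_hcomp_vec: "level ds e (hcomp_vec ds e u)"
  by (simp add: level_def hcomp_vec_def homogeneous_hcomp)

lemma free_moduleD:
  assumes "v \<in> free_module V n"
  shows "v \<in> carrier_vec n" "dim_vec v = n" "\<And>k. k < n \<Longrightarrow> v $ k \<in> polys (indets V)"
  using assms by (auto simp: free_module_iff)

lemma free_module_0: "0\<^sub>v n \<in> free_module V n"
  and free_module_add: "u \<in> free_module V n \<Longrightarrow> w \<in> free_module V n \<Longrightarrow> u + w \<in> free_module V n"
  and free_module_smult: "p \<in> polys (indets V) \<Longrightarrow> u \<in> free_module V n \<Longrightarrow> p \<cdot>\<^sub>v u \<in> free_module V n"
  by (auto simp: free_module_iff intro!: polys_add polys_mult)

lemma sum_closed:
  assumes z: "0\<^sub>v n \<in> U" and add: "\<And>u w. u \<in> U \<Longrightarrow> w \<in> U \<Longrightarrow> u + w \<in> U" and dim: "\<And>u. u \<in> U \<Longrightarrow> u \<in> carrier_vec n"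
    and f: "\<And>i. i \<in> S \<Longrightarrow> f i \<in> U"
  shows "vec n (\<lambda>k. \<Sum>i\<in>S. f i $ k) \<in> U"
  using f
proof (induction S rule: infinite_finite_induct)
  case (insert i S)
  have "vec n (\<lambda>k. \<Sum>i\<in>insert i S. f i $ k) = f i + vec n (\<lambda>k. \<Sum>i\<in>S. f i $ k)"
    using dim[of "f i"] insert by (intro eq_vecI) auto
  then show ?case using add insert by simp
qed (use z in \<open>simp_all add: zero_vec_def\<close>)

lemma graded_submodule_sum:
  assumes U: "graded_submodule V ds U" and f: "\<And>i. i \<in> S \<Longrightarrow> f i \<in> U"
  shows "vec (length ds) (\<lambda>k. \<Sum>i\<in>S. f i $ k) \<in> U"
  by (rule sum_closed[OF graded_submoduleD(2)[OF U] graded_submoduleD(3)[OF U]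
        free_moduleD(1)[OF graded_submoduleD(1)[OF U]] f])

inductive_set vspan :: "nat set \<Rightarrow> nat \<Rightarrow> 'k::field mpol vec set \<Rightarrow> 'k mpol vec set" for V n G where
  vspan_zero: "0\<^sub>v n \<in> vspan V n G"
| vspan_step: "p \<in> polys (indets V) \<Longrightarrow> g \<in> G \<Longrightarrow> w \<in> vspan V n G \<Longrightarrow> p \<cdot>\<^sub>v g + w \<in> vspan V n G"

lemma vspan_carrier:
  assumes "G \<subseteq> free_module V n" "w \<in> vspan V n G"
  shows "w \<in> carrier_vec n"
  using assms(2) by (induction rule: vspan.induct) (use assms(1) in \<open>auto simp: free_module_iff\<close>)

lemma vspan_add:
  assumes G: "G \<subseteq> free_module V n" and "u \<in> vspan V n G" and w: "w \<in> vspan V n G"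
  shows "u + w \<in> vspan V n G"
  using assms(2)
proof (induction rule: vspan.induct)
  case vspan_zero
  then show ?case using w vspan_carrier[OF G w] by simp
next
  case (vspan_step p g u)
  have "p \<cdot>\<^sub>v g \<in> carrier_vec n" using vspan_step(2) G by (auto simp: free_module_iff)
  then have "(p \<cdot>\<^sub>v g + u) + w = p \<cdot>\<^sub>v g + (u + w)"
    using vspan_carrier[OF G] vspan_step(3) w by (intro assoc_add_vec) auto
  then show ?case using vspan_step by (auto intro: vspan.vspan_step)
qed

lemma vspan_smult:
  assumes G: "G \<subseteq> free_module V n" and "u \<in> vspan V n G" and q: "q \<in> polys (indets V)"
  shows "q \<cdot>\<^sub>v u \<in> vspan V n G"
  using assms(2)
proof (induction rule: vspan.induct)
  case vspan_zero
  have "q \<cdot>\<^sub>v 0\<^sub>v n = 0\<^sub>v n" by (intro eq_vecI) auto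
  then show ?case by (simp add: vspan.vspan_zero)
next
  case (vspan_step p g u)
  have "g \<in> carrier_vec n" "u \<in> carrier_vec n"
    using vspan_step(2,3) G vspan_carrier[OF G] by (auto simp: free_module_iff)
  then have "q \<cdot>\<^sub>v (p \<cdot>\<^sub>v g + u) = (q * p) \<cdot>\<^sub>v g + q \<cdot>\<^sub>v u"
    by (intro eq_vecI) (auto simp: algebra_simps)
  then show ?case using vspan_step q by (auto intro: vspan.vspan_step polys_mult)
qed

lemma vspan_base:
  assumes G: "G \<subseteq> free_module V n" and g: "g \<in> G"
  shows "g \<in> vspan V n G"
proof -
  have "dim_vec g = n" using G g by (intro free_moduleD(2)[of _ V]) blast
  then have eq: "1 \<cdot>\<^sub>v g + 0\<^sub>v n = g" by (intro eq_vecI) auto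
  have "1 \<cdot>\<^sub>v g + 0\<^sub>v n \<in> vspan V n G" by (intro vspan_step polys_1 g vspan_zero)
  then show ?thesis by (simp only: eq)
qed

lemma vspan_subset:
  assumes H: "H \<subseteq> free_module V n" and "G \<subseteq> vspan V n H"
  shows "vspan V n G \<subseteq> vspan V n H"
proof
  fix w assume "w \<in> vspan V n G"
  then show "w \<in> vspan V n H"
    by (induction rule: vspan.induct)
      (use assms in \<open>auto intro!: vspan_add[OF H] vspan_smult[OF H] vspan.vspan_zero\<close>)
qed

lemma vspan_sum:
  assumes G: "G \<subseteq> free_module V n" and "\<And>i. i \<in> S \<Longrightarrow> f i \<in> vspan V n G"
  shows "vec n (\<lambda>k. \<Sum>i\<in>S. f i $ k) \<in> vspan V n G"
  by (rule sum_closed) (use assms vspan_carrier[OF G] in \<open>auto intro: vspan_zero vspan_add\<close>)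

lemma finite_monomials:
  assumes X: "finite X"
  shows "finite {m :: mon. keys m \<subseteq> X \<and> mon_degree m = d}"
proof (rule finite_imageD)
  let ?M = "{m :: mon. keys m \<subseteq> X \<and> mon_degree m = d}"
  let ?f = "\<lambda>m. restrict (lookup m) X"
  show "inj_on ?f ?M"
  proof (rule inj_onI)
    fix m m' assume m: "m \<in> ?M" "m' \<in> ?M" "?f m = ?f m'"
    show "m = m'"
    proof (rule poly_mapping_eqI)
      fix a
      show "lookup m a = lookup m' a"
      proof (cases "a \<in> X")
        case True
        then show ?thesis using fun_cong[OF m(3), of a] by simp
      next
        case False
        then have "a \<notin> keys m" "a \<notin> keys m'" using m(1,2) by auto
        then show ?thesis by (simp add: in_keys_iff)
      qed
    qed
  qed
  have "?f ` ?M \<subseteq> (\<Pi>\<^sub>E a\<in>X. {..d})"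
  proof
    fix h assume "h \<in> ?f ` ?M"
    then obtain m where m: "keys m \<subseteq> X" "mon_degree m = d" "h = ?f m" by blast
    have "lookup m a \<le> d" if "a \<in> X" for a
      using mon_degree_superset[OF X m(1)] m(2) member_le_sum[OF that, of "lookup m"] X by simp
    then show "h \<in> (\<Pi>\<^sub>E a\<in>X. {..d})" by (auto simp: m(3))
  qed
  then show "finite (?f ` ?M)" by (rule finite_subset) (intro finite_PiE X finite_atMost)
qed

lemma lookup_const_mult:
  "lookup (single 0 c * p) m = c * lookup p m" for p :: "'k::field mpol"
  by (induction p rule: mpol_induct) (auto simp: distrib_left lookup_add mult_single lookup_single when_def)

text \<open>Gaussian elimination on the finite set \<open>T\<close> of coordinates that can be nonzero.\<close>

lemma finite_span_of_bounded_support: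
  fixes W :: "'k::field mpol vec set"
  assumes "finite T" and "W \<subseteq> free_module V n"
    and "\<And>c u w. u \<in> W \<Longrightarrow> w \<in> W \<Longrightarrow> w + single 0 c \<cdot>\<^sub>v u \<in> W"
    and "\<And>w k m. w \<in> W \<Longrightarrow> k < n \<Longrightarrow> lookup (w $ k) m \<noteq> 0 \<Longrightarrow> (k, m) \<in> T"
  shows "\<exists>L. finite L \<and> L \<subseteq> W \<and> W \<subseteq> vspan V n L"
  using assms
proof (induction T arbitrary: W rule: finite_induct)
  case empty
  have "w = 0\<^sub>v n" if w: "w \<in> W" for w
  proof (rule eq_vecI)
    fix k assume "k < dim_vec (0\<^sub>v n :: 'k mpol vec)"
    then show "w $ k = 0\<^sub>v n $ k" using empty.prems(3)[OF w] by (intro poly_mapping_eqI) auto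
  qed (use empty.prems(1) w in \<open>auto simp: free_module_iff\<close>)
  then show ?case by (intro exI[of _ "{}"]) (auto intro: vspan_zero)
next
  case (insert t T)
  obtain k m where t: "t = (k, m)" by (cases t)
  define W' where "W' = {w \<in> W. k < n \<longrightarrow> lookup (w $ k) m = 0}"
  have W'W: "W' \<subseteq> W" by (auto simp: W'_def)
  have dim: "dim_vec w = n" if "w \<in> W" for w using insert.prems(1) that by (auto simp: free_module_iff)
  have "\<exists>L. finite L \<and> L \<subseteq> W' \<and> W' \<subseteq> vspan V n L"
  proof (rule insert.IH)
    show "W' \<subseteq> free_module V n" using W'W insert.prems(1) by blast
    show "w + single 0 c \<cdot>\<^sub>v u \<in> W'" if "u \<in> W'" "w \<in> W'" for c u w
    proof -
      have "lookup (single 0 c * u $ k) m = c * lookup (u $ k) m" if "k < n"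
        by (rule lookup_const_mult)
      then show ?thesis using that insert.prems(2)[of u w c] dim[of u] dim[of w]
        by (auto simp: W'_def lookup_add)
    qed
    show "(k', m') \<in> T" if "w \<in> W'" "k' < n" "lookup (w $ k') m' \<noteq> 0" for w k' m'
      using insert.prems(3)[of w k' m'] that by (auto simp: W'_def t)
  qed
  then obtain L where L: "finite L" "L \<subseteq> W'" "W' \<subseteq> vspan V n L" by blast
  show ?case
  proof (cases "\<exists>u\<in>W. k < n \<and> lookup (u $ k) m \<noteq> 0")
    case False
    then have "W' = W" by (auto simp: W'_def)
    then show ?thesis using L by blast
  next
    case True
    then obtain u where u: "u \<in> W" "k < n" "lookup (u $ k) m \<noteq> 0" by blast
    have uL: "insert u L \<subseteq> free_module V n" using L(2) W'W u(1) insert.prems(1) by blast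
    have "L \<subseteq> vspan V n (insert u L)" using vspan_base[OF uL] by blast
    then have sub: "vspan V n L \<subseteq> vspan V n (insert u L)" by (rule vspan_subset[OF uL])
    have "w \<in> vspan V n (insert u L)" if w: "w \<in> W" for w
    proof -
      define c where "c = lookup (w $ k) m / lookup (u $ k) m"
      define w' where "w' = w + single 0 (- c) \<cdot>\<^sub>v u"
      have "lookup (w' $ k) m = 0"
        using u dim[OF w] dim[OF u(1)] by (simp add: w'_def lookup_add lookup_const_mult c_def)
      then have "w' \<in> W'" using insert.prems(2)[OF u(1) w, of "- c"] by (simp add: W'_def w'_def)
      then have "w' \<in> vspan V n (insert u L)" using L(3) sub by blast
      then have "single 0 c \<cdot>\<^sub>v u + w' \<in> vspan V n (insert u L)" by (intro vspan_step) auto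
      moreover have "single 0 c \<cdot>\<^sub>v u + w' = w"
        using dim[OF w] dim[OF u(1)] by (intro eq_vecI) (auto simp: w'_def single_uminus)
      ultimately show ?thesis by simp
    qed
    then show ?thesis using L(1,2) W'W u(1) by (intro exI[of _ "insert u L"]) auto
  qed
qed

text \<open>An element \<open>u\<close> of \<open>U\<close> of degree above \<open>s + 1\<close> has coefficients in the maximal ideal, so it is
  \<open>\<Sum>\<^sub>a x\<^sub>a b\<^sub>a\<close> for some \<open>b\<^sub>a\<close> in the free module. Regularity allows the \<open>b\<^sub>a\<close> to be chosen in \<open>U\<close>, and
  induction on the degree shows that \<open>U\<close> is generated in degrees at most \<open>s + 1\<close>. In each such degree
  finitely many elements suffice, by linear algebra. This replaces Hilbert's basis theorem.\<close>

lemma finite_generators: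
  fixes U :: "'k::field mpol vec set"
  assumes V: "finite V" and U: "graded_submodule V ds U" and pos: "\<And>u. u \<in> U \<Longrightarrow> no_constants (length ds) u"
    and r: "vec_regular V ds U s"
  shows "\<exists>L. finite L \<and> L \<subseteq> U \<and> (\<forall>g\<in>L. \<exists>e. level ds e g) \<and> U \<subseteq> vspan V (length ds) L"
proof -
  let ?n = "length ds" and ?X = "indets V"
  have X: "finite ?X" by (rule finite_indets[OF V])
  note D = graded_submoduleD[OF U]
  have dim: "dim_vec u = ?n" if "u \<in> U" for u using D(1)[OF that] by (rule free_moduleD(2))
  define W where "W = (\<lambda>e. {u \<in> U. level ds e u})"
  have "\<exists>L. finite L \<and> L \<subseteq> W e \<and> W e \<subseteq> vspan V ?n L" for e
  proof (rule finite_span_of_bounded_support)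
    let ?T = "\<Union>k<?n. Pair k ` {m. keys m \<subseteq> ?X \<and> mon_degree m = nat (e - ds ! k)}"
    show "finite ?T" using finite_monomials[OF X] by auto
    show "W e \<subseteq> free_module V ?n" using D(1) unfolding W_def by blast
    show "w + single 0 c \<cdot>\<^sub>v u \<in> W e" if "u \<in> W e" "w \<in> W e" for c u w
    proof -
      have "homogeneous (e - ds ! k) (w $ k + single 0 c * u $ k)" if k: "k < ?n" for k
        using homogeneous_mult[OF homogeneous_const, of "e - ds ! k" "u $ k" c] \<open>u \<in> W e\<close> \<open>w \<in> W e\<close> k
        by (intro homogeneous_add) (auto simp: W_def level_def)
      then show ?thesis using that D(3,4) dim by (auto simp: W_def level_def)
    qed
    show "(k, m) \<in> ?T" if w: "w \<in> W e" "k < ?n" "lookup (w $ k) m \<noteq> 0" for w k m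
    proof -
      have m: "m \<in> keys (w $ k)" using w(3) by (simp add: in_keys_iff)
      have "w $ k \<in> polys ?X" "homogeneous (e - ds ! k) (w $ k)"
        using w(1,2) free_moduleD(3)[OF D(1)] by (auto simp: W_def level_def)
      then have "keys m \<subseteq> ?X" "int (mon_degree m) = e - ds ! k"
        using m by (auto simp: polys_def homogeneous_def)
      then show ?thesis using w(2) by (intro UN_I[of k] imageI) auto
    qed
  qed
  then have "\<forall>e. \<exists>L. finite L \<and> L \<subseteq> W e \<and> W e \<subseteq> vspan V ?n L" by (rule allI)
  then obtain Lf where "\<forall>e. finite (Lf e) \<and> Lf e \<subseteq> W e \<and> W e \<subseteq> vspan V ?n (Lf e)"
    by (rule exE[OF choice])
  then have Lf: "\<And>e. finite (Lf e)" "\<And>e. Lf e \<subseteq> W e" "\<And>e. W e \<subseteq> vspan V ?n (Lf e)" by simp_all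
  \<comment> \<open>below \<open>e0\<close> the free module has no nonzero homogeneous elements\<close>
  define e0 where "e0 = Min (insert (s + 1) (set ds))"
  define L where "L = (\<Union>e\<in>{e0..s + 1}. Lf e)"
  have finL: "finite L" unfolding L_def using Lf(1) by simp
  have LU: "L \<subseteq> U" and Lh: "\<forall>g\<in>L. \<exists>e. level ds e g" unfolding L_def using Lf(2) by (auto simp: W_def)
  have LF: "L \<subseteq> free_module V ?n" using LU D(1) by blast
  have lev: "u \<in> vspan V ?n L" if "u \<in> U" "level ds e u" for u e
    using that
  proof (induction "nat (e - (s + 1))" arbitrary: u e rule: less_induct)
    case less
    consider "e < e0" | "e0 \<le> e" "e \<le> s + 1" | "e > s + 1" by linarith
    then show ?case
    proof cases
      case 1
      have "u = 0\<^sub>v ?n"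
      proof (rule eq_vecI)
        fix k assume "k < dim_vec (0\<^sub>v ?n :: 'k mpol vec)"
        then have k: "k < ?n" by simp
        then have "e0 \<le> ds ! k" unfolding e0_def by (intro Min_le) auto
        then have "e - ds ! k < 0" using 1 by simp
        moreover have "homogeneous (e - ds ! k) (u $ k)" using less.prems(2) k by (simp add: level_def)
        ultimately have "u $ k = 0" using homogeneous_negative by blast
        then show "u $ k = 0\<^sub>v ?n $ k" using k by simp
      qed (use dim less.prems in simp)
      then show ?thesis by (simp add: vspan_zero)
    next
      case 2
      then have "Lf e \<subseteq> L" by (auto simp: L_def)
      then have "Lf e \<subseteq> vspan V ?n L" using vspan_base[OF LF] by blast
      then have "vspan V ?n (Lf e) \<subseteq> vspan V ?n L" by (rule vspan_subset[OF LF])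
      then show ?thesis using Lf(3)[of e] less.prems by (auto simp: W_def)
    next
      case 3
      define c where "c = (\<lambda>k B :: indet set. if B = {} then u $ k else 0)"
      have up: "u $ k \<in> polys ?X" if "k < ?n" for k using free_moduleD(3)[OF D(1)[OF less.prems(1)] that] .
      have c1: "c k B \<in> polys ?X" if "k < ?n" for k B using up[OF that] by (simp add: c_def)
      have c0: "lookup (c k B) 0 = 0" if "k < ?n" for k B
        using pos[OF less.prems(1)] that by (simp add: c_def no_constants_def)
      have dc: "koszul ?X (c k) B = 0" for k B
        by (auto simp: koszul_def contract_def c_def intro!: sum.neutral)
      have ch: "homogeneous (e - ds ! k) (c k B)" if "k < ?n" for k B
        using less.prems(2) that by (simp add: c_def level_def)
      have "\<forall>k. \<exists>b. k < ?n \<longrightarrow> (\<forall>B. b B \<in> polys ?X \<and> homogeneous (e - ds ! k - 1) (b B) \<and> koszul ?X b B = c k B)"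
        using koszul_acyclic_graded[OF X c1 c0 dc ch] by blast
      then obtain b where b: "\<forall>k. k < ?n \<longrightarrow> (\<forall>B. b k B \<in> polys ?X \<and> homogeneous (e - ds ! k - 1) (b k B) \<and> koszul ?X (b k) B = c k B)"
        by (rule exE[OF choice])
      have b1: "b k B \<in> polys ?X" and b2: "homogeneous (e - 1 - ds ! k) (b k B)" and b3: "koszul ?X (b k) B = c k B"
        if "k < ?n" for k B
      proof -
        have "e - ds ! k - 1 = e - 1 - ds ! k" by simp
        then show "b k B \<in> polys ?X" "homogeneous (e - 1 - ds ! k) (b k B)" "koszul ?X (b k) B = c k B"
          using b that by metis+
      qed
      have b4: "vec ?n (\<lambda>k. koszul ?X (b k) B) \<in> U" for B
      proof -
        have "vec ?n (\<lambda>k. koszul ?X (b k) B) = (if B = {} then u else 0\<^sub>v ?n)"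
          using dim[OF less.prems(1)] by (cases "B = {}"; intro eq_vecI) (simp_all add: b3 c_def)
        then show ?thesis using less.prems(1) D(2) by simp
      qed
      have e1: "e - 1 > s" using 3 by simp
      obtain f where f: "\<And>k B. k < ?n \<Longrightarrow> f k B \<in> polys ?X" "\<And>B. vec ?n (\<lambda>k. b k B - koszul ?X (f k) B) \<in> U"
        using vec_regularE[OF r e1 b1 b2 b4] by blast
      define w where "w = (\<lambda>a. hcomp_vec ds (e - 1) (vec ?n (\<lambda>k. b k {a} - koszul ?X (f k) {a})))"
      have w: "w a \<in> U" "level ds (e - 1) (w a)" for a
        using D(5)[OF f(2)] by (auto simp: w_def level_hcomp_vec)
      have wv: "w a \<in> vspan V ?n L" for a
        by (rule less.hyps[OF _ w]) (use 3 in simp)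
      have "u = vec ?n (\<lambda>k. \<Sum>a\<in>?X. (var a \<cdot>\<^sub>v w a) $ k)"
      proof (rule eq_vecI)
        fix k assume "k < dim_vec (vec ?n (\<lambda>k. \<Sum>a\<in>?X. (var a \<cdot>\<^sub>v w a) $ k))"
        then have k: "k < ?n" by simp
        have "u $ k = koszul ?X (\<lambda>B. b k B - koszul ?X (f k) B) {}"
          by (simp add: koszul_diff koszul_koszul[OF X] b3[OF k] c_def)
        also have "\<dots> = (\<Sum>a\<in>?X. var a * (b k {a} - koszul ?X (f k) {a}))"
          by (simp add: koszul_def[of ?X "\<lambda>B. b k B - koszul ?X (f k) B"] contract_def koszul_sign_def)
        finally have "hcomp (e - ds ! k) (u $ k) = hcomp (e - ds ! k) (\<Sum>a\<in>?X. var a * (b k {a} - koszul ?X (f k) {a}))"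
          by simp
        also have "\<dots> = (\<Sum>a\<in>?X. var a * w a $ k)"
        proof -
          have idx: "e - ds ! k - 1 = e - 1 - ds ! k" by simp
          show ?thesis by (simp only: hcomp_sum hcomp_var_mult idx) (simp add: w_def hcomp_vec_def k)
        qed
        finally show "u $ k = vec ?n (\<lambda>k. \<Sum>a\<in>?X. (var a \<cdot>\<^sub>v w a) $ k) $ k"
          using k less.prems(2) dim[OF w(1)] by (simp add: level_def hcomp_same)
      qed (use dim less.prems in simp)
      moreover have "vec ?n (\<lambda>k. \<Sum>a\<in>?X. (var a \<cdot>\<^sub>v w a) $ k) \<in> vspan V ?n L"
        by (intro vspan_sum[OF LF] vspan_smult[OF LF] wv polys_var)
      ultimately show ?thesis by simp
    qed
  qed
  have "u \<in> vspan V ?n L" if u: "u \<in> U" for u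
  proof -
    define E where "E = (\<Union>k<?n. (\<lambda>m. int (mon_degree m) + ds ! k) ` keys (u $ k))"
    have E: "finite E" by (simp add: E_def)
    have "u = vec ?n (\<lambda>k. \<Sum>e\<in>E. hcomp_vec ds e u $ k)"
    proof (rule eq_vecI)
      fix k assume "k < dim_vec (vec ?n (\<lambda>k. \<Sum>e\<in>E. hcomp_vec ds e u $ k))"
      then have k: "k < ?n" by simp
      have "u $ k = (\<Sum>d\<in>(\<lambda>e. e - ds ! k) ` E. hcomp d (u $ k))"
        using k E by (intro sum_hcomp) (force simp: E_def)+
      also have "\<dots> = (\<Sum>e\<in>E. hcomp (e - ds ! k) (u $ k))"
        by (subst sum.reindex) (auto simp: inj_on_def)
      finally show "u $ k = vec ?n (\<lambda>k. \<Sum>e\<in>E. hcomp_vec ds e u $ k) $ k" using k by (simp add: hcomp_vec_def)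
    qed (use dim u in simp)
    moreover have "vec ?n (\<lambda>k. \<Sum>e\<in>E. hcomp_vec ds e u $ k) \<in> vspan V ?n L"
      by (rule vspan_sum[OF LF]) (rule lev[OF D(5)[OF u] level_hcomp_vec])
    ultimately show ?thesis by simp
  qed
  then show ?thesis using finL LU Lh by blast
qed

lemma hcomp_degree_0: "hcomp 0 p = single 0 (lookup p 0)"
  by (rule poly_mapping_eqI) (auto simp: hcomp_def lookup_restr lookup_single when_def mon_degree_eq_0)

text \<open>Take a generating set of least cardinality. If a relation had a coefficient with nonzero
  constant term, its homogeneous component in the degree of the corresponding generator would
  express that generator through the others.\<close>

lemma minimal_generators:
  fixes U :: "'k::field mpol vec set"
  assumes V: "finite V" and U: "graded_submodule V ds U" and pos: "\<And>u. u \<in> U \<Longrightarrow> no_constants (length ds) u"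
    and r: "vec_regular V ds U s"
  obtains ds' A where "graded_matrix V ds ds' A"
    "\<And>i j. i < length ds \<Longrightarrow> j < length ds' \<Longrightarrow> lookup (A $$ (i, j)) 0 = 0"
    "U = (\<lambda>w. A *\<^sub>v w) ` free_module V (length ds')"
    "\<And>w. w \<in> free_module V (length ds') \<Longrightarrow> A *\<^sub>v w = 0\<^sub>v (length ds) \<Longrightarrow> no_constants (length ds') w"
proof -
  let ?n = "length ds" and ?X = "indets V"
  note D = graded_submoduleD[OF U]
  define GEN where "GEN = (\<lambda>L. finite L \<and> L \<subseteq> U \<and> (\<forall>g\<in>L. \<exists>e. level ds e g) \<and> U \<subseteq> vspan V ?n L)"
  have "\<exists>L. GEN L" using finite_generators[OF assms] by (simp add: GEN_def)
  then obtain L where L: "GEN L" and least: "\<And>L'. GEN L' \<Longrightarrow> card L \<le> card L'"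
    using ex_has_least_nat[of GEN _ card] by blast
  have finL: "finite L" and LU: "L \<subseteq> U" and Lh: "\<And>g. g \<in> L \<Longrightarrow> \<exists>e. level ds e g" and UL: "U \<subseteq> vspan V ?n L"
    using L by (simp_all add: GEN_def)
  have LF: "L \<subseteq> free_module V ?n" using LU D(1) by blast
  obtain gs where gs: "set gs = L" "distinct gs" using finite_distinct_list[OF finL] by blast
  let ?N = "length gs"
  define ds' where "ds' = map (\<lambda>g. SOME e. level ds e g) gs"
  define A where "A = mat ?n ?N (\<lambda>(i, j). gs ! j $ i)"
  have len: "length ds' = ?N" by (simp add: ds'_def)
  have gL: "gs ! j \<in> L" if "j < ?N" for j using that gs(1) by auto
  have lev: "level ds (ds' ! j) (gs ! j)" if "j < ?N" for j
    using someI_ex[OF Lh[OF gL[OF that]]] that by (simp add: ds'_def)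
  have gp: "gs ! j $ i \<in> polys ?X" if "i < ?n" "j < ?N" for i j
    using free_moduleD(3)[of "gs ! j" V ?n i] gL[OF that(2)] LF that(1) by blast
  have gdim: "dim_vec (gs ! j) = ?n" if "j < ?N" for j
    using free_moduleD(2)[of "gs ! j" V ?n] gL[OF that] LF by blast
  have gh: "homogeneous (ds' ! j - ds ! i) (gs ! j $ i)" if "i < ?n" "j < ?N" for i j
    using lev[OF that(2)] that(1) by (simp add: level_def)
  have Am: "A \<in> carrier_mat ?n ?N" by (simp add: A_def)
  have Aij: "A $$ (i, j) = gs ! j $ i" if "i < ?n" "j < ?N" for i j using that by (simp add: A_def)
  have mult: "A *\<^sub>v w = vec ?n (\<lambda>i. \<Sum>j<?N. gs ! j $ i * w $ j)" if "w \<in> carrier_vec ?N" for w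
    unfolding mult_mat_vec_sum[OF Am that] by (intro eq_vecI) (auto simp: Aij)
  have mult': "A *\<^sub>v w = vec ?n (\<lambda>i. \<Sum>j<?N. (w $ j \<cdot>\<^sub>v gs ! j) $ i)" if "w \<in> carrier_vec ?N" for w
    unfolding mult[OF that] by (intro eq_vecI) (auto simp: gdim mult.commute)
  show ?thesis
  proof (rule that[of ds' A])
    show "graded_matrix V ds ds' A"
      unfolding graded_matrix_def using Am Aij gp gh by (simp add: len carrier_S_ring)
    show "lookup (A $$ (i, j)) 0 = 0" if "i < ?n" "j < length ds'" for i j
      using pos[of "gs ! j"] gL[of j] LU that by (auto simp: no_constants_def len Aij)
    show "U = (\<lambda>w. A *\<^sub>v w) ` free_module V (length ds')"
    proof
      show "(\<lambda>w. A *\<^sub>v w) ` free_module V (length ds') \<subseteq> U"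
      proof
        fix u assume "u \<in> (\<lambda>w. A *\<^sub>v w) ` free_module V (length ds')"
        then obtain w where w: "w \<in> free_module V ?N" "u = A *\<^sub>v w" by (auto simp: len)
        have "vec ?n (\<lambda>i. \<Sum>j<?N. (w $ j \<cdot>\<^sub>v gs ! j) $ i) \<in> U"
        proof (rule graded_submodule_sum[OF U])
          fix j assume "j \<in> {..<?N}"
          then show "w $ j \<cdot>\<^sub>v gs ! j \<in> U"
            using D(4) free_moduleD(3)[OF w(1), of j] gL[of j] LU by blast
        qed
        then show "u \<in> U" using mult'[OF free_moduleD(1)[OF w(1)]] w(2) by simp
      qed
      show "U \<subseteq> (\<lambda>w. A *\<^sub>v w) ` free_module V (length ds')"
      proof
        fix u assume "u \<in> U"
        then have "u \<in> vspan V ?n L" using UL by blast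
        then show "u \<in> (\<lambda>w. A *\<^sub>v w) ` free_module V (length ds')"
          unfolding len
        proof (induction rule: vspan.induct)
          case vspan_zero
          have "A *\<^sub>v 0\<^sub>v ?N = 0\<^sub>v ?n" unfolding mult[OF zero_carrier_vec] by (intro eq_vecI) auto
          then show ?case by (intro image_eqI[where x="0\<^sub>v ?N"] free_module_0) simp
        next
          case (vspan_step p g u)
          then obtain w where w: "w \<in> free_module V ?N" "u = A *\<^sub>v w" by blast
          obtain j where j: "j < ?N" "g = gs ! j" using vspan_step(2) gs(1) by (metis in_set_conv_nth)
          define w' where "w' = vec ?N (\<lambda>i. w $ i + (if i = j then p else 0))"
          have w': "w' \<in> free_module V ?N"
            unfolding w'_def using free_moduleD(3)[OF w(1)] vspan_step(1)
            by (intro vec_free_module) (auto intro: polys_add)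
          have "A *\<^sub>v w' = p \<cdot>\<^sub>v g + u"
          proof (rule eq_vecI)
            fix i assume "i < dim_vec (p \<cdot>\<^sub>v g + u)"
            then have i: "i < ?n" using w Am by simp
            have "(A *\<^sub>v w') $ i = (\<Sum>k<?N. gs ! k $ i * w' $ k)"
              using mult[OF free_moduleD(1)[OF w']] i by simp
            also have "\<dots> = (\<Sum>k<?N. gs ! k $ i * w $ k + (if k = j then gs ! j $ i * p else 0))"
              by (rule sum.cong) (auto simp: w'_def distrib_left)
            also have "\<dots> = (\<Sum>k<?N. gs ! k $ i * w $ k) + gs ! j $ i * p"
              using j by (simp add: sum.distrib)
            also have "\<dots> = (p \<cdot>\<^sub>v g + u) $ i"
              using i j gdim[OF j(1)] mult[OF free_moduleD(1)[OF w(1)]] w(2) by (simp add: mult.commute add.commute)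
            finally show "(A *\<^sub>v w') $ i = (p \<cdot>\<^sub>v g + u) $ i" .
          qed (use w Am in simp)
          then show ?case using w' by (metis imageI)
        qed
      qed
    qed
    show "no_constants (length ds') w" if w: "w \<in> free_module V (length ds')" "A *\<^sub>v w = 0\<^sub>v ?n" for w
      unfolding no_constants_def
    proof (intro allI impI, rule ccontr)
      fix j assume "j < length ds'" and c0: "lookup (w $ j) 0 \<noteq> 0"
      then have j: "j < ?N" by (simp add: len)
      have wF: "w \<in> free_module V ?N" using w(1) by (simp add: len)
      define c where "c = lookup (w $ j) 0"
      \<comment> \<open>the component of the relation \<open>w\<close> in the degree of the generator \<open>gs ! j\<close>\<close>
      define v where "v = (\<lambda>i. hcomp (ds' ! j - ds' ! i) (w $ i))"
      have vp: "v i \<in> polys ?X" if "i < ?N" for i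
        using free_moduleD(3)[OF wF that] by (simp add: v_def hcomp_polys)
      have vj: "v j = single 0 c" by (simp add: v_def hcomp_degree_0 c_def)
      have rel: "(\<Sum>i<?N. gs ! i $ k * v i) = 0" if k: "k < ?n" for k
      proof -
        have "(\<Sum>i<?N. gs ! i $ k * w $ i) = (A *\<^sub>v w) $ k"
          using mult[OF free_moduleD(1)[OF wF]] k by simp
        then have "hcomp (ds' ! j - ds ! k) (\<Sum>i<?N. gs ! i $ k * w $ i) = 0" using w(2) k by simp
        moreover have "hcomp (ds' ! j - ds ! k) (\<Sum>i<?N. gs ! i $ k * w $ i) = (\<Sum>i<?N. gs ! i $ k * v i)"
          unfolding hcomp_sum
        proof (rule sum.cong[OF refl])
          fix i assume "i \<in> {..<?N}"
          then have "hcomp (ds' ! j - ds ! k) (gs ! i $ k * w $ i)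
              = gs ! i $ k * hcomp (ds' ! j - ds ! k - (ds' ! i - ds ! k)) (w $ i)"
            by (intro hcomp_mult gh k) simp
          then show "hcomp (ds' ! j - ds ! k) (gs ! i $ k * w $ i) = gs ! i $ k * v i" by (simp add: v_def)
        qed
        ultimately show ?thesis by simp
      qed
      define q where "q = (\<lambda>i. single 0 (- (1 / c)) * v i)"
      let ?L' = "L - {gs ! j}"
      have L'F: "?L' \<subseteq> free_module V ?n" using LF by blast
      have "gs ! j = vec ?n (\<lambda>k. \<Sum>i\<in>{..<?N} - {j}. (q i \<cdot>\<^sub>v gs ! i) $ k)"
      proof (rule eq_vecI)
        fix k assume "k < dim_vec (vec ?n (\<lambda>k. \<Sum>i\<in>{..<?N} - {j}. (q i \<cdot>\<^sub>v gs ! i) $ k))"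
        then have k: "k < ?n" by simp
        have s: "(\<Sum>i\<in>{..<?N} - {j}. gs ! i $ k * v i) = - (gs ! j $ k * single 0 c)"
          using rel[OF k] j by (simp add: sum.remove[of "{..<?N}" j] vj eq_neg_iff_add_eq_0 add.commute)
        have "(\<Sum>i\<in>{..<?N} - {j}. (q i \<cdot>\<^sub>v gs ! i) $ k)
            = (\<Sum>i\<in>{..<?N} - {j}. single 0 (- (1 / c)) * (gs ! i $ k * v i))"
          using k by (intro sum.cong) (auto simp: q_def gdim mult.commute mult.left_commute)
        also have "\<dots> = single 0 (- (1 / c)) * - (gs ! j $ k * single 0 c)"
          by (simp only: s flip: sum_distrib_left)
        also have "\<dots> = gs ! j $ k * (single 0 (1 / c) * single 0 c)"
          by (simp add: single_uminus mult.left_commute)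
        also have "\<dots> = gs ! j $ k" using c0 by (simp add: mult_single c_def)
        finally show "gs ! j $ k = vec ?n (\<lambda>k. \<Sum>i\<in>{..<?N} - {j}. (q i \<cdot>\<^sub>v gs ! i) $ k) $ k"
          using k by simp
      qed (use gdim[OF j] in simp)
      moreover have "vec ?n (\<lambda>k. \<Sum>i\<in>{..<?N} - {j}. (q i \<cdot>\<^sub>v gs ! i) $ k) \<in> vspan V ?n ?L'"
      proof (rule vspan_sum[OF L'F])
        fix i assume i: "i \<in> {..<?N} - {j}"
        then have "gs ! i \<noteq> gs ! j" using gs(2) j by (simp add: nth_eq_iff_index_eq)
        then have "gs ! i \<in> ?L'" using gL[of i] i by simp
        moreover have "q i \<in> polys ?X" using vp[of i] i by (auto simp: q_def intro!: polys_mult)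
        ultimately show "q i \<cdot>\<^sub>v gs ! i \<in> vspan V ?n ?L'"
          by (intro vspan_smult[OF L'F] vspan_base[OF L'F])
      qed
      ultimately have gj: "gs ! j \<in> vspan V ?n ?L'" by simp
      have "L \<subseteq> vspan V ?n ?L'"
      proof
        fix g assume "g \<in> L"
        then show "g \<in> vspan V ?n ?L'"
          using gj vspan_base[OF L'F, of g] by (cases "g = gs ! j") simp_all
      qed
      then have "U \<subseteq> vspan V ?n ?L'" using UL vspan_subset[OF L'F] by blast
      then have "GEN ?L'" using finL LU Lh by (auto simp: GEN_def)
      then have "card L \<le> card ?L'" by (rule least)
      moreover have "card ?L' < card L" using finL gL[OF j] by (intro card_Diff1_less)
      ultimately show False by simp
    qed
  qed
qed

section \<open>Minimal graded free resolutions\<close>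

lemma kernel_graded_submodule:
  fixes A :: "'k::field mpol mat"
  assumes A: "graded_matrix V ds ds' A"
  shows "graded_submodule V ds' {w \<in> free_module V (length ds'). A *\<^sub>v w = 0\<^sub>v (length ds)}"
proof -
  let ?n = "length ds" and ?n' = "length ds'"
  have Am: "A \<in> carrier_mat ?n ?n'" using A by (simp add: graded_matrix_def)
  have Ah: "homogeneous (ds' ! c - ds ! r) (A $$ (r, c))" if "r < ?n" "c < ?n'" for r c
    using A that by (simp add: graded_matrix_def)
  have iff: "A *\<^sub>v w = 0\<^sub>v ?n \<longleftrightarrow> (\<forall>r<?n. (\<Sum>c<?n'. A $$ (r, c) * w $ c) = 0)" if "dim_vec w = ?n'" for w
  proof -
    have "w \<in> carrier_vec ?n'" using that by (metis carrier_vec_dim_vec)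
    then show ?thesis unfolding mult_mat_vec_sum[OF Am \<open>w \<in> carrier_vec ?n'\<close>] by (auto simp: vec_eq_iff)
  qed
  show ?thesis
    unfolding graded_submodule_def
  proof (intro conjI ballI allI subsetI)
    show "0\<^sub>v ?n' \<in> {w \<in> free_module V ?n'. A *\<^sub>v w = 0\<^sub>v ?n}" by (simp add: free_module_0 iff)
  next
    fix u w assume "u \<in> {w \<in> free_module V ?n'. A *\<^sub>v w = 0\<^sub>v ?n}" "w \<in> {w \<in> free_module V ?n'. A *\<^sub>v w = 0\<^sub>v ?n}"
    then show "u + w \<in> {w \<in> free_module V ?n'. A *\<^sub>v w = 0\<^sub>v ?n}"
      using free_moduleD(2)[of u V ?n'] free_moduleD(2)[of w V ?n']
      by (auto simp: free_module_add iff distrib_left sum.distrib)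
  next
    fix p :: "'k mpol" and u assume "p \<in> polys (indets V)" "u \<in> {w \<in> free_module V ?n'. A *\<^sub>v w = 0\<^sub>v ?n}"
    then show "p \<cdot>\<^sub>v u \<in> {w \<in> free_module V ?n'. A *\<^sub>v w = 0\<^sub>v ?n}"
      using free_moduleD(2)[of u V ?n']
      by (auto simp: free_module_smult iff mult.left_commute[of _ p] simp flip: sum_distrib_left)
  next
    fix e u assume u: "u \<in> {w \<in> free_module V ?n'. A *\<^sub>v w = 0\<^sub>v ?n}"
    then have uF: "u \<in> free_module V ?n'" and dim: "dim_vec u = ?n'" using free_moduleD(2)[of u V ?n'] by auto
    have "(\<Sum>c<?n'. A $$ (r, c) * hcomp (e - ds' ! c) (u $ c)) = 0" if r: "r < ?n" for r
    proof -
      have "(\<Sum>c<?n'. A $$ (r, c) * hcomp (e - ds' ! c) (u $ c)) = (\<Sum>c<?n'. hcomp (e - ds ! r) (A $$ (r, c) * u $ c))"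
      proof (rule sum.cong[OF refl])
        fix c assume "c \<in> {..<?n'}"
        then have "hcomp (e - ds ! r) (A $$ (r, c) * u $ c) = A $$ (r, c) * hcomp (e - ds ! r - (ds' ! c - ds ! r)) (u $ c)"
          by (intro hcomp_mult Ah r) simp
        then show "A $$ (r, c) * hcomp (e - ds' ! c) (u $ c) = hcomp (e - ds ! r) (A $$ (r, c) * u $ c)" by simp
      qed
      also have "\<dots> = hcomp (e - ds ! r) (\<Sum>c<?n'. A $$ (r, c) * u $ c)" by (simp add: hcomp_sum)
      also have "\<dots> = 0" using u r iff[OF dim] by simp
      finally show ?thesis .
    qed
    then show "hcomp_vec ds' e u \<in> {w \<in> free_module V ?n'. A *\<^sub>v w = 0\<^sub>v ?n}"
      using free_moduleD(3)[OF uF] by (auto simp: hcomp_vec_def iff intro!: vec_free_module hcomp_polys)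
  qed auto
qed

text \<open>Each syzygy module inherits the hypotheses of \<open>minimal_generators\<close> from the preceding one, with
  the bound raised by one, so the resolution is built by dependent choice.\<close>

theorem minimal_resolution_exists:
  fixes I :: "'k::field mpol set"
  assumes V: "finite V" and I: "hom_ideal (indets V) I" and pos: "\<And>p. p \<in> I \<Longrightarrow> lookup p 0 = 0"
    and r: "regular (indets V) I r"
  shows "\<exists>d a D. minimal_graded_free_resolution V I d a D"
proof -
  let ?X = "indets V"
  note II = hom_ideal_ideal[OF I]
  define a where "a = vec 1 (\<lambda>_. 1 :: 'k mpol)"
  \<comment> \<open>the zeroth term is \<open>S\<close> itself, with basis element \<open>1\<close> in degree \<open>0\<close>\<close>
  define U0 where "U0 = {v \<in> free_module V (length [0::int]). a \<bullet> v \<in> I}"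
  have dot: "a \<bullet> v = v $ 0" if "dim_vec v = 1" for v using that by (simp add: a_def scalar_prod_def)
  have U0_iff: "v \<in> U0 \<longleftrightarrow> v \<in> free_module V 1 \<and> v $ 0 \<in> I" for v
    using dot[of v] free_moduleD(2)[of v V 1] by (auto simp: U0_def)
  have aF: "a \<in> free_module V (length [0::int])" by (auto simp: a_def intro: vec_free_module)
  have surj: "\<exists>v\<in>free_module V (length [0::int]). p - a \<bullet> v \<in> I" if "p \<in> polys ?X" for p
    using that ideal_0[OF II] by (intro bexI[of _ "vec 1 (\<lambda>_. p)"]) (auto simp: dot intro: vec_free_module)
  have ah: "homogeneous ([0] ! k) (a $ k)" if "k < length [0::int]" for k using that by (simp add: a_def)
  have reg0: "vec_regular V [0] U0 r"
    unfolding U0_def by (rule vec_regular_quotient[OF aF ah II r surj])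
  have sub0: "graded_submodule V [0] U0"
    unfolding graded_submodule_def
  proof (intro conjI ballI allI subsetI)
    fix u w assume uw: "u \<in> U0" "w \<in> U0"
    then show "u + w \<in> U0"
      using free_module_add[of u V 1 w] ideal_add[OF II] free_moduleD(2)[of w V 1] by (simp add: U0_iff)
  next
    fix p :: "'k mpol" and u assume "p \<in> polys ?X" "u \<in> U0"
    then show "p \<cdot>\<^sub>v u \<in> U0"
      using free_module_smult[of p V u 1] ideal_mult[OF II] free_moduleD(2)[of u V 1] by (simp add: U0_iff)
  next
    fix e u assume "u \<in> U0"
    then show "hcomp_vec [0] e u \<in> U0"
      using hom_ideal_hcomp[OF I] free_moduleD(3)[of u V 1 0]
      by (auto simp: U0_iff hcomp_vec_def intro!: vec_free_module hcomp_polys)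
  qed (use ideal_0[OF II] free_module_0[of 1 V] in \<open>auto simp: U0_iff\<close>)
  have pos0: "no_constants 1 u" if "u \<in> U0" for u using that pos by (simp add: U0_iff no_constants_def)
  define P where "P = (\<lambda>i (ds, U :: 'k mpol vec set). (i = (0::nat) \<longrightarrow> (ds, U) = ([0], U0)) \<and>
     graded_submodule V ds U \<and> (\<forall>u\<in>U. no_constants (length ds) u) \<and> vec_regular V ds U (r + int i))"
  define Q where "Q = (\<lambda>(ds, U :: 'k mpol vec set) (ds', U'). \<exists>A. graded_matrix V ds ds' A \<and>
     (\<forall>i<length ds. \<forall>j<length ds'. lookup (A $$ (i, j)) 0 = 0) \<and>
     U = (\<lambda>w. A *\<^sub>v w) ` free_module V (length ds') \<and>
     U' = {w \<in> free_module V (length ds'). A *\<^sub>v w = 0\<^sub>v (length ds)})"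
  have "\<exists>f. \<forall>i. P i (f i) \<and> Q (f i) (f (Suc i))"
  proof (rule dependent_nat_choice)
    show "\<exists>x. P 0 x" using sub0 pos0 reg0 by (intro exI[of _ "([0], U0)"]) (simp add: P_def)
    fix x i assume "P i x"
    then obtain ds U where x: "x = (ds, U)" "graded_submodule V ds U" "\<And>u. u \<in> U \<Longrightarrow> no_constants (length ds) u"
      "vec_regular V ds U (r + int i)" by (cases x) (auto simp: P_def)
    obtain ds' A where A: "graded_matrix V ds ds' A"
      "\<And>i j. i < length ds \<Longrightarrow> j < length ds' \<Longrightarrow> lookup (A $$ (i, j)) 0 = 0"
      "U = (\<lambda>w. A *\<^sub>v w) ` free_module V (length ds')"
      "\<And>w. w \<in> free_module V (length ds') \<Longrightarrow> A *\<^sub>v w = 0\<^sub>v (length ds) \<Longrightarrow> no_constants (length ds') w"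
      using minimal_generators[OF V x(2,3,4)] by blast
    define U' where "U' = {w \<in> free_module V (length ds'). A *\<^sub>v w = 0\<^sub>v (length ds)}"
    have idx: "r + int i + 1 = r + int (Suc i)" by simp
    have "vec_regular V ds' U' (r + int (Suc i))"
      unfolding U'_def idx[symmetric]
      by (rule vec_regular_syzygies[OF V A(1) A(2)]) (use x(4) A(3) in simp_all)
    then have "P (Suc i) (ds', U')"
      using kernel_graded_submodule[OF A(1)] A(4) unfolding P_def U'_def by simp
    moreover have "Q x (ds', U')" unfolding Q_def x(1) using A(1,2,3) by (auto simp: U'_def)
    ultimately show "\<exists>y. P (Suc i) y \<and> Q x y" by blast
  qed
  then obtain f where f: "\<And>i. P i (f i)" "\<And>i. Q (f i) (f (Suc i))" by blast
  define d where "d = (\<lambda>i. fst (f i))"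
  define U where "U = (\<lambda>i. snd (f i))"
  have fdU: "f i = (d i, U i)" for i by (simp add: d_def U_def)
  have "\<forall>i. \<exists>A. graded_matrix V (d i) (d (Suc i)) A \<and>
     (\<forall>k<length (d i). \<forall>j<length (d (Suc i)). lookup (A $$ (k, j)) 0 = 0) \<and>
     U i = (\<lambda>w. A *\<^sub>v w) ` free_module V (length (d (Suc i))) \<and>
     U (Suc i) = {w \<in> free_module V (length (d (Suc i))). A *\<^sub>v w = 0\<^sub>v (length (d i))}"
    using f(2) unfolding fdU Q_def by simp
  then obtain D where DD: "\<forall>i. graded_matrix V (d i) (d (Suc i)) (D i) \<and>
     (\<forall>k<length (d i). \<forall>j<length (d (Suc i)). lookup (D i $$ (k, j)) 0 = 0) \<and>
     U i = (\<lambda>w. D i *\<^sub>v w) ` free_module V (length (d (Suc i))) \<and>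
     U (Suc i) = {w \<in> free_module V (length (d (Suc i))). D i *\<^sub>v w = 0\<^sub>v (length (d i))}"
    by (rule exE[OF choice])
  have DD1: "graded_matrix V (d i) (d (Suc i)) (D i)"
    and DD2: "\<And>k j. k < length (d i) \<Longrightarrow> j < length (d (Suc i)) \<Longrightarrow> lookup (D i $$ (k, j)) 0 = 0"
    and DD3: "U i = (\<lambda>w. D i *\<^sub>v w) ` free_module V (length (d (Suc i)))"
    and DD4: "U (Suc i) = {w \<in> free_module V (length (d (Suc i))). D i *\<^sub>v w = 0\<^sub>v (length (d i))}" for i
    using DD[rule_format, of i] by blast+
  have d0: "d 0 = [0]" and U00: "U 0 = U0" using f(1)[of 0] by (simp_all add: fdU P_def)
  have "minimal_graded_free_resolution V I d a D"
    unfolding minimal_graded_free_resolution_def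
  proof (intro conjI allI impI ballI)
    show "a \<in> free_module V (length (d 0))" using aF by (simp add: d0)
    show "homogeneous (d 0 ! k) (a $ k)" if "k < length (d 0)" for k using ah that by (simp add: d0)
    show "graded_matrix V (d i) (d (Suc i)) (D i)" for i by (rule DD1)
    show "\<exists>v\<in>free_module V (length (d 0)). p - a \<bullet> v \<in> I" if "p \<in> carrier (S_ring V)" for p
      using surj that by (simp add: d0 carrier_S_ring)
    show "{v \<in> free_module V (length (d 0)). a \<bullet> v \<in> I} = (\<lambda>w. D 0 *\<^sub>v w) ` free_module V (length (d 1))"
      using DD3[of 0] U00 by (simp add: U0_def d0)
    show "{v \<in> free_module V (length (d (Suc i))). D i *\<^sub>v v = 0\<^sub>v (length (d i))} =
       (\<lambda>w. D (Suc i) *\<^sub>v w) ` free_module V (length (d (Suc (Suc i))))" for i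
      using DD3[of "Suc i"] DD4[of i] by simp
    show "D i $$ (k, c) \<in> irrelevant_ideal V" if "k < length (d i)" "c < length (d (Suc i))" for i k c
      using DD1[of i] DD2[OF that] that by (simp add: irrelevant_ideal_iff graded_matrix_def carrier_S_ring)
  qed
  then show ?thesis by blast
qed

text \<open>The upper bound is dimension shifting. For the lower bound, minimality implies that no basis
  element is mapped to zero in the preceding term, and that the nonzero entries of the differentials have positive degree.\<close>

theorem minimal_resolution_degrees:
  fixes I :: "'k::field mpol set"
  assumes V: "finite V" and I: "is_ideal (indets V) I" and r: "regular (indets V) I r"
    and R: "minimal_graded_free_resolution V I d a D" and k: "k < length (d i)"
  shows "int i \<le> d i ! k" "d i ! k \<le> r + int i"
proof -
  let ?X = "indets V"
  note R1 = R[unfolded minimal_graded_free_resolution_def carrier_S_ring One_nat_def]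
  note R2 = conjunct2[OF R1] note R3 = conjunct2[OF R2] note R4 = conjunct2[OF R3]
  note R5 = conjunct2[OF R4] note R6 = conjunct2[OF R5] note R7 = conjunct2[OF R6]
  note a = conjunct1[OF R1] conjunct1[OF R2, rule_format] and gm = conjunct1[OF R3, rule_format]
    and surj = conjunct1[OF R4, rule_format] and ex0 = conjunct1[OF R5]
    and ex = conjunct1[OF R6, rule_format] and irr = R7[rule_format]
  define U where "U = (\<lambda>i. (\<lambda>w. D i *\<^sub>v w) ` free_module V (length (d (Suc i))))"
  have Dm: "D i \<in> carrier_mat (length (d i)) (length (d (Suc i)))" for i
    using gm[of i] by (simp add: graded_matrix_def)
  have D0: "lookup (D i $$ (k, c)) 0 = 0" if "k < length (d i)" "c < length (d (Suc i))" for i k c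
    using irr[OF that] by (simp add: irrelevant_ideal_iff)
  have Upos: "no_constants (length (d i)) u" if u: "u \<in> U i" for i u
  proof -
    obtain w where w: "w \<in> free_module V (length (d (Suc i)))" "u = D i *\<^sub>v w" using u by (auto simp: U_def)
    show ?thesis
      unfolding no_constants_def
    proof (intro allI impI)
      fix k assume k: "k < length (d i)"
      have "lookup (D i $$ (k, c) * w $ c) 0 = 0" if "c < length (d (Suc i))" for c
        using lookup_0_mult[OF D0[OF k that], of "w $ c"] by (simp add: mult.commute)
      then show "lookup (u $ k) 0 = 0"
        unfolding w(2) mult_mat_vec_sum[OF Dm free_moduleD(1)[OF w(1)]] using k by (simp add: lookup_sum)
    qed
  qed
  have Uz: "0\<^sub>v (length (d i)) \<in> U i" for i
  proof -
    have "D i *\<^sub>v 0\<^sub>v (length (d (Suc i))) = 0\<^sub>v (length (d i))"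
      using mult_mat_vec_sum[OF Dm, of "0\<^sub>v (length (d (Suc i)))" i] by (auto simp: vec_eq_iff)
    then show ?thesis unfolding U_def using free_module_0 by (metis imageI)
  qed
  have reg: "vec_regular V (d i) (U i) (r + int i)" for i
  proof (induction i)
    case 0
    have "vec_regular V (d 0) {v \<in> free_module V (length (d 0)). a \<bullet> v \<in> I} r"
      by (rule vec_regular_quotient[OF a I r surj])
    then show ?case by (simp add: U_def ex0)
  next
    case (Suc i)
    have "vec_regular V (d (Suc i)) {v \<in> free_module V (length (d (Suc i))). D i *\<^sub>v v = 0\<^sub>v (length (d i))} (r + int i + 1)"
      by (rule vec_regular_syzygies[OF V gm D0 Suc[unfolded U_def]])
    moreover have "r + int i + 1 = r + int (Suc i)" by simp
    ultimately show ?case unfolding U_def ex by (simp only:)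
  qed
  show "d i ! k \<le> r + int i" by (rule vec_regular_bound[OF reg Upos Uz k])
  have unit: "unit_vec (length (d i)) k \<notin> U i" if "k < length (d i)" for i k
  proof
    assume "unit_vec (length (d i)) k \<in> U i"
    then have "lookup (unit_vec (length (d i)) k $ k :: 'k mpol) 0 = 0"
      using Upos that unfolding no_constants_def by blast
    then show False using that by simp
  qed
  have unitF: "unit_vec n k \<in> free_module V n" for n k
    by (auto simp: free_module_iff unit_vec_def)
  have lower: "\<forall>k<length (d i). int i \<le> d i ! k" for i
  proof (induction i)
    case 0
    show ?case
    proof (intro allI impI)
      fix k assume k: "k < length (d 0)"
      have "a \<bullet> unit_vec (length (d 0)) k = a $ k"
        using a(1) k by (intro scalar_prod_right_unit) (auto simp: free_module_iff)
      moreover have "a \<bullet> unit_vec (length (d 0)) k \<notin> I"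
        using unit[OF k] unitF[of "length (d 0)" k] ex0 unfolding U_def by blast
      ultimately have "a $ k \<noteq> 0" using ideal_0[OF I] by metis
      then have "\<not> d 0 ! k < 0" using homogeneous_negative[OF a(2)[OF k]] by blast
      then show "int 0 \<le> d 0 ! k" by simp
    qed
  next
    case (Suc i)
    show ?case
    proof (intro allI impI)
      fix k assume k: "k < length (d (Suc i))"
      let ?u = "unit_vec (length (d (Suc i))) k :: 'k mpol vec"
      have "D i *\<^sub>v ?u \<noteq> 0\<^sub>v (length (d i))"
        using unit[OF k] unitF[of "length (d (Suc i))" k] ex[of i] unfolding U_def by blast
      moreover have "D i *\<^sub>v ?u = vec (length (d i)) (\<lambda>j. D i $$ (j, k))"
        using Dm[of i] k by (intro eq_vecI) (auto simp: scalar_prod_right_unit)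
      ultimately obtain j where j: "j < length (d i)" "D i $$ (j, k) \<noteq> 0" by (auto simp: vec_eq_iff)
      have h: "homogeneous (d (Suc i) ! k - d i ! j) (D i $$ (j, k))"
        using gm[of i] j(1) k by (simp add: graded_matrix_def)
      have "\<not> d (Suc i) ! k - d i ! j < 0" using homogeneous_negative[OF h] j(2) by blast
      moreover have "d (Suc i) ! k - d i ! j \<noteq> 0"
      proof
        assume "d (Suc i) ! k - d i ! j = 0"
        then have "homogeneous 0 (D i $$ (j, k))" using h by (simp only:)
        then have "D i $$ (j, k) = single 0 (lookup (D i $$ (j, k)) 0)"
          using hcomp_same hcomp_degree_0 by metis
        then show False using D0[OF j(1) k] j(2) by (metis single_zero)
      qed
      ultimately show "int (Suc i) \<le> d (Suc i) ! k" using Suc[rule_format, OF j(1)] by linarith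
    qed
  qed
  show "int i \<le> d i ! k" using lower k by blast
qed

text \<open>The lower bound on the degrees and the nonvanishing of \<open>F\<^sub>0\<close> ensure that the maximum in the
  definition of \<open>reg\<close> is taken over a finite nonempty set.\<close>

theorem reg_le:
  fixes I :: "'k::field mpol set"
  assumes V: "finite V" and I: "hom_ideal (indets V) I" and pos: "\<And>p. p \<in> I \<Longrightarrow> lookup p 0 = 0"
    and r: "regular (indets V) I r"
  shows "reg V I \<le> r"
proof -
  define d where "d = (SOME d. \<exists>a D. minimal_graded_free_resolution V I d a D)"
  have "\<exists>a D. minimal_graded_free_resolution V I d a D"
    unfolding d_def by (rule someI_ex[OF minimal_resolution_exists[OF V I pos r]])
  then obtain a D where R: "minimal_graded_free_resolution V I d a D" by blast
  note II = hom_ideal_ideal[OF I]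
  let ?S = "{j - int i |i j. betti V I i j \<noteq> 0}"
  have betti: "betti V I i j \<noteq> 0 \<longleftrightarrow> j \<in> set (d i)" for i j
    by (simp add: betti_def count_list_0_iff flip: d_def)
  have S: "s \<in> {0..r}" if s: "s \<in> ?S" for s
  proof -
    from s obtain i j where ij: "s = j - int i" "betti V I i j \<noteq> 0" by blast
    then have "j \<in> set (d i)" using betti[of i j] by simp
    then obtain k where "k < length (d i)" "j = d i ! k" unfolding in_set_conv_nth by blast
    then show ?thesis using minimal_resolution_degrees[OF V II r R, of k i] ij(1) by simp
  qed
  have "?S \<subseteq> {0..r}" by (rule subsetI) (rule S)
  then have fin: "finite ?S" by (rule finite_subset) simp
  have "d 0 \<noteq> []"
  proof
    assume "d 0 = []"
    note R1 = R[unfolded minimal_graded_free_resolution_def carrier_S_ring]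
    note surj = conjunct1[OF conjunct2[OF conjunct2[OF conjunct2[OF R1]]]]
    obtain v where v: "v \<in> free_module V (length (d 0))" "1 - a \<bullet> v \<in> I"
      using bspec[OF surj polys_1] by (rule bexE)
    then have "a \<bullet> v = 0" using free_moduleD(2)[OF v(1)] \<open>d 0 = []\<close> by (simp add: scalar_prod_def)
    then have "(1 :: 'k mpol) \<in> I" using v(2) by simp
    then show False using pos[of 1] by simp
  qed
  then have "d 0 ! 0 - int 0 \<in> ?S" using betti[of 0 "d 0 ! 0"] by fastforce
  then have "?S \<noteq> {}" by blast
  then have "Max ?S \<le> r \<longleftrightarrow> (\<forall>s\<in>?S. s \<le> r)" by (rule Max_le_iff[OF fin])
  moreover have "s \<le> r" if "s \<in> ?S" for s using S[OF that] by simp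
  ultimately show ?thesis unfolding reg_def by blast
qed

theorem theorem2p3:
  fixes n :: nat and G :: "nat graph" and \<phi> :: "nat graph \<Rightarrow> nat"
  assumes "is_graph G" and "verts G = {1..n}"
    and "compatible \<phi>"
  shows "reg {1..n} (binomial_edge_ideal G :: 'k::field mpol set) \<le> int (\<phi> G)"
proof -
  let ?J = "gen (indets {1..n}) (edge_binomials G) :: 'k mpol set"
  have vG: "verts G \<subseteq> {1..n}" by (simp add: assms(2))
  have J: "binomial_edge_ideal G = ?J" using binomial_edge_ideal_gen[OF assms(1)] by (simp add: assms(2))
  have "lookup p 0 = 0" if "p \<in> ?J" for p
    using that
  proof (induction rule: gen.induct)
    case (gen_step p a q)
    have "lookup a 0 = 0"
      using gen_step(2) homogeneous_lookup_0[OF homogeneous_edge_binomial] by (auto simp: edge_binomials_def)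
    then show ?case using gen_step by (simp add: lookup_add lookup_0_mult)
  qed simp
  then show ?thesis
    unfolding J
    by (rule reg_le[OF finite_atLeastAtMost edge_binomials_hom_ideal[OF assms(1) vG] _
          regular_compatible[OF finite_atLeastAtMost assms(3,1) vG]])
qed

end
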